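(* Let $\mathbb{N}_+$ be the set of strictly positive integers and let $C:\mathbb{N}_+\rightarrow\mathbb{N}_+$ be the Collatz function, $C(n)=3n+1$ for $n$ odd and $C(n)=n/2$ for $n$ even. Let $P(C)$ be the presentation 2-complex associated to the group presentation \[\mathcal{P}(C):=\langle a_i,\ i\in\mathbb{N}_+ \ :\ a_{C(i)}^{-1}a_ia_{C(i)}=a_i^2,\ i\in\mathbb{N}_+\rangle.\] Then $P(C)$ is contractible if and only if the Collatz conjecture holds, i.e., if and only if every forward orbit $\{i,C(i),C^2(i),\ldots\}$, $i\in\mathbb{N}_+$, contains $1$.
   Context: The presentation 2-complex of a group presentation is the CW-complex with one 0-cell, 1-cells in bijective correspondence with the generators, and 2-cells in bijective correspondence with the relators, where the 2-cell of a relator is attached along the loop in the 1-skeleton (a rose) spelled by the relator; relators are taken to be cyclically reduced words. In $\mathcal{P}(C)$ both generators and relators are indexed by $\mathbb{N}_+$. *)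

theory Defs
  imports "HOL-Analysis.Analysis"
begin

section \<open>Quotient topologies\<close>

definition quotient_topology :: "'a topology \<Rightarrow> ('a \<Rightarrow> 'b) \<Rightarrow> 'b topology" where
  "quotient_topology X q =
     topology (\<lambda>U. U \<subseteq> q ` topspace X \<and> openin X {x \<in> topspace X. q x \<in> U})"

lemma istopology_quotient:
  "istopology (\<lambda>U. U \<subseteq> q ` topspace X \<and> openin X {x \<in> topspace X. q x \<in> U})"
proof -
  have Int: "{x \<in> topspace X. q x \<in> S \<inter> T} =
      {x \<in> topspace X. q x \<in> S} \<inter> {x \<in> topspace X. q x \<in> T}" for S T
    by auto
  have Un: "{x \<in> topspace X. q x \<in> \<Union>\<K>} = (\<Union>K\<in>\<K>. {x \<in> topspace X. q x \<in> K})" for \<K>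
    by auto
  show ?thesis
    unfolding istopology_def Int Un by blast
qed

lemma openin_quotient_topology:
  "openin (quotient_topology X q) U \<longleftrightarrow>
     U \<subseteq> q ` topspace X \<and> openin X {x \<in> topspace X. q x \<in> U}"
  by (simp add: quotient_topology_def istopology_quotient)

lemma topspace_quotient_topology [simp]:
  "topspace (quotient_topology X q) = q ` topspace X"
proof -
  have "{x \<in> topspace X. q x \<in> q ` topspace X} = topspace X"
    by auto
  then have "openin (quotient_topology X q) (q ` topspace X)"
    by (simp add: openin_quotient_topology)
  then show ?thesis
    by (meson openin_quotient_topology openin_subset openin_topspace subset_antisym)
qed

lemma quotient_map_quotient_topology:
  "quotient_map X (quotient_topology X q) q"
  by (auto simp: quotient_map_def openin_quotient_topology)


section \<open>Words and group presentations\<close>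

text \<open>The letter \<open>(g, True)\<close> stands for the generator \<open>g\<close>, the letter \<open>(g, False)\<close> for its inverse.\<close>

type_synonym 'g word = "('g \<times> bool) list"

definition inverse_word :: "'g word \<Rightarrow> 'g word" where
  "inverse_word w = rev (map (\<lambda>(g, e). (g, \<not> e)) w)"

definition cyclically_reduced :: "'g word \<Rightarrow> bool" where
  "cyclically_reduced w \<longleftrightarrow>
     (\<forall>k < length w. w ! (Suc k mod length w) \<noteq> (fst (w ! k), \<not> snd (w ! k)))"

record ('g, 'r) presentation =
  generators :: "'g set"
  relator_index :: "'r set"
  relator :: "'r \<Rightarrow> 'g word"


section \<open>The presentation complex\<close>

datatype ('g, 'r) cell = Vertex | Edge 'g | Face 'r

definition cells :: "('g, 'r) presentation \<Rightarrow> ('g, 'r) cell set" where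
  "cells P = {Vertex} \<union> Edge ` generators P \<union> Face ` relator_index P"

text \<open>All closed cells are modelled inside the complex plane; a closed 1-cell is the real
  interval from 0 to 1.\<close>

primrec closed_cell :: "('g, 'r) cell \<Rightarrow> complex set" where
  "closed_cell Vertex = {0}"
| "closed_cell (Edge g) = of_real ` {0..1}"
| "closed_cell (Face r) = cball 0 1"

text \<open>A point of the complex is represented by the unique pair \<open>(c, z)\<close> where \<open>c\<close> is the cell
  whose interior contains it and \<open>z\<close> is its position in \<open>c\<close>. The next functions
  compute these representatives: \<open>edge_point g\<close> runs once around the circle of \<open>g\<close>,
  \<open>word_loop w\<close> runs through the letters of \<open>w\<close> at constant speed (and is constant
  for the empty word), and \<open>glue P\<close> is the map identifying the boundary of each closed cell
  with its image in the lower skeleton.\<close>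

definition edge_point :: "'g \<Rightarrow> real \<Rightarrow> ('g, 'r) cell \<times> complex" where
  "edge_point g t = (if 0 < t \<and> t < 1 then (Edge g, of_real t) else (Vertex, 0))"

definition word_loop :: "'g word \<Rightarrow> real \<Rightarrow> ('g, 'r) cell \<times> complex" where
  "word_loop w s =
     (let x = real (length w) * s; k = nat \<lfloor>x\<rfloor> in
      if k < length w
      then edge_point (fst (w ! k)) (if snd (w ! k) then frac x else 1 - frac x)
      else (Vertex, 0))"

fun glue :: "('g, 'r) presentation \<Rightarrow> ('g, 'r) cell \<times> complex \<Rightarrow> ('g, 'r) cell \<times> complex" where
  "glue P (Vertex, z) = (Vertex, 0)"
| "glue P (Edge g, z) = edge_point g (Re z)"
| "glue P (Face r, z) =
     (if norm z < 1 then (Face r, z) else word_loop (relator P r) (Arg2pi z / (2 * pi)))"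

definition presentation_complex ::
    "('g, 'r) presentation \<Rightarrow> (('g, 'r) cell \<times> complex) topology" where
  "presentation_complex P =
     quotient_topology (sum_topology (\<lambda>c. top_of_set (closed_cell c)) (cells P)) (glue P)"


section \<open>The Collatz presentation\<close>

text \<open>Only the values at positive arguments matter; these are positive.\<close>

definition collatz :: "nat \<Rightarrow> nat" where
  "collatz n = (if odd n then 3 * n + 1 else n div 2)"

text \<open>A relation \<open>u = v\<close> is turned into the relator \<open>u v\<^sup>-\<^sup>1\<close>.\<close>

definition collatz_presentation :: "(nat, nat) presentation" where
  "collatz_presentation =
     \<lparr>generators = {0<..}, relator_index = {0<..},
      relator = (\<lambda>i. [(collatz i, False), (i, True), (collatz i, True)] @
                     inverse_word [(i, True), (i, True)])\<rparr>"

lemma collatz_pos: "n > 0 \<Longrightarrow> collatz n > 0"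
  by (auto simp: collatz_def elim!: evenE)

lemma collatz_neq: "n > 0 \<Longrightarrow> collatz n \<noteq> n"
  by (auto simp: collatz_def)

lemma cyclically_reduced_collatz:
  assumes "i > 0"
  shows "cyclically_reduced (relator collatz_presentation i)"
proof -
  have w: "relator collatz_presentation i =
      [(collatz i, False), (i, True), (collatz i, True), (i, False), (i, False)]" (is "_ = ?w")
    by (simp add: collatz_presentation_def inverse_word_def)
  have "?w ! (Suc k mod 5) \<noteq> (fst (?w ! k), \<not> snd (?w ! k))" if "k < 5" for k
  proof -
    from that consider "k = 0" | "k = 1" | "k = 2" | "k = 3" | "k = 4"
      by arith
    then show ?thesis
      using collatz_neq [OF assms] by cases auto
  qed
  then show ?thesis
    unfolding cyclically_reduced_def w by simp
qed

end

theory Submission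
  imports Defs
begin

text \<open>
  The boundary of the face of \<open>i\<close> runs through the edge of \<open>i\<close> with total exponent \<open>-1\<close> and
  through the edge of \<open>C(i)\<close> with total exponent 0. Hence the complex is acyclic whatever \<open>C\<close> is,
  and everything depends on its fundamental group.

  If all orbits reach 1, the generators \<open>a\<^sub>1, a\<^sub>4, a\<^sub>2\<close> satisfy the relations of Higman's three
  generator presentation of the trivial group, and \<open>a\<^sub>C\<^sub>(\<^sub>i\<^sub>) = 1\<close> turns the relation of \<open>i\<close> into
  \<open>a\<^sub>i = a\<^sub>i\<^sup>2\<close>; so all edge loops are null-homotopic. By homotopy extension the identity is then
  homotopic to a map \<open>f\<close> that is constant on the 1-skeleton, i.e. to a family of spheres, one for
  each face. A map that collapses the 1-skeleton is null-homotopic: during the time interval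
  \<open>[1/(i+1), 1/i]\<close> let the loop of \<open>i\<close> sweep over the sphere of the face \<open>i\<close>. In the boundary of
  that face this sphere then appears with total multiplicity \<open>-1\<close>, which cancels the face, and in
  the boundaries of the faces \<open>j\<close> with \<open>C(j) = i\<close> it appears in the conjugating letters only,
  where it cancels itself.

  Conversely, an action of the group on a set is a local system on the complex, and a local system
  on a contractible space has no monodromy. If some orbit avoids 1, it is infinite or ends in a
  cycle of length \<open>n \<ge> 4\<close>; sending the generators of the orbit to those of a Higman group with
  \<open>n \<ge> 4\<close> generators (\<open>n = 4\<close> in the infinite case) and all others to 1 gives a nontrivial
  action, because Higman's groups are nontrivial amalgams over free groups.
\<close>

section \<open>The complex as a type\<close>

text \<open>Infinitely many cells meet at the one vertex, so continuity of a homotopy is only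
  accessible cell by cell. The same topology makes infinitely many successive sweeps harmless
  although their time intervals accumulate at 0: each closed face sees two edges only. Paths and
  homotopies are treated over type classes, hence the complex is turned into a type. Higman's groups
  are never constructed as groups. On a countable set, a free action of a free group with infinitely
  many orbits is unique up to isomorphism, so instead of forming an amalgam one relabels points
  until two actions agree on the common free group. The bound 4 has its origin in the pieces: the
  two ends of a chain with a single relation satisfy that relation, while chains with two or more
  relations can be realised with free ends, and a cycle is glued from two of these.\<close>

definition collatz_complex :: "((nat, nat) cell \<times> complex) topology" where
  "collatz_complex = presentation_complex collatz_presentation"

typedef pc = "topspace collatz_complex"
  by (rule exI[of _ "(Vertex, 0)"])
    (force simp: collatz_complex_def presentation_complex_def image_iff cells_def)

instantiation pc :: topological_space
begin

definition open_pc :: "pc set \<Rightarrow> bool" where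
  "open_pc U \<longleftrightarrow> openin collatz_complex (Rep_pc ` U)"

instance
proof
  have "Rep_pc ` (UNIV :: pc set) = topspace collatz_complex"
    using type_definition.Rep_range type_definition_pc by blast
  then show "open (UNIV :: pc set)"
    by (simp add: open_pc_def)
  show "open (S \<inter> T)" if "open S" "open T" for S T :: "pc set"
    using that by (simp add: open_pc_def image_Int Rep_pc_inject inj_on_def openin_Int)
  show "open (\<Union>K)" if "\<forall>S\<in>K. open S" for K :: "pc set set"
    using that unfolding open_pc_def image_Union by blast
qed

end

lemma homeomorphic_map_Rep_pc: "homeomorphic_map euclidean collatz_complex Rep_pc"
proof -
  have r: "range Rep_pc = topspace collatz_complex"
    using type_definition.Rep_range type_definition_pc by blast
  have "openin collatz_complex U \<longleftrightarrow> open {x. Rep_pc x \<in> U}" if "U \<subseteq> topspace collatz_complex" for U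
  proof -
    have "Rep_pc ` (Rep_pc -` U) = U"
      using that r by (simp add: image_vimage_eq Int_absorb2)
    then have "Rep_pc ` {x. Rep_pc x \<in> U} = U"
      by (simp add: vimage_def)
    then show ?thesis by (simp add: open_pc_def)
  qed
  then show ?thesis
    unfolding homeomorphic_map_def quotient_map_def using r
    by (simp add: inj_on_def Rep_pc_inject)
qed

lemma contractible_space_collatz_complex:
  "contractible_space collatz_complex \<longleftrightarrow> contractible (UNIV :: pc set)"
  using homeomorphic_map_Rep_pc homeomorphic_map_imp_homeomorphic_space
    homeomorphic_space_contractibility contractible_space_top_of_set
  by (metis subtopology_UNIV)

section \<open>Characteristic maps of the cells, in polar coordinates on the faces\<close>

definition gl :: "(nat, nat) cell \<times> complex \<Rightarrow> pc" where
  "gl p = Abs_pc (glue collatz_presentation p)"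

abbreviation ccells :: "(nat, nat) cell set" where
  "ccells \<equiv> cells collatz_presentation"

abbreviation cell_sum :: "((nat, nat) cell \<times> complex) topology" where
  "cell_sum \<equiv> sum_topology (\<lambda>c. top_of_set (closed_cell c)) ccells"

lemma topspace_collatz_complex:
  "topspace collatz_complex = glue collatz_presentation ` (SIGMA c:ccells. closed_cell c)"
  by (simp add: collatz_complex_def presentation_complex_def o_def)

lemma Rep_gl: "c \<in> ccells \<Longrightarrow> z \<in> closed_cell c \<Longrightarrow> Rep_pc (gl (c, z)) = glue collatz_presentation (c, z)"
  unfolding gl_def by (rule Abs_pc_inverse) (force simp: topspace_collatz_complex)

lemma quotient_map_gl: "quotient_map cell_sum euclidean gl"
proof -
  have q: "quotient_map cell_sum collatz_complex (glue collatz_presentation)"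
    unfolding collatz_complex_def presentation_complex_def
    by (rule quotient_map_quotient_topology)
  have sub: "Rep_pc ` U \<subseteq> topspace collatz_complex" for U
    using Rep_pc by blast
  have eq: "{x \<in> topspace cell_sum. glue collatz_presentation x \<in> Rep_pc ` U}
    = {x \<in> topspace cell_sum. gl x \<in> U}" for U
    by (auto simp: image_iff Rep_pc_inject simp flip: Rep_gl)
  have "open U \<longleftrightarrow> openin cell_sum {x \<in> topspace cell_sum. gl x \<in> U}" for U
    using q sub[of U] unfolding quotient_map_def open_pc_def eq[symmetric] by blast
  moreover have "\<exists>x \<in> topspace cell_sum. p = gl x" for p
  proof -
    from Rep_pc[of p] obtain c z where "c \<in> ccells" "z \<in> closed_cell c"
        "Rep_pc p = glue collatz_presentation (c, z)"
      unfolding topspace_collatz_complex by blast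
    then show ?thesis
      by (intro bexI[of _ "(c, z)"]) (auto simp: Rep_pc_inject simp flip: Rep_gl)
  qed
  then have "gl ` topspace cell_sum = UNIV" by blast
  ultimately show ?thesis
    unfolding quotient_map_def by simp
qed

definition vx :: pc where "vx = gl (Vertex, 0)"

definition ed :: "nat \<Rightarrow> real \<Rightarrow> pc" where "ed i s = gl (Edge i, of_real s)"

definition fc :: "nat \<Rightarrow> complex \<Rightarrow> pc" where "fc i z = gl (Face i, z)"

definition polar :: "real \<Rightarrow> real \<Rightarrow> complex" where
  "polar r \<theta> = of_real r * cis (2 * pi * \<theta>)"

lemma cells_collatz: "ccells = insert Vertex (Edge ` {0<..} \<union> Face ` {0<..})"
  by (simp add: cells_def collatz_presentation_def)

lemma Rep_vx: "Rep_pc vx = (Vertex, 0)"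
  unfolding vx_def by (subst Rep_gl) (auto simp: cells_collatz)

lemma Rep_ed: "i > 0 \<Longrightarrow> s \<in> {0..1} \<Longrightarrow> Rep_pc (ed i s) = edge_point i s"
  unfolding ed_def by (subst Rep_gl) (auto simp: cells_collatz)

lemma Rep_fc_interior: "i > 0 \<Longrightarrow> norm z < 1 \<Longrightarrow> Rep_pc (fc i z) = (Face i, z)"
  unfolding fc_def by (subst Rep_gl) (auto simp: cells_collatz)

lemma ed_0 [simp]: "i > 0 \<Longrightarrow> ed i 0 = vx" and ed_1 [simp]: "i > 0 \<Longrightarrow> ed i 1 = vx"
  by (simp_all flip: Rep_pc_inject add: Rep_ed Rep_vx edge_point_def)

text \<open>The word of the face \<open>i\<close>, spelled at constant speed in a family \<open>E\<close> of loops.\<close>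

definition slotwise :: "(nat \<Rightarrow> real \<Rightarrow> 'b) \<Rightarrow> nat \<Rightarrow> real \<Rightarrow> 'b" where
  "slotwise E i \<theta> =
     (if \<theta> \<le> 1/5 then E (collatz i) (1 - 5 * \<theta>)
      else if \<theta> \<le> 2/5 then E i (5 * \<theta> - 1)
      else if \<theta> \<le> 3/5 then E (collatz i) (5 * \<theta> - 2)
      else if \<theta> \<le> 4/5 then E i (4 - 5 * \<theta>)
      else E i (5 - 5 * \<theta>))"

lemma relator_collatz: "relator collatz_presentation i =
    [(collatz i, False), (i, True), (collatz i, True), (i, False), (i, False)]"
  by (simp add: collatz_presentation_def inverse_word_def)

text \<open>\<open>word_loop\<close> uses half-open slots and \<open>slotwise\<close> closed ones;
  the two agree because every edge starts and ends at \<open>vx\<close>.\<close>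

lemma fc_boundary:
  assumes "i > 0" "\<theta> \<in> {0..1}"
  shows "fc i (polar 1 \<theta>) = slotwise ed i \<theta>"
proof -
  note C = collatz_pos[OF \<open>i > 0\<close>]
  \<comment> \<open>\<open>Arg2pi\<close> takes values in [0, 2 pi), so the angle 1 has to be
    replaced by 0.\<close>
  define t where "t = (if \<theta> = 1 then 0 else \<theta>)"
  have t: "0 \<le> t" "t < 1" using assms by (auto simp: t_def)
  have p: "polar 1 \<theta> = polar 1 t"
    using cis_2pi by (simp add: t_def polar_def)
  have "Arg2pi (cis (2 * pi * t)) = 2 * pi * t"
    by (rule Arg2pi_unique[of 1]) (use t in \<open>auto simp: cis_conv_exp\<close>)
  then have R: "Rep_pc (fc i (polar 1 \<theta>)) = word_loop (relator collatz_presentation i) t"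
    unfolding p fc_def using \<open>i > 0\<close>
    by (subst Rep_gl) (auto simp: cells_collatz polar_def)
  have ep: "edge_point g x = Rep_pc (ed g x)" if "g > 0" "x \<in> {0..1}" for g x
    using that by (simp add: Rep_ed)
  have fl: "nat \<lfloor>5 * t\<rfloor> = k \<and> frac (5 * t) = 5 * t - k" if "real k \<le> 5 * t" "5 * t < real k + 1" for k
  proof -
    from that have "\<lfloor>5 * t\<rfloor> = int k" by (intro floor_unique) auto
    then show ?thesis by (auto simp: frac_def)
  qed
  have e0: "edge_point g 0 = (Vertex, 0)" "edge_point g 1 = (Vertex, 0)" for g :: nat
    by (auto simp: edge_point_def)
  have f0: "frac (numeral n :: real) = 0" for n
    by (simp add: frac_def)
  consider "5 * t < 1" | "1 \<le> 5 * t" "5 * t < 2" | "2 \<le> 5 * t" "5 * t < 3"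
    | "3 \<le> 5 * t" "5 * t < 4" | "4 \<le> 5 * t" "5 * t < 5"
    using t by linarith
  then have "word_loop (relator collatz_presentation i) t = Rep_pc (slotwise ed i t)"
  proof cases
    case 1 
    with fl[of 0] t C show ?thesis
      by (simp add: word_loop_def relator_collatz slotwise_def Rep_ed Let_def)
  next
    case 2
    with fl[of 1] t C \<open>i > 0\<close> show ?thesis
      by (cases "5 * t = 1") (auto simp: word_loop_def relator_collatz slotwise_def Rep_ed Rep_vx Let_def e0 f0)
  next
    case 3
    with fl[of 2] t C \<open>i > 0\<close> show ?thesis
      by (cases "5 * t = 2") (auto simp: word_loop_def relator_collatz slotwise_def Rep_ed Rep_vx Let_def e0 f0)
  next
    case 4
    with fl[of 3] t C \<open>i > 0\<close> show ?thesis
      by (cases "5 * t = 3") (auto simp: word_loop_def relator_collatz slotwise_def Rep_ed Rep_vx Let_def e0 f0)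
  next
    case 5
    with fl[of 4] t C \<open>i > 0\<close> show ?thesis
      by (cases "5 * t = 4") (auto simp: word_loop_def relator_collatz slotwise_def Rep_ed Rep_vx Let_def e0 f0)
  qed
  moreover have "slotwise ed i t = slotwise ed i \<theta>"
    using C \<open>i > 0\<close> by (simp add: t_def slotwise_def)
  ultimately show ?thesis
    using R by (simp flip: Rep_pc_inject)
qed

lemma slotwise_cases:
  assumes "i > 0" "\<theta> \<in> {0..1}"
  obtains j x where "j > 0" "x \<in> {0..1}" "slotwise E i \<theta> = E j x"
proof -
  consider "\<theta> \<le> 1/5" | "\<not> \<theta> \<le> 1/5" "\<theta> \<le> 2/5" | "\<not> \<theta> \<le> 2/5" "\<theta> \<le> 3/5"
    | "\<not> \<theta> \<le> 3/5" "\<theta> \<le> 4/5" | "\<not> \<theta> \<le> 4/5" by linarith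
  then show thesis
  proof cases
    case 1 then show thesis
      using that[of "collatz i" "1 - 5 * \<theta>"] assms collatz_pos by (simp add: slotwise_def)
  next
    case 2 then show thesis
      using that[of i "5 * \<theta> - 1"] assms by (simp add: slotwise_def)
  next
    case 3 then show thesis
      using that[of "collatz i" "5 * \<theta> - 2"] assms collatz_pos by (simp add: slotwise_def)
  next
    case 4 then show thesis
      using that[of i "4 - 5 * \<theta>"] assms by (simp add: slotwise_def)
  next
    case 5 then show thesis
      using that[of i "5 - 5 * \<theta>"] assms by (simp add: slotwise_def)
  qed
qed

lemma pc_cases:
  obtains "p = vx" | i s where "i > 0" "0 < s" "s < 1" "p = ed i s"
  | i r \<theta> where "i > 0" "0 \<le> r" "r < 1" "0 \<le> \<theta>" "\<theta> < 1" "p = fc i (polar r \<theta>)"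
proof -
  have "p \<in> gl ` topspace cell_sum"
    using quotient_map_gl unfolding quotient_map_def by auto
  then obtain c z where c: "c \<in> ccells" "z \<in> closed_cell c" "p = gl (c, z)" by auto
  have e: thesis if "i > 0" "s \<in> {0..1}" "p = ed i s" for i s
    using that by (metis atLeastAtMost_iff ed_0 ed_1 \<open>p = vx \<Longrightarrow> thesis\<close> less_eq_real_def
        \<open>\<And>s i. \<lbrakk>0 < i; 0 < s; s < 1; p = ed i s\<rbrakk> \<Longrightarrow> thesis\<close>)
  show thesis
  proof (cases c)
    case Vertex
    with c that show ?thesis by (auto simp: vx_def)
  next
    case (Edge i)
    with c e show ?thesis by (auto simp: cells_collatz ed_def)
  next
    case (Face i)
    then have i: "i > 0" using c by (auto simp: cells_collatz)
    define r \<theta> where "r = norm z" and "\<theta> = Arg2pi z / (2 * pi)"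
    have \<theta>: "0 \<le> \<theta>" "\<theta> < 1"
      using Arg2pi_ge_0[of z] Arg2pi_lt_2pi[of z] by (auto simp: \<theta>_def field_simps)
    have "z = polar r \<theta>"
      using Arg2pi_eq[of z] by (simp add: r_def \<theta>_def polar_def cis_conv_exp)
    then have p: "p = fc i (polar r \<theta>)" using c Face by (simp add: fc_def)
    have "r \<le> 1" "0 \<le> r" using c Face by (auto simp: r_def)
    show ?thesis
    proof (cases "r = 1")
      case True
      with p have "p = slotwise ed i \<theta>" using fc_boundary[OF i] \<theta> by auto
      then obtain j x where "j > 0" "x \<in> {0..1}" "p = ed j x"
        using slotwise_cases[OF i, of \<theta> ed] \<theta> by auto
      then show ?thesis by (rule e)
    next
      case False
      then show ?thesis using that(3)[of i r \<theta>] p i \<theta> \<open>r \<le> 1\<close> \<open>0 \<le> r\<close> by auto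
    qed
  qed
qed

lemma polar_image: "(\<lambda>p. polar (fst p) (snd p)) ` ({0..1} \<times> {0..1}) = cball 0 1"
proof -
  have "z \<in> (\<lambda>p. polar (fst p) (snd p)) ` ({0..1} \<times> {0..1})" if "z \<in> cball 0 1" for z
  proof (rule image_eqI)
    show "z = polar (fst (norm z, Arg2pi z / (2 * pi))) (snd (norm z, Arg2pi z / (2 * pi)))"
      using Arg2pi_eq[of z] by (simp add: polar_def cis_conv_exp)
    show "(norm z, Arg2pi z / (2 * pi)) \<in> {0..1} \<times> {0..1}"
      using that Arg2pi_ge_0[of z] Arg2pi_lt_2pi[of z] by (auto simp: field_simps)
  qed
  moreover have "polar r t \<in> cball 0 1" if "r \<in> {0..1}" for r t
    using that by (simp add: polar_def norm_mult)
  ultimately show ?thesis by force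
qed

lemma continuous_polar [continuous_intros]:
  "continuous_on S f \<Longrightarrow> continuous_on S g \<Longrightarrow> continuous_on S (\<lambda>x. polar (f x) (g x))"
  unfolding polar_def cis_conv_exp by (intro continuous_intros)

text \<open>A continuous map from a compact square onto a Hausdorff disc is a quotient map.\<close>

lemma openin_cball_polar:
  assumes "V \<subseteq> cball 0 1"
  shows "openin (top_of_set (cball 0 1)) V \<longleftrightarrow>
    openin (top_of_set ({0..1} \<times> {0..1})) {p \<in> {0..1} \<times> {0..1}. polar (fst p) (snd p) \<in> V}"
proof -
  let ?S = "{0..1} \<times> {0..1} :: (real \<times> real) set"
  have c: "continuous_on ?S (\<lambda>p. polar (fst p) (snd p))"
    by (intro continuous_intros)
  from Abstract_Topology_2.continuous_imp_quotient_map[OF c polar_image compact_Times assms]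
  have "openin (top_of_set ?S) (?S \<inter> (\<lambda>p. polar (fst p) (snd p)) -` V)
      \<longleftrightarrow> openin (top_of_set (cball 0 1)) V" by simp
  moreover have "?S \<inter> (\<lambda>p. polar (fst p) (snd p)) -` V = {p \<in> ?S. polar (fst p) (snd p) \<in> V}"
    by auto
  ultimately show ?thesis by simp
qed

text \<open>The quotient topology, tested on closed cells; the vertex gives no condition since every
  subset of a point is open.\<close>

lemma open_pc_iff:
  "open U \<longleftrightarrow> (\<forall>i>0. openin (top_of_set {0..1}) {s \<in> {0..1}. ed i s \<in> U} \<and>
    openin (top_of_set ({0..1} \<times> {0..1}))
      {p \<in> {0..1} \<times> {0..1}. fc i (polar (fst p) (snd p)) \<in> U})"
proof -
  let ?e = "of_real :: real \<Rightarrow> complex"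
  have "open U \<longleftrightarrow> openin cell_sum {x \<in> topspace cell_sum. gl x \<in> U}"
    using quotient_map_gl by (auto simp: quotient_map_def)
  also have "\<dots> \<longleftrightarrow> (\<forall>c\<in>ccells. openin (top_of_set (closed_cell c)) {z \<in> closed_cell c. gl (c, z) \<in> U})"
  proof -
    have "{z. (c, z) \<in> {x \<in> topspace cell_sum. gl x \<in> U}} = {z \<in> closed_cell c. gl (c, z) \<in> U}"
      if "c \<in> ccells" for c using that by simp
    then show ?thesis unfolding openin_sum_topology by auto
  qed
  also have "\<dots> \<longleftrightarrow> (\<forall>i>0. openin (top_of_set (?e ` {0..1})) {z \<in> ?e ` {0..1}. gl (Edge i, z) \<in> U} \<and>
      openin (top_of_set (cball 0 1)) {z \<in> cball 0 1. fc i z \<in> U})"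
  proof -
    have "openin (top_of_set {0}) {z::complex. z = 0 \<and> gl (Vertex, z) \<in> U}"
    proof (cases "gl (Vertex, 0) \<in> U")
      case True
      then have "{z::complex. z = 0 \<and> gl (Vertex, z) \<in> U} = {0}" by auto
      then show ?thesis by simp
    next
      case False
      then have "{z::complex. z = 0 \<and> gl (Vertex, z) \<in> U} = {}" by auto
      then show ?thesis by (simp only: openin_empty)
    qed
    moreover have "(\<forall>c\<in>ccells. Q c) \<longleftrightarrow> Q Vertex \<and> (\<forall>i>0. Q (Edge i) \<and> Q (Face i))" for Q
      by (auto simp: cells_collatz)
    ultimately show ?thesis unfolding fc_def by simp
  qed
  also have "\<dots> \<longleftrightarrow> (\<forall>i>0. openin (top_of_set {0..1}) {s \<in> {0..1}. ed i s \<in> U} \<and>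
    openin (top_of_set ({0..1} \<times> {0..1}))
      {p \<in> {0..1} \<times> {0..1}. fc i (polar (fst p) (snd p)) \<in> U})"
  proof -
    have 1: "openin (top_of_set (?e ` {0..1})) {z \<in> ?e ` {0..1}. gl (Edge i, z) \<in> U} \<longleftrightarrow>
        openin (top_of_set {0..1}) {s \<in> {0..1}. ed i s \<in> U}" for i
    proof -
      let ?V = "{z \<in> ?e ` {0..1}. gl (Edge i, z) \<in> U}"
      have "openin (top_of_set {0..1}) ({0..1} \<inter> ?e -` ?V) \<longleftrightarrow> openin (top_of_set (?e ` {0..1})) ?V"
        by (rule Abstract_Topology_2.continuous_imp_quotient_map) (auto intro: continuous_intros)
      moreover have "{0..1} \<inter> ?e -` ?V = {s \<in> {0..1}. ed i s \<in> U}"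
        by (auto simp: ed_def)
      ultimately show ?thesis by simp
    qed
    have 2: "openin (top_of_set (cball 0 1)) {z \<in> cball 0 1. fc i z \<in> U} \<longleftrightarrow>
        openin (top_of_set ({0..1} \<times> {0..1}))
          {p \<in> {0..1} \<times> {0..1}. fc i (polar (fst p) (snd p)) \<in> U}" for i
      by (subst openin_cball_polar)
        (auto simp: polar_def norm_mult intro!: arg_cong2[where f = openin])
    show ?thesis by (simp only: 1 2)
  qed
  finally show ?thesis .
qed

lemma continuous_ed: "i > 0 \<Longrightarrow> continuous_on {0..1} (ed i)"
  unfolding continuous_openin_preimage_eq
proof (intro allI impI)
  fix U :: "pc set" assume "i > 0" "open U"
  then have "openin (top_of_set {0..1}) {s \<in> {0..1}. ed i s \<in> U}"
    by (simp add: open_pc_iff)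
  moreover have "{0..1} \<inter> ed i -` U = {s \<in> {0..1}. ed i s \<in> U}" by auto
  ultimately show "openin (top_of_set {0..1}) ({0..1} \<inter> ed i -` U)" by simp
qed

lemma continuous_fc:
  assumes "i > 0"
  shows "continuous_on (cball 0 1) (fc i)"
  unfolding continuous_openin_preimage_eq
proof (intro allI impI)
  fix U :: "pc set" assume "open U"
  let ?V = "{z \<in> cball 0 1. fc i z \<in> U}"
  have "{p \<in> {0..1} \<times> {0..1}. polar (fst p) (snd p) \<in> ?V}
      = {p \<in> {0..1} \<times> {0..1}. fc i (polar (fst p) (snd p)) \<in> U}"
    by (auto simp: polar_def norm_mult)
  then have "openin (top_of_set (cball 0 1)) ?V"
    using \<open>open U\<close> \<open>i > 0\<close> by (subst openin_cball_polar) (auto simp: open_pc_iff)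
  moreover have "cball 0 1 \<inter> fc i -` U = ?V" by auto
  ultimately show "openin (top_of_set (cball 0 1)) (cball 0 1 \<inter> fc i -` U)" by simp
qed

section \<open>Continuity on the product with the interval\<close>

lemma continuous_map_prod_sum_topology:
  assumes "\<And>i. i \<in> I \<Longrightarrow> continuous_map (prod_topology Z (X i)) Y (\<lambda>p. f (fst p, (i, snd p)))"
  shows "continuous_map (prod_topology Z (sum_topology X I)) Y f"
  unfolding continuous_map_def
proof (intro conjI allI impI)
  show "f \<in> topspace (prod_topology Z (sum_topology X I)) \<rightarrow> topspace Y"
  proof
    fix p assume "p \<in> topspace (prod_topology Z (sum_topology X I))"
    then obtain t i x where p: "p = (t, (i, x))" "i \<in> I" "(t, x) \<in> topspace (prod_topology Z (X i))"
      by (cases p) auto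
    with continuous_map_funspace[OF assms[OF p(2)]] show "f p \<in> topspace Y" by (auto simp: Pi_iff)
  qed
  fix U assume U: "openin Y U"
  let ?W = "{x \<in> topspace (prod_topology Z (sum_topology X I)). f x \<in> U}"
  show "openin (prod_topology Z (sum_topology X I)) ?W"
    unfolding openin_prod_topology_alt
  proof (intro allI impI)
    fix t ix assume "(t, ix) \<in> ?W"
    then obtain i x where ix: "ix = (i, x)" "i \<in> I" "x \<in> topspace (X i)" "t \<in> topspace Z" "f (t, (i, x)) \<in> U"
      by auto
    let ?P = "{p \<in> topspace (prod_topology Z (X i)). f (fst p, (i, snd p)) \<in> U}"
    have "openin (prod_topology Z (X i)) ?P"
      using assms[OF ix(2)] U unfolding continuous_map_def by blast
    moreover have "(t, x) \<in> ?P" using ix by simp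
    ultimately obtain T V where TV: "openin Z T" "openin (X i) V" "t \<in> T" "x \<in> V" "T \<times> V \<subseteq> ?P"
      unfolding openin_prod_topology_alt by meson
    have "{x. (j, x) \<in> {i} \<times> V} = (if j = i then V else {})" for j
      by auto
    then have "openin (sum_topology X I) ({i} \<times> V)"
      using TV(2) ix(2) openin_subset[OF TV(2)] by (auto simp: openin_sum_topology)
    moreover have "T \<times> ({i} \<times> V) \<subseteq> ?W"
      using TV(5) ix(2) by auto
    ultimately show "\<exists>U V. openin Z U \<and> openin (sum_topology X I) V \<and> t \<in> U \<and> ix \<in> V \<and> U \<times> V \<subseteq> ?W"
      using TV ix by blast
  qed
qed

lemma continuous_on_compact_quotient:
  fixes f :: "'a::t2_space \<Rightarrow> 'b::t2_space" and g :: "'b \<Rightarrow> 'c::topological_space"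
  assumes f: "continuous_on S f" "f ` S = T" "compact S" and gf: "continuous_on S (g \<circ> f)"
  shows "continuous_on T g"
  unfolding continuous_openin_preimage_eq
proof (intro allI impI)
  fix U :: "'c set" assume "open U"
  with gf have "openin (top_of_set S) (S \<inter> (g \<circ> f) -` U)"
    unfolding continuous_openin_preimage_eq by blast
  moreover have "S \<inter> (g \<circ> f) -` U = S \<inter> f -` (T \<inter> g -` U)"
    using f(2) by auto
  ultimately show "openin (top_of_set T) (T \<inter> g -` U)"
    using Abstract_Topology_2.continuous_imp_quotient_map[OF f, of "T \<inter> g -` U"] by simp
qed

text \<open>The interval is locally compact and Hausdorff, so its product with the quotient map
  \<open>gl\<close> is again a quotient map, and continuity can be tested on the interval times each
  closed cell.\<close>

lemma continuous_on_interval_times_pc: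
  fixes H :: "real \<times> pc \<Rightarrow> 'b::topological_space"
  assumes ed: "\<And>i. i > 0 \<Longrightarrow> continuous_on ({0..1} \<times> {0..1}) (\<lambda>p. H (fst p, ed i (snd p)))"
    and fc: "\<And>i. i > 0 \<Longrightarrow> continuous_on ({0..1} \<times> {0..1} \<times> {0..1})
        (\<lambda>p. H (fst p, fc i (polar (fst (snd p)) (snd (snd p)))))"
  shows "continuous_on ({0..1} \<times> UNIV) H"
proof -
  let ?I = "top_of_set {0..1::real}"
  have "locally_compact_space ?I"
    by (simp add: compact_imp_locally_compact_space compact_space_subtopology)
  moreover have "Hausdorff_space ?I"
    by (simp add: Hausdorff_space_subtopology)
  ultimately have q: "quotient_map (prod_topology ?I cell_sum) (prod_topology ?I euclidean) (\<lambda>(x,y). (x, gl y))"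
    using quotient_map_gl by (intro quotient_map_prod_right) auto
  have "continuous_on ({0..1} \<times> closed_cell c) (\<lambda>p. H (fst p, gl (c, snd p)))" if "c \<in> ccells" for c
  proof (cases c)
    case Vertex
    have "continuous_on ({0..1} \<times> {0}) ((\<lambda>p. H (fst p, ed 1 (snd p))) \<circ> (\<lambda>p. (fst p, Re (snd p))))"
      by (intro continuous_on_compose continuous_intros continuous_on_subset[OF ed[of 1]]) auto
    then have "continuous_on ({0..1} \<times> {0}) (\<lambda>p::real \<times> complex. H (fst p, gl (Vertex, snd p)))"
      by (rule continuous_on_eq) (auto simp flip: vx_def)
    with Vertex show ?thesis by simp
  next
    case (Edge i)
    then have "i > 0" using that by (auto simp: cells_collatz)
    have "continuous_on ({0..1} \<times> (of_real ` {0..1}))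
        ((\<lambda>p. H (fst p, ed i (snd p))) \<circ> (\<lambda>p. (fst p, Re (snd p))))"
      by (intro continuous_on_compose continuous_intros continuous_on_subset[OF ed[OF \<open>i > 0\<close>]]) auto
    then have "continuous_on ({0..1} \<times> (of_real ` {0..1})) (\<lambda>p. H (fst p, gl (Edge i, snd p)))"
      by (rule continuous_on_eq) (auto simp: ed_def)
    with Edge show ?thesis by simp
  next
    case (Face i)
    then have "i > 0" using that by (auto simp: cells_collatz)
    let ?f = "\<lambda>p. (fst p, polar (fst (snd p)) (snd (snd p)))"
    have "continuous_on ({0..1} \<times> {0..1} \<times> {0..1}) ?f"
      by (intro continuous_intros)
    moreover have "?f ` ({0..1} \<times> {0..1} \<times> {0..1}) = {0..1} \<times> cball 0 1"
      unfolding polar_image[symmetric] by force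
    moreover have "compact ({0..1} \<times> {0..1} \<times> {0..1} :: (real \<times> real \<times> real) set)"
      by (intro compact_Times) auto
    moreover have "continuous_on ({0..1} \<times> {0..1} \<times> {0..1}) ((\<lambda>p. H (fst p, fc i (snd p))) \<circ> ?f)"
      using fc[OF \<open>i > 0\<close>] by (simp add: o_def)
    ultimately have "continuous_on ({0..1} \<times> cball 0 1) (\<lambda>p. H (fst p, fc i (snd p)))"
      by (rule continuous_on_compact_quotient)
    with Face show ?thesis by (simp add: fc_def)
  qed
  then have "continuous_map (prod_topology ?I cell_sum) euclidean (H \<circ> (\<lambda>(x,y). (x, gl y)))"
    by (intro continuous_map_prod_sum_topology) (simp add: o_def)
  then have "continuous_map (prod_topology ?I euclidean) euclidean H"
    using q by (rule continuous_compose_quotient_map[rotated])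
  then show ?thesis
    by (metis continuous_map_subtopology_eu prod_topology_subtopology_eu subtopology_UNIV subtopology_UNIV)
qed

definition pc_fun :: "'b \<Rightarrow> (nat \<Rightarrow> real \<Rightarrow> 'b) \<Rightarrow> (nat \<Rightarrow> real \<Rightarrow> real \<Rightarrow> 'b) \<Rightarrow> pc \<Rightarrow> 'b" where
  "pc_fun V E F p = (case Rep_pc p of
      (Vertex, z) \<Rightarrow> V
    | (Edge i, z) \<Rightarrow> E i (Re z)
    | (Face i, z) \<Rightarrow> F i (norm z) (Arg2pi z / (2 * pi)))"

lemma pc_fun_vx [simp]: "pc_fun V E F vx = V"
  by (simp add: pc_fun_def Rep_vx)

lemma pc_fun_ed:
  assumes "i > 0" "s \<in> {0..1}" "E i 0 = V" "E i 1 = V"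
  shows "pc_fun V E F (ed i s) = E i s"
  using assms by (auto simp: pc_fun_def Rep_ed edge_point_def)

lemma Arg2pi_polar: "0 < r \<Longrightarrow> 0 \<le> \<theta> \<Longrightarrow> \<theta> < 1 \<Longrightarrow> Arg2pi (polar r \<theta>) = 2 * pi * \<theta>"
  by (rule Arg2pi_unique[of r]) (auto simp: polar_def cis_conv_exp)

lemma polar_1 [simp]: "polar r 1 = polar r 0"
  by (simp add: polar_def)

lemma norm_polar [simp]: "norm (polar r \<theta>) = \<bar>r\<bar>"
  by (simp add: polar_def norm_mult)

text \<open>The last two assumptions let \<open>F i\<close> descend from the square of polar
  coordinates to the disc: angle 1 is angle 0, and the centre has no angle.\<close>

lemma pc_fun_fc_interior:
  assumes "i > 0" "r \<in> {0..<1}" "\<theta> \<in> {0..1}"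
    and "F i r 1 = F i r 0" "\<And>\<theta>. \<theta> \<in> {0..1} \<Longrightarrow> F i 0 \<theta> = F i 0 0"
  shows "pc_fun V E F (fc i (polar r \<theta>)) = F i r \<theta>"
proof -
  have R: "Rep_pc (fc i (polar r \<theta>)) = (Face i, polar r \<theta>)"
    using assms(1,2) by (intro Rep_fc_interior) auto
  show ?thesis
  proof (cases "r = 0")
    case True
    then show ?thesis
      using R assms(3) assms(5)[of \<theta>] by (simp add: pc_fun_def polar_def Arg2pi_0)
  next
    case False
    define t where "t = (if \<theta> = 1 then 0 else \<theta>)"
    have "polar r \<theta> = polar r t" "F i r \<theta> = F i r t" using assms(4) by (auto simp: t_def)
    moreover have "Arg2pi (polar r t) = 2 * pi * t"
      using False assms by (intro Arg2pi_polar) (auto simp: t_def)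
    ultimately show ?thesis using R assms(2) by (simp add: pc_fun_def)
  qed
qed

lemma pc_fun_fc_boundary:
  assumes "i > 0" "\<theta> \<in> {0..1}" "\<And>j. j > 0 \<Longrightarrow> E j 0 = V \<and> E j 1 = V"
  shows "pc_fun V E F (fc i (polar 1 \<theta>)) = slotwise E i \<theta>"
proof -
  have "pc_fun V E F (slotwise ed i \<theta>) = slotwise (\<lambda>j s. pc_fun V E F (ed j s)) i \<theta>"
    by (simp add: slotwise_def)
  also have "\<dots> = slotwise E i \<theta>"
    using assms collatz_pos[OF assms(1)] by (auto simp: slotwise_def pc_fun_ed)
  finally show ?thesis using assms by (simp add: fc_boundary)
qed

section \<open>Cellwise homotopies\<close>

lemma slotwise_0: "slotwise E i 0 = E (collatz i) 1" and slotwise_1: "slotwise E i 1 = E i 0"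
  by (simp_all add: slotwise_def)

lemma polar_0_left [simp]: "polar 0 \<theta> = 0"
  by (simp add: polar_def)

lemma polar_shift: "polar r (\<theta> + 1) = polar r \<theta>"
  by (simp add: polar_def distrib_left flip: cis_mult)

lemma continuous_slotwise:
  fixes E :: "nat \<Rightarrow> real \<Rightarrow> real \<Rightarrow> 'b::topological_space"
  assumes "i > 0"
    and E: "\<And>j. j > 0 \<Longrightarrow> continuous_on ({0..1} \<times> {0..1}) (\<lambda>p. E j (fst p) (snd p))"
    and V: "\<And>j t. j > 0 \<Longrightarrow> t \<in> {0..1} \<Longrightarrow> E j t 0 = V \<and> E j t 1 = V"
  shows "continuous_on ({0..1} \<times> {0..1}) (\<lambda>p. slotwise (\<lambda>j. E j (fst p)) i (snd p))"
proof -
  have c: "continuous_on T (\<lambda>p. E j (fst p) (g (snd p)))"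
    if "j > 0" "continuous_on UNIV g" "T \<subseteq> {0..1} \<times> UNIV" "\<And>p. p \<in> T \<Longrightarrow> g (snd p) \<in> {0..1}" for j g T
  proof -
    have "continuous_on T ((\<lambda>p. E j (fst p) (snd p)) \<circ> (\<lambda>p. (fst p, g (snd p))))"
      by (intro continuous_on_compose continuous_intros continuous_on_subset[OF E[OF that(1)]]
          continuous_on_compose2[OF that(2)])
        (use that(3,4) in force)+
    then show ?thesis by (simp add: o_def)
  qed
  have "collatz i > 0" using assms(1) by (rule collatz_pos)
  then show ?thesis
    unfolding slotwise_def using \<open>i > 0\<close>
    by (intro continuous_on_cases_le c continuous_intros) (auto simp: V mult.commute[of 5])
qed

definition pc_homotopy ::
    "(nat \<Rightarrow> real \<Rightarrow> real \<Rightarrow> pc) \<Rightarrow> (nat \<Rightarrow> real \<Rightarrow> real \<Rightarrow> real \<Rightarrow> pc) \<Rightarrow> real \<times> pc \<Rightarrow> pc" where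
  "pc_homotopy E F p = pc_fun vx (\<lambda>i. E i (fst p)) (\<lambda>i. F i (fst p)) (snd p)"

text \<open>The homotopy is prescribed in polar coordinates: \<open>wrap_F\<close> and
  \<open>centre_F\<close> make it descend to the discs, \<open>boundary_F\<close> makes it
  compatible with the attaching maps. The vertex stays fixed throughout.\<close>

locale cellwise_homotopy =
  fixes E :: "nat \<Rightarrow> real \<Rightarrow> real \<Rightarrow> pc" and F :: "nat \<Rightarrow> real \<Rightarrow> real \<Rightarrow> real \<Rightarrow> pc"
  assumes cont_E: "i > 0 \<Longrightarrow> continuous_on ({0..1} \<times> {0..1}) (\<lambda>p. E i (fst p) (snd p))"
    and ends_E: "i > 0 \<Longrightarrow> t \<in> {0..1} \<Longrightarrow> E i t 0 = vx \<and> E i t 1 = vx"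
    and cont_F: "i > 0 \<Longrightarrow> continuous_on ({0..1} \<times> {0..1} \<times> {0..1})
        (\<lambda>p. F i (fst p) (fst (snd p)) (snd (snd p)))"
    and wrap_F: "i > 0 \<Longrightarrow> t \<in> {0..1} \<Longrightarrow> r \<in> {0..1} \<Longrightarrow> F i t r 1 = F i t r 0"
    and centre_F: "i > 0 \<Longrightarrow> t \<in> {0..1} \<Longrightarrow> \<theta> \<in> {0..1} \<Longrightarrow> F i t 0 \<theta> = F i t 0 0"
    and boundary_F: "i > 0 \<Longrightarrow> t \<in> {0..1} \<Longrightarrow> \<theta> \<in> {0..1} \<Longrightarrow> F i t 1 \<theta> = slotwise (\<lambda>j. E j t) i \<theta>"
begin

lemma homotopy_vx [simp]: "pc_homotopy E F (t, vx) = vx"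
  by (simp add: pc_homotopy_def)

lemma homotopy_ed: "i > 0 \<Longrightarrow> t \<in> {0..1} \<Longrightarrow> s \<in> {0..1} \<Longrightarrow> pc_homotopy E F (t, ed i s) = E i t s"
  using ends_E by (simp add: pc_homotopy_def pc_fun_ed)

lemma homotopy_fc:
  assumes "i > 0" "t \<in> {0..1}" "r \<in> {0..1}" "\<theta> \<in> {0..1}"
  shows "pc_homotopy E F (t, fc i (polar r \<theta>)) = F i t r \<theta>"
proof (cases "r = 1")
  case True
  then show ?thesis
    using assms ends_E boundary_F by (simp add: pc_homotopy_def pc_fun_fc_boundary)
next
  case False
  then have "r \<in> {0..<1}" using assms by auto
  from pc_fun_fc_interior[where F = "\<lambda>i. F i t", OF assms(1) this assms(4) wrap_F[OF assms(1,2,3)] centre_F[OF assms(1,2)]]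
  show ?thesis
    by (simp add: pc_homotopy_def)
qed

lemma continuous_homotopy: "continuous_on ({0..1} \<times> UNIV) (pc_homotopy E F)"
proof (rule continuous_on_interval_times_pc)
  fix i :: nat assume "i > 0"
  show "continuous_on ({0..1} \<times> {0..1}) (\<lambda>p. pc_homotopy E F (fst p, ed i (snd p)))"
    by (rule continuous_on_eq[OF cont_E[OF \<open>i > 0\<close>]]) (auto simp: homotopy_ed \<open>i > 0\<close>)
  show "continuous_on ({0..1} \<times> {0..1} \<times> {0..1})
        (\<lambda>p. pc_homotopy E F (fst p, fc i (polar (fst (snd p)) (snd (snd p)))))"
    by (rule continuous_on_eq[OF cont_F[OF \<open>i > 0\<close>]]) (auto simp: homotopy_fc \<open>i > 0\<close>)
qed

lemma homotopic:
  "homotopic_with_canon (\<lambda>_. True) UNIV UNIV (\<lambda>p. pc_homotopy E F (0, p)) (\<lambda>p. pc_homotopy E F (1, p))"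
proof -
  have "prod_topology (top_of_set {0..1}) euclidean = top_of_set ({0..1::real} \<times> (UNIV :: pc set))"
    using prod_topology_subtopology_eu[of "{0..1::real}" "UNIV :: pc set"] unfolding subtopology_UNIV .
  then have "continuous_map (prod_topology (top_of_set {0..1}) euclidean) euclidean (pc_homotopy E F)"
    using continuous_homotopy by (simp only: continuous_map_iff_continuous)
  then show ?thesis
    unfolding homotopic_with_def subtopology_UNIV
    by (intro exI[of _ "pc_homotopy E F"] conjI allI ballI TrueI refl)
qed

end

text \<open>Homotopy extension: at time \<open>t\<close> the disc of a face is squeezed into the disc of radius
  \<open>1/(1+5t)\<close>, and the remaining ring carries the null homotopies of the edges up to time \<open>t\<close>.
  At \<open>t = 1\<close> these are completed on all radii from \<open>1/3\<close>.\<close>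

lemma homotopic_id_collapse_edges:
  assumes "\<And>i. i > 0 \<Longrightarrow> homotopic_paths UNIV (ed i) (\<lambda>_. vx)"
  obtains f where "homotopic_with_canon (\<lambda>_. True) UNIV UNIV id f"
    and "\<And>i s. i > 0 \<Longrightarrow> s \<in> {0..1} \<Longrightarrow> f (ed i s) = vx" and "f vx = vx"
    and "\<And>i z. i > 0 \<Longrightarrow> norm z \<in> {1/3..1} \<Longrightarrow> f (fc i z) = vx"
proof -
  define Q where "Q i h \<longleftrightarrow> continuous_on ({0..1} \<times> {0..1}) (\<lambda>p. h (fst p) (snd p)) \<and>
      (\<forall>s\<in>{0..1}. h 0 s = ed i s \<and> h 1 s = vx) \<and> (\<forall>t\<in>{0..1}. h t 0 = vx \<and> h t 1 = vx)"
    for i and h :: "real \<Rightarrow> real \<Rightarrow> pc"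
  have "\<exists>h. Q i h" if "i > 0" for i
  proof -
    from assms[OF that] obtain h :: "real \<times> real \<Rightarrow> pc" where h: "continuous_on ({0..1} \<times> {0..1}) h"
      "\<forall>x\<in>{0..1}. h (0, x) = ed i x" "\<forall>x\<in>{0..1}. h (1, x) = vx"
      "\<forall>t\<in>{0..1}. pathstart (h \<circ> Pair t) = pathstart (ed i) \<and> pathfinish (h \<circ> Pair t) = pathfinish (ed i)"
      unfolding homotopic_paths by (elim exE conjE) (rule that)
    then show ?thesis
      using that unfolding Q_def
      by (intro exI[of _ "\<lambda>t s. h (t, s)"]) (auto simp: pathstart_def pathfinish_def)
  qed
  then obtain h where Q: "\<And>i. i > 0 \<Longrightarrow> Q i (h i)"
    by metis
  then have cont: "\<And>i. i > 0 \<Longrightarrow> continuous_on ({0..1} \<times> {0..1}) (\<lambda>p. h i (fst p) (snd p))"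
    and h01: "\<And>i s. i > 0 \<Longrightarrow> s \<in> {0..1} \<Longrightarrow> h i 0 s = ed i s \<and> h i 1 s = vx"
    and ends: "\<And>i t. i > 0 \<Longrightarrow> t \<in> {0..1} \<Longrightarrow> h i t 0 = vx \<and> h i t 1 = vx"
    unfolding Q_def by blast+
  \<comment> \<open>At time 1 the radius 1/3 is stretched to 2, so from there outwards the null
    homotopies have reached time 1. The minimum keeps the boundary circle, where
    \<open>r * (1 + 5 * t) - 1\<close> is \<open>5 * t\<close>, at time \<open>t\<close>.\<close>
  define F where "F = (\<lambda>i t r \<theta>. if r * (1 + 5 * t) \<le> 1 then fc i (polar (r * (1 + 5 * t)) \<theta>)
      else slotwise (\<lambda>j. h j (min t (r * (1 + 5 * t) - 1))) i \<theta>)"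
  have sl: "slotwise (\<lambda>j. h j 0) i \<theta> = slotwise ed i \<theta>" "slotwise (\<lambda>j. h j 1) i \<theta> = vx"
    if "i > 0" "\<theta> \<in> {0..1}" for i \<theta>
    using that h01[OF \<open>i > 0\<close>] h01[OF collatz_pos[OF \<open>i > 0\<close>]] by (auto simp: slotwise_def)
  interpret cellwise_homotopy h F
  proof
    fix i t r \<theta> :: real and n :: nat assume n: "n > 0"
    show "continuous_on ({0..1} \<times> {0..1}) (\<lambda>p. h n (fst p) (snd p))" using cont n .
    show "h n t 0 = vx \<and> h n t 1 = vx" if "t \<in> {0..1}" using ends n that .
    show "F n t r 1 = F n t r 0" if "t \<in> {0..1}" "r \<in> {0..1}"
    proof -
      have "r * (1 + 5 * t) - 1 \<ge> 0" if "\<not> r * (1 + 5 * t) \<le> 1" using that by simp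
      then show ?thesis
        using that n ends collatz_pos[OF n] by (auto simp: F_def slotwise_0 slotwise_1 min_def)
    qed
    show "F n t 0 \<theta> = F n t 0 0" by (simp add: F_def polar_def)
    show "F n t 1 \<theta> = slotwise (\<lambda>j. h j t) n \<theta>" if "t \<in> {0..1}" "\<theta> \<in> {0..1}"
      using that n by (auto simp: F_def fc_boundary sl min_def)
    show "continuous_on ({0..1} \<times> {0..1} \<times> {0..1}) (\<lambda>p. F n (fst p) (fst (snd p)) (snd (snd p)))"
      unfolding F_def
    proof (rule continuous_on_cases_le)
      let ?S = "{0..1} \<times> {0..1} \<times> {0..1} :: (real \<times> real \<times> real) set"
      let ?k = "\<lambda>p. fst (snd p) * (1 + 5 * fst p) :: real"
      show "continuous_on {p \<in> ?S. ?k p \<le> 1} (\<lambda>p. fc n (polar (?k p) (snd (snd p))))"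
        by (rule continuous_on_compose2[OF continuous_fc[OF n]])
          (auto intro!: continuous_intros)
      have "continuous_on {p \<in> ?S. 1 \<le> ?k p}
          ((\<lambda>p. slotwise (\<lambda>j. h j (fst p)) n (snd p)) \<circ> (\<lambda>p. (min (fst p) (?k p - 1), snd (snd p))))"
        by (intro continuous_on_compose continuous_intros
            continuous_on_subset[OF continuous_slotwise[OF n cont ends]]) auto
      then show "continuous_on {p \<in> ?S. 1 \<le> ?k p}
          (\<lambda>p. slotwise (\<lambda>j. h j (min (fst p) (?k p - 1))) n (snd (snd p)))"
        by (simp add: o_def)
      show "continuous_on ?S ?k" by (intro continuous_intros)
      show "fc n (polar (?k p) (snd (snd p))) = slotwise (\<lambda>j. h j (min (fst p) (?k p - 1))) n (snd (snd p))"
        if "p \<in> ?S" "?k p = 1" for p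
        using that n by (auto simp: fc_boundary sl min_absorb2)
    qed
  qed
  let ?f = "\<lambda>p. pc_homotopy h F (1, p)"
  have "F i 0 r \<theta> = fc i (polar r \<theta>)" if "r \<le> 1" for i r \<theta>
    using that by (simp add: F_def)
  then have H0: "pc_homotopy h F (0, p) = p" for p
    by (cases p rule: pc_cases) (auto simp: homotopy_ed homotopy_fc h01)
  show thesis
  proof (rule that)
    show "homotopic_with_canon (\<lambda>_. True) UNIV UNIV id ?f"
      using homotopic by (simp add: H0 id_def)
    show "?f (ed i s) = vx" if "i > 0" "s \<in> {0..1}" for i s
      using that by (simp add: homotopy_ed h01)
    show "?f vx = vx" by simp
    show "?f (fc i z) = vx" if "i > 0" "norm z \<in> {1/3..1}" for i z
    proof -
      have "z \<in> cball 0 1" using that by simp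
      then obtain r \<theta> where r: "r \<in> {0..1}" "\<theta> \<in> {0..1}" "z = polar r \<theta>"
        unfolding polar_image[symmetric] by auto
      have "F i 1 r \<theta> = vx"
      proof (cases "r * 6 \<le> 1")
        case True
        with that r show ?thesis by simp
      next
        case False
        then have "min 1 (r * 6 - 1) = 1" using that r by simp
        with False r that show ?thesis by (simp add: F_def sl)
      qed
      then show ?thesis using r that(1) homotopy_fc by simp
    qed
  qed
qed

section \<open>Cancelling the spheres one after the other\<close>

definition clamp01 :: "real \<Rightarrow> real" where
  "clamp01 x = max 0 (min 1 x)"

lemma clamp01_range [simp]: "0 \<le> clamp01 x" "clamp01 x \<le> 1"
  by (auto simp: clamp01_def)

lemma clamp01_le_0 [simp]: "x \<le> 0 \<Longrightarrow> clamp01 x = 0" and clamp01_ge_1 [simp]: "x \<ge> 1 \<Longrightarrow> clamp01 x = 1"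
  and clamp01_id: "0 \<le> x \<Longrightarrow> x \<le> 1 \<Longrightarrow> clamp01 x = x"
  by (auto simp: clamp01_def)

lemma continuous_clamp01 [continuous_intros]:
  "continuous_on S f \<Longrightarrow> continuous_on S (\<lambda>x. clamp01 (f x))"
  unfolding clamp01_def by (intro continuous_intros)

text \<open>The edge \<open>i\<close> moves only during the time interval \<open>[1/(i+1), 1/i]\<close>.\<close>

definition phase :: "nat \<Rightarrow> real \<Rightarrow> real" where
  "phase i t = clamp01 (real i * (real i + 1) * t - real i)"

text \<open>A phase strictly between 0 and 1 puts \<open>t\<close> strictly between 1/(i+1) and 1/i,
  and these open intervals are disjoint. As C(i) differs from i, the two edges in the boundary of a
  face never move together.\<close>

lemma phase_disjoint:
  assumes "i > 0" "j > 0" "i \<noteq> j" "phase i t \<notin> {0, 1}"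
  shows "phase j t \<in> {0, 1}"
proof -
  have p: "1 < (real k + 1) * t \<and> real k * t < 1" if "k > 0" "phase k t \<notin> {0, 1}" for k
  proof -
    have "0 < real k * (real k + 1) * t - real k" "real k * (real k + 1) * t - real k < 1"
      using that(2) by (auto simp: phase_def clamp01_def min_def max_def split: if_splits)
    then have "real k * 1 < real k * ((real k + 1) * t)" "(real k + 1) * (real k * t) < (real k + 1) * 1"
      by (auto simp: algebra_simps)
    then show ?thesis using that(1) by (metis mult_less_cancel_left_pos of_nat_0_less_iff of_nat_Suc zero_less_Suc add.commute)
  qed
  show ?thesis
  proof (rule ccontr)
    assume "phase j t \<notin> {0, 1}"
    with p assms have *: "1 < (real i + 1) * t" "real i * t < 1" "1 < (real j + 1) * t" "real j * t < 1"
      by blast+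
    then have "t > 0"
      by (smt (verit) mult_nonneg_nonpos of_nat_0_le_iff)
    consider "real i + 1 \<le> real j" | "real j + 1 \<le> real i" using assms(3) by linarith
    then show False
    proof cases
      case 1
      then have "(real i + 1) * t \<le> real j * t" using \<open>t > 0\<close> by (intro mult_right_mono) auto
      with * show False by linarith
    next
      case 2
      then have "(real j + 1) * t \<le> real i * t" using \<open>t > 0\<close> by (intro mult_right_mono) auto
      with * show False by linarith
    qed
  qed
qed

text \<open>In the proof, \<open>u i\<close> is the sphere of the face \<open>i\<close>, as a map on the plane that is constant
  outside the unit disc. The edge \<open>i\<close> follows the sphere along the circles \<open>loop \<tau>\<close> through 1 with
  centre \<open>\<tau>\<close>, clockwise, so that \<open>\<tau>\<close> from 0 to 1 sweeps over the disc once. When only the edge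
  \<open>i\<close> moves, its three occurrences make the boundary of the face follow the same circle with the
  angle function \<open>g\<close>, which has degree 1; this extends over the face by a homotopy from \<open>g\<close> to the
  identity (\<open>F1\<close>). When only the edge \<open>C(i)\<close> moves, the boundary goes back and forth along its
  circle with the angle function \<open>h\<close>, which is contracted in an outer ring (\<open>F2\<close>).\<close>

lemma collapsed_homotopic_constant:
  assumes f: "continuous_on UNIV f" and f_vx: "f vx = vx"
    and f_ed: "\<And>i s. i > 0 \<Longrightarrow> s \<in> {0..1} \<Longrightarrow> f (ed i s) = vx"
    and f_fc: "\<And>i z. i > 0 \<Longrightarrow> norm z \<in> {1/3..1} \<Longrightarrow> f (fc i z) = vx"
  shows "homotopic_with_canon (\<lambda>_. True) UNIV UNIV f (\<lambda>_. vx)"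
proof -
  \<comment> \<open>The map \<open>f\<close> is constant from radius 1/3 on, so the rest of the face
    is rescaled to the unit disc.\<close>
  define u where "u i z = (if norm z \<le> 1 then f (fc i (z / 3)) else vx)" for i z
  have u_vx: "u i z = vx" if "i > 0" "norm z \<ge> 1" for i z
    using that f_fc[of i "z / 3"] by (auto simp: u_def norm_divide)
  have cont_u: "continuous_on UNIV (u i)" if "i > 0" for i
  proof -
    have "continuous_on UNIV (\<lambda>z. if norm z \<le> 1 then f (fc i (z / 3)) else vx)"
    proof (rule continuous_on_cases_le)
      have "continuous_on {z \<in> UNIV. norm z \<le> 1} (f \<circ> (fc i \<circ> (\<lambda>z. z / 3)))"
        by (intro continuous_on_compose continuous_intros continuous_on_subset[OF continuous_fc[OF that]]
            continuous_on_subset[OF f]) (auto simp: norm_divide)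
      then show "continuous_on {z \<in> UNIV. norm z \<le> 1} (\<lambda>z. f (fc i (z / 3)))" by (simp add: o_def)
      show "f (fc i (z / 3)) = vx" if "norm z = 1" for z
        using f_fc[OF \<open>i > 0\<close>, of "z / 3"] that by (simp add: norm_divide)
    qed (auto intro: continuous_intros)
    then show ?thesis by (simp add: u_def[abs_def])
  qed
  define loop where "loop \<tau> s = of_real \<tau> + polar (1 - \<tau>) s" for \<tau> s
  \<comment> \<open>The angle rests at 0 in the first slot, falls to -1 in the second, rests in the
    third and rises by 1 in each of the last two: degree -1 + 1 + 1 = 1.\<close>
  define g where "g \<theta> = max 0 (5 * \<theta> - 3) - clamp01 (5 * \<theta> - 1)" for \<theta> :: real
  define h where "h \<theta> = max 0 (1 - 5 * \<theta>) + clamp01 (5 * \<theta> - 2)" for \<theta> :: real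
  define E where "E i t s = u i (loop (phase i t) (- s))" for i t s
  \<comment> \<open>The disc inside the circle of the edge is the part of the sphere not yet swept.
    It is placed at radii up to 1/3 and shrinks to the point 1; between radii 1/3 and 2/3 the angle
    is deformed from \<theta> to \<open>g \<theta>\<close>.\<close>
  define F1 where "F1 i t r \<theta> = u i (of_real (phase i t) +
      polar ((1 - phase i t) * min 1 (3 * r)) (\<theta> + clamp01 (3 * r - 1) * (g \<theta> - \<theta>)))" for i t r \<theta>
  \<comment> \<open>At radius 2/3 the loop is contracted to its start 1, where \<open>u\<close> has
    the value \<open>vx\<close>.\<close>
  define F2 where "F2 i t r \<theta> = u (collatz i) (loop (phase (collatz i) t) (- h \<theta> * clamp01 (3 * r - 2)))" for i t r \<theta>
  \<comment> \<open>While C(i) moves, i rests and \<open>F1\<close> is \<open>vx\<close> from radius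
    1/3 on, so \<open>F2\<close> can take over in the outer ring.\<close>
  define F where "F i t r \<theta> = (if r \<le> 2/3 \<or> phase (collatz i) t \<in> {0, 1} then F1 i t r \<theta> else F2 i t r \<theta>)" for i t r \<theta>
  have norm_loop: "norm (loop \<tau> s) \<ge> 1" if "\<tau> = 0 \<or> \<tau> = 1 \<or> s = 0 \<or> s = -1" for \<tau> s
  proof -
    have "polar (1 - \<tau>) (-1) = polar (1 - \<tau>) 0" using polar_shift[of "1 - \<tau>" "-1"] by simp
    then show ?thesis using that by (auto simp: loop_def polar_def)
  qed
  have E_vx: "E i t s = vx" if "i > 0" "phase i t \<in> {0, 1} \<or> s = 0 \<or> s = 1" for i t s
    unfolding E_def by (rule u_vx[OF that(1)], rule norm_loop) (use that in auto)
  have F1_vx: "F1 i t r \<theta> = vx" if "i > 0" "phase i t \<in> {0, 1}" "r \<ge> 1/3" for i t r \<theta>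
    unfolding F1_def using that by (intro u_vx) (auto simp: min_def norm_polar)
  have F2_vx: "F2 i t r \<theta> = vx" if "i > 0" "phase (collatz i) t \<in> {0, 1} \<or> r \<le> 2/3" for i t r \<theta>
    unfolding F2_def by (rule u_vx[OF collatz_pos[OF that(1)]], rule norm_loop) (use that in auto)
  have phase_0: "phase i 0 = 0" for i by (simp add: phase_def)
  have phase_1: "phase i 1 = 1" if "i > 0" for i
  proof -
    have "real i * (real i + 1) * 1 - real i = real i * real i" by (simp add: algebra_simps)
    moreover have "real i * real i \<ge> 1" using that by (simp add: mult_ge1_I)
    ultimately show ?thesis unfolding phase_def by simp
  qed
  interpret cellwise_homotopy E F
  proof
    fix t r \<theta> :: real and i :: nat assume i: "i > 0"
    note C = collatz_pos[OF i]
    show "continuous_on ({0..1} \<times> {0..1}) (\<lambda>p. E i (fst p) (snd p))"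
      unfolding E_def loop_def phase_def
      by (rule continuous_on_compose2[OF cont_u[OF i]]) (auto intro!: continuous_intros)
    show "E i t 0 = vx \<and> E i t 1 = vx" using E_vx i by simp
    show "F i t r 1 = F i t r 0"
      by (simp add: F_def F1_def F2_def g_def h_def)
    show "F i t 0 \<theta> = F i t 0 0"
      by (simp add: F_def F1_def polar_def)
    show "F i t 1 \<theta> = slotwise (\<lambda>j. E j t) i \<theta>" if "t \<in> {0..1}" "\<theta> \<in> {0..1}"
    proof -
      consider "\<theta> \<le> 1/5" | "\<not> \<theta> \<le> 1/5" "\<theta> \<le> 2/5" | "\<not> \<theta> \<le> 2/5" "\<theta> \<le> 3/5"
        | "\<not> \<theta> \<le> 3/5" "\<theta> \<le> 4/5" | "\<not> \<theta> \<le> 4/5" by linarith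
      note slots = this
      show ?thesis
      proof (cases "phase (collatz i) t \<in> {0, 1}")
        case True
        then have EC: "E (collatz i) t s = vx" for s using E_vx C by blast
        have "F i t 1 \<theta> = u i (loop (phase i t) (g \<theta>))"
          using True by (simp add: F_def F1_def loop_def)
        also have "\<dots> = slotwise (\<lambda>j. E j t) i \<theta>"
          using slots
        proof cases
          case 1
          then show ?thesis using that EC i by (simp add: slotwise_def g_def u_vx norm_loop)
        next
          case 2
          then show ?thesis using that by (simp add: slotwise_def g_def clamp01_id E_def)
        next
          case 3
          then show ?thesis using that EC i by (simp add: slotwise_def g_def u_vx norm_loop)
        next
          case 4
          then show ?thesis using that by (simp add: slotwise_def g_def E_def)
        next
          case 5
          have "loop (phase i t) (5 * \<theta> - 5) = loop (phase i t) (5 * \<theta> - 4)"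
            using polar_shift[of _ "5 * \<theta> - 5"] by (simp add: loop_def)
          with 5 show ?thesis using that by (simp add: slotwise_def g_def E_def)
        qed
        finally show ?thesis .
      next
        case False
        then have "phase i t \<in> {0, 1}" using phase_disjoint[OF C i collatz_neq[OF i]] by blast
        then have Ei: "E i t s = vx" for s using E_vx i by blast
        have "F i t 1 \<theta> = u (collatz i) (loop (phase (collatz i) t) (- h \<theta>))"
          using False by (simp add: F_def F2_def)
        also have "\<dots> = slotwise (\<lambda>j. E j t) i \<theta>"
          using slots
        proof cases
          case 1
          then show ?thesis using that by (simp add: slotwise_def h_def E_def)
        next
          case 2
          then show ?thesis using that C Ei by (simp add: slotwise_def h_def u_vx norm_loop)
        next
          case 3
          then show ?thesis using that by (simp add: slotwise_def h_def clamp01_id E_def)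
        next
          case 4
          then show ?thesis using that C Ei by (simp add: slotwise_def h_def u_vx norm_loop)
        next
          case 5
          then show ?thesis using that C Ei by (simp add: slotwise_def h_def u_vx norm_loop)
        qed
        finally show ?thesis .
      qed
    qed
    show "continuous_on ({0..1} \<times> {0..1} \<times> {0..1}) (\<lambda>p. F i (fst p) (fst (snd p)) (snd (snd p)))"
    proof -
      let ?K = "{0..1} \<times> {0..1} \<times> {0..1} :: (real \<times> real \<times> real) set"
      let ?\<tau> = "\<lambda>p. phase (collatz i) (fst p)"
      \<comment> \<open>These closed sets cover everything because one of the two edges always
        rests; on their overlap \<open>F1\<close> and \<open>F2\<close> are both
        \<open>vx\<close>.\<close>
      let ?S = "?K \<inter> ({p. fst (snd p) \<le> 2/3} \<union> ({p. ?\<tau> p = 0} \<union> {p. ?\<tau> p = 1}))"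
      let ?T = "?K \<inter> ({p. 2/3 \<le> fst (snd p)} \<inter> ({p. phase i (fst p) = 0} \<union> {p. phase i (fst p) = 1}))"
      have cp: "continuous_on UNIV (\<lambda>p. phase j (fst p))" for j
        unfolding phase_def by (intro continuous_intros)
      have K: "closed ?K" by (intro closed_Times) auto
      have "closed ?S" "closed ?T"
        by (intro closed_Int K closed_Un closed_Collect_le closed_Collect_eq cp continuous_intros)+
      moreover have "continuous_on ?S (\<lambda>p. F1 i (fst p) (fst (snd p)) (snd (snd p)))"
        unfolding F1_def g_def phase_def
        by (rule continuous_on_compose2[OF cont_u[OF i]]) (auto intro!: continuous_intros)
      moreover have "continuous_on ?T (\<lambda>p. F2 i (fst p) (fst (snd p)) (snd (snd p)))"
        unfolding F2_def loop_def h_def phase_def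
        by (rule continuous_on_compose2[OF cont_u[OF C]]) (auto intro!: continuous_intros)
      ultimately have "continuous_on (?S \<union> ?T) (\<lambda>p. F i (fst p) (fst (snd p)) (snd (snd p)))"
        unfolding F_def
        by (rule continuous_on_cases) (auto simp: F1_vx F2_vx i)
      moreover have "?S \<union> ?T = ?K"
        using phase_disjoint[OF C i collatz_neq[OF i]] by auto
      ultimately show ?thesis by simp
    qed
  qed
  have "F i 0 r \<theta> = f (fc i (polar r \<theta>))" if "i > 0" "0 \<le> r" "r \<le> 1" for i r \<theta>
  proof (cases "r \<le> 1/3")
    case True
    then show ?thesis using that by (simp add: F_def F1_def phase_0 u_def polar_def norm_mult)
  next
    case False
    then have "F i 0 r \<theta> = vx" using that F1_vx F2_vx by (simp add: F_def phase_0)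
    then show ?thesis using f_fc[OF \<open>i > 0\<close>, of "polar r \<theta>"] that False by simp
  qed
  then have H0: "pc_homotopy E F (0, p) = f p" for p
    by (cases p rule: pc_cases) (auto simp: homotopy_ed homotopy_fc f_vx f_ed E_vx phase_0)
  have "F i 1 r \<theta> = vx" if "i > 0" "0 \<le> r" "r \<le> 1" for i r \<theta>
    using that u_vx by (simp add: F_def F1_def phase_1 collatz_pos polar_def)
  then have H1: "pc_homotopy E F (1, p) = vx" for p
    by (cases p rule: pc_cases) (auto simp: homotopy_ed homotopy_fc E_vx phase_1)
  show ?thesis using homotopic by (simp add: H0 H1)
qed

section \<open>The fundamental group\<close>

text \<open>The homotopy takes place inside the interval and is pushed forward by \<open>p\<close>,
  so the target may be any topological space. The next two lemmas use the same device.\<close>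

lemma homotopic_paths_const_right:
  fixes p :: "real \<Rightarrow> 'a::topological_space"
  assumes "path p" "path_image p \<subseteq> S" "pathfinish p = x"
  shows "homotopic_paths S (p +++ (\<lambda>_. x)) p"
proof -
  have "homotopic_paths {0..1} (linepath 0 1 +++ linepath 1 1) (linepath 0 (1::real))"
    by (rule homotopic_paths_rid') (simp_all add: closed_segment_eq_real_ivl)
  then have "homotopic_paths S (p \<circ> (linepath 0 1 +++ linepath 1 1)) (p \<circ> linepath 0 1)"
    by (rule homotopic_paths_continuous_image) (use assms in \<open>auto simp: path_def path_image_def\<close>)
  moreover have "p \<circ> linepath 0 1 = p" "p \<circ> (linepath 0 1 +++ linepath 1 1) = p +++ (\<lambda>_. x)"
    using assms(3) by (auto simp: linepath_def joinpaths_def pathfinish_def)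
  ultimately show ?thesis by simp
qed

lemma homotopic_paths_const_left:
  fixes p :: "real \<Rightarrow> 'a::topological_space"
  assumes "path p" "path_image p \<subseteq> S" "pathstart p = x"
  shows "homotopic_paths S ((\<lambda>_. x) +++ p) p"
proof -
  have "homotopic_paths {0..1} (linepath 0 0 +++ linepath 0 1) (linepath 0 (1::real))"
    by (rule homotopic_paths_lid') (simp_all add: closed_segment_eq_real_ivl)
  then have "homotopic_paths S (p \<circ> (linepath 0 0 +++ linepath 0 1)) (p \<circ> linepath 0 1)"
    by (rule homotopic_paths_continuous_image) (use assms in \<open>auto simp: path_def path_image_def\<close>)
  moreover have "p \<circ> linepath 0 1 = p" "p \<circ> (linepath 0 0 +++ linepath 0 1) = (\<lambda>_. x) +++ p"
    using assms(3) by (auto simp: linepath_def joinpaths_def pathstart_def)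
  ultimately show ?thesis by simp
qed

lemma homotopic_paths_reversepath_left:
  fixes p :: "real \<Rightarrow> 'a::topological_space"
  assumes "path p" "path_image p \<subseteq> S" "pathfinish p = x"
  shows "homotopic_paths S (reversepath p +++ p) (\<lambda>_. x)"
proof -
  have "homotopic_paths {0..1} (reversepath (linepath 0 1) +++ linepath 0 1) (linepath 1 (1::real))"
    using homotopic_paths_linv[of "linepath 0 (1::real)" "{0..1}"]
    by (simp add: closed_segment_eq_real_ivl del: reversepath_linepath)
  then have "homotopic_paths S (p \<circ> (reversepath (linepath 0 1) +++ linepath 0 1)) (p \<circ> linepath 1 1)"
    by (rule homotopic_paths_continuous_image) (use assms in \<open>auto simp: path_def path_image_def\<close>)
  moreover have "p \<circ> linepath 1 1 = (\<lambda>_. x)"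
    "p \<circ> (reversepath (linepath 0 1) +++ linepath 0 1) = reversepath p +++ p"
    using assms(3) by (auto simp: linepath_def joinpaths_def pathfinish_def reversepath_def)
  ultimately show ?thesis by simp
qed

lemma pathstart_const [simp]: "pathstart (\<lambda>_. x) = x" and pathfinish_const [simp]: "pathfinish (\<lambda>_. x) = x"
  by (simp_all add: pathstart_def pathfinish_def)

\<comment> \<open>The fundamental group at \<open>vx\<close>, made a type so that it can be an
  instance of \<open>group_add\<close>, which does not assume commutativity.\<close>
quotient_type loop_class = "real \<Rightarrow> pc" / partial:
  "\<lambda>p q. homotopic_paths UNIV p q \<and> pathstart p = vx \<and> pathfinish p = vx"
proof (rule part_equivpI)
  show "\<exists>p. homotopic_paths UNIV p p \<and> pathstart p = vx \<and> pathfinish p = vx"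
    by (rule exI[of _ "\<lambda>_. vx"]) (simp add: path_def pathstart_def pathfinish_def)
  show "symp (\<lambda>p q. homotopic_paths UNIV p q \<and> pathstart p = vx \<and> pathfinish p = vx)"
    by (metis (mono_tags, lifting) homotopic_paths_imp_pathfinish homotopic_paths_imp_pathstart
        homotopic_paths_sym sympI)
  show "transp (\<lambda>p q. homotopic_paths UNIV p q \<and> pathstart p = vx \<and> pathfinish p = vx)"
    by (metis (mono_tags, lifting) homotopic_paths_trans transpI)
qed

instantiation loop_class :: group_add
begin

lift_definition zero_loop_class :: loop_class is "\<lambda>_. vx"
  by (simp add: path_def pathstart_def pathfinish_def)

lift_definition plus_loop_class :: "loop_class \<Rightarrow> loop_class \<Rightarrow> loop_class" is "(+++)"
  by (simp add: homotopic_paths_join homotopic_paths_imp_pathstart homotopic_paths_imp_pathfinish)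

lift_definition uminus_loop_class :: "loop_class \<Rightarrow> loop_class" is reversepath
  by (simp add: homotopic_paths_reversepath)

definition minus_loop_class :: "loop_class \<Rightarrow> loop_class \<Rightarrow> loop_class" where
  "minus_loop_class a b = a + - b"

instance
proof
  fix a b c :: loop_class
  show "a + b + c = a + (b + c)"
    by transfer (auto intro!: homotopic_paths_sym[OF homotopic_paths_assoc] dest: homotopic_paths_imp_path)
  show "0 + a = a"
    by transfer (auto intro!: homotopic_paths_const_left dest: homotopic_paths_imp_path)
  show "a + 0 = a"
    by transfer (auto intro!: homotopic_paths_const_right dest: homotopic_paths_imp_path)
  show "- a + a = 0"
    by transfer (auto intro!: homotopic_paths_reversepath_left dest: homotopic_paths_imp_path)
  show "a + - b = a - b"
    by (simp add: minus_loop_class_def)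
qed

end

lift_definition edge_class :: "nat \<Rightarrow> loop_class" is "\<lambda>i. if i > 0 then ed i else (\<lambda>_. vx)"
  by (auto simp: path_def pathstart_def pathfinish_def continuous_ed)

lemma edge_class_eq_0:
  "i > 0 \<Longrightarrow> edge_class i = 0 \<longleftrightarrow> homotopic_paths UNIV (ed i) (\<lambda>_. vx)"
  by transfer (auto simp: pathstart_def pathfinish_def)

lemma slotwise_fifth:
  "slotwise E i (x / 5) =
     (if x \<le> 1 then E (collatz i) (1 - x)
      else if x \<le> 2 then E i (x - 1)
      else if x \<le> 3 then E (collatz i) (x - 2)
      else if x \<le> 4 then E i (4 - x)
      else E i (5 - x))"
  by (simp add: slotwise_def)

text \<open>The boundary circle is null-homotopic in the closed disc, and \<open>fc i\<close>
  carries it to the word of the face.\<close>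

lemma edge_class_relation:
  assumes "i > 0"
  shows "- edge_class (collatz i) + (edge_class i + (edge_class (collatz i) + (- edge_class i + - edge_class i))) = 0"
proof -
  note C = collatz_pos[OF assms]
  \<comment> \<open>The circle is cut into five linear pieces, bracketed exactly like the word, so
    that both loops agree pointwise without reparametrisation.\<close>
  let ?l = "\<lambda>k. linepath (real k / 5) ((real k + 1) / 5)"
  let ?L = "?l 0 +++ (?l 1 +++ (?l 2 +++ (?l 3 +++ ?l 4)))"
  let ?J = "reversepath (ed (collatz i)) +++ (ed i +++ (ed (collatz i) +++ (reversepath (ed i) +++ reversepath (ed i))))"
  have L: "path ?L" "pathstart ?L = 0" "pathfinish ?L = 1" by simp_all
  let ?q = "polar 1 \<circ> ?L"
  have cp: "continuous_on UNIV (polar 1)"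
    unfolding polar_def cis_conv_exp by (intro continuous_intros)
  have "path ?q"
    by (intro path_continuous_image L continuous_on_subset[OF cp]) auto
  moreover have "path_image ?q \<subseteq> cball 0 1"
    by (auto simp: path_image_def)
  moreover have "pathstart ?q = 1" "pathfinish ?q = 1"
    using L by (simp_all add: pathstart_compose pathfinish_compose polar_def)
  moreover have "simply_connected (cball 0 1 :: complex set)"
    by (intro convex_imp_simply_connected) auto
  ultimately have "homotopic_paths (cball 0 1) ?q (linepath 1 1)"
    unfolding simply_connected_eq_homotopic_paths by auto
  then have "homotopic_paths UNIV (fc i \<circ> ?q) (fc i \<circ> linepath 1 1)"
    by (rule homotopic_paths_continuous_image) (use continuous_fc assms in auto)
  moreover have "fc i \<circ> linepath 1 1 = (\<lambda>_. vx)"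
  proof -
    have "fc i 1 = slotwise ed i 0" using fc_boundary[OF assms, of 0] by (simp add: polar_def)
    then show ?thesis using C by (auto simp: slotwise_def linepath_def)
  qed
  moreover have "(fc i \<circ> ?q) t = ?J t" if "t \<in> {0..1}" for t
  proof -
    have s: "(fc i \<circ> (polar 1 \<circ> ?l k)) t = slotwise ed i ((real k + t) / 5)" if "t \<in> {0..1}" "k < 5" for k t
    proof -
      have l: "?l k t = (real k + t) / 5" by (simp add: linepath_def field_simps)
      show ?thesis
        unfolding o_def l using that assms by (intro fc_boundary) auto
    qed
    have join: "(p +++ q) t = (p' +++ q') t"
      if "\<And>t. t \<in> {0..1} \<Longrightarrow> p t = p' t" "\<And>t. t \<in> {0..1} \<Longrightarrow> q t = q' t" "t \<in> {0..1}"
      for p p' q q' :: "real \<Rightarrow> pc" and t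
      using that by (auto simp: joinpaths_def)
    have *: "(fc i \<circ> (polar 1 \<circ> ?l 0)) t = reversepath (ed (collatz i)) t"
        "(fc i \<circ> (polar 1 \<circ> ?l 1)) t = ed i t" "(fc i \<circ> (polar 1 \<circ> ?l 2)) t = ed (collatz i) t"
        "(fc i \<circ> (polar 1 \<circ> ?l 3)) t = reversepath (ed i) t" "(fc i \<circ> (polar 1 \<circ> ?l 4)) t = reversepath (ed i) t"
      if "t \<in> {0..1}" for t
      using that assms C
      by (subst s; cases "t = 0"; auto simp: slotwise_fifth slotwise_0 reversepath_def)+
    show ?thesis
      unfolding path_compose_join
      by (intro join * that)
  qed
  moreover have J: "path ?J" "pathstart ?J = vx" "pathfinish ?J = vx"
    using assms C continuous_ed by (auto simp: path_def[symmetric] pathstart_def[of "ed _"] pathfinish_def[of "ed _"])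
  ultimately have "homotopic_paths UNIV (fc i \<circ> ?q) (\<lambda>_. vx)"
    and "homotopic_paths UNIV ?J (fc i \<circ> ?q)"
    by (simp, intro homotopic_paths_eq) auto
  then have "homotopic_paths UNIV ?J (\<lambda>_. vx)"
    by (rule homotopic_paths_trans[rotated])
  then show ?thesis
    using assms C J(2,3) by transfer simp
qed

text \<open>Conjugating \<open>c\<close> by both sides of \<open>a\<close> expresses \<open>a\<close> by \<open>b\<close> and \<open>c\<close>. Inserting this in the last
  relation turns \<open>c\<close> into a multiple of \<open>b\<close>; then \<open>b\<close> and \<open>c\<close> commute and \<open>b = b + b\<close>.\<close>

lemma higman_three_generators_trivial:
  fixes a b c :: "'a::group_add"
  assumes a: "a + b = b + (a + a)" and b: "b + c = c + (b + b)" and c: "c + a = a + (c + c)"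
  shows "a = 0"
proof -
  have b1: "b + (c + x) = c + (b + (b + x))" for x
    using b by (metis add.assoc)
  have b2: "- b + c = c + (- b + - b)"
    using b1[of "- b + - b"] by (metis add.assoc add.right_neutral add_minus_cancel minus_add_cancel)
  have b3: "- b + (c + x) = c + (- b + (- b + x))" for x
    using b2 by (metis add.assoc)
  have b5: "- c + (b + x) = b + (b + (- c + x))" for x
    using b1[of "- c + x"] by (metis add_minus_cancel minus_add_cancel)
  have b6: "- c + b = b + (b + - c)"
    using b5[of 0] by (simp only: add.right_neutral)
  have b7: "- c + (- b + x) = - b + (- b + (- c + x))" for x
    using b3[of "- c + x"] by (metis add_minus_cancel minus_add_cancel)
  have ac: "- a + (c + x) = c + (c + (- a + x))" for x
  proof -
    have "c + (a + y) = a + (c + (c + y))" for y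
      using c by (metis add.assoc)
    from this[of "- a + x"] show ?thesis
      by (metis add_minus_cancel minus_add_cancel)
  qed
  have ab: "- a + (- b + (a + x)) = a + (- b + x)" for x
  proof -
    have "a + b + - a = b + (a + a) + - a"
      by (simp only: a)
    then have "b + a = a + (b + - a)"
      by (simp only: add.assoc right_minus add.right_neutral)
    then have "- (- a + (b + a)) = - (b + - a)"
      by (simp only: minus_add_cancel)
    then have "- a + (- b + a) = a + - b"
      by (simp only: minus_add minus_minus add.assoc)
    then show ?thesis by (metis add.assoc)
  qed
  have "- (a + b) + (c + (a + b)) = - (b + (a + a)) + (c + (b + (a + a)))"
    by (simp only: a)
  then have "- b + (- a + (c + (a + b))) = - a + (- a + (- b + (c + (b + (a + a)))))"
    by (simp only: minus_add add.assoc)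
  then have "- b + (c + (c + b)) = - a + (- a + (- b + (c + (b + (a + a)))))"
    by (simp only: ac minus_add_cancel)
  also have "\<dots> = c + (c + (c + (c + (- b + a))))"
    by (simp only: b3 ac ab minus_add_cancel)
  finally have q: "- b + (c + (c + b)) = c + (c + (c + (c + (- b + a))))" .
  have a': "a = b + (- c + (- c + (- c + (- c + (- b + (c + (c + b)))))))"
    unfolding q by (simp only: add_minus_cancel minus_add_cancel)
  \<comment> \<open>Moving an element past \<open>- c\<close> on its left doubles its multiple of
    \<open>b\<close>. Collecting \<open>c\<close> on the right in \<open>a'\<close> therefore leaves
    the coefficient 1 - 16 + 4 = -11 of \<open>b\<close>, that is, a = -11 b - 2 c.\<close>
  let ?n = "\<lambda>x. - b + (- b + (- b + (- b + (- b + (- b + (- b + (- b + (- b + (- b + (- b + x))))))))))"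
  have 1: "c + a = c + ?n (- c + (- c + 0))"
    unfolding a' by (simp only: b1 b3 b5 b6 b7 minus_add_cancel add_minus_cancel add.right_neutral)
  have 2: "a + (c + c) = ?n 0"
    unfolding a' by (simp only: b1 b3 b5 b6 b7 minus_add_cancel add_minus_cancel add.right_neutral add.assoc left_minus)
  from 1 2 c have "c + ?n (- c + (- c + 0)) = ?n 0"
    by (simp only:)
  then have "c + ?n (- c + (- c + 0)) + (c + c) = ?n 0 + (c + c)"
    by (simp only:)
  then have "c + ?n 0 = ?n 0 + (c + c)"
    by (simp only: add.assoc minus_add_cancel add.right_neutral add_0 add_0_left left_minus)
  \<comment> \<open>Each \<open>c\<close> that passes to the left doubles the coefficient of
    \<open>b\<close>: -11, -22, -44. Comparison with -11 gives c = 33 b.\<close>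
  also have "\<dots> = c + (c + ?n (?n (?n (?n 0))))"
    by (simp only: b2 b3 add.assoc add.right_neutral add_0_left)
  finally have "?n 0 = c + ?n (?n (?n (?n 0)))"
    by (simp only: add_left_cancel)
  moreover define N M where "N = ?n 0" and "M = ?n (?n (?n (?n 0)))"
  ultimately have N: "N = c + M"
    by (simp only:)
  have "b + N = N + b" "b + M = M + b"
    unfolding N_def M_def by (simp_all only: add.assoc minus_add_cancel add_minus_cancel add.right_neutral add_0_left left_minus)
  then have "b + (c + M) = c + (b + M)"
    unfolding N by (simp only: add.assoc)
  then have "b + c = c + b"
    by (simp only: add.assoc[symmetric] add_right_cancel)
  with b have "b = 0" by (simp add: add_left_cancel) (metis add.right_neutral add_left_cancel)
  with a have "a = a + a" by simp
  then show ?thesis by (metis add.right_neutral add_left_cancel)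
qed

lemma edge_classes_trivial:
  assumes "\<forall>i::nat. i > 0 \<longrightarrow> 1 \<in> {(collatz ^^ k) i | k. True}" and "i > 0"
  shows "edge_class i = 0"
proof -
  have rel: "edge_class i + edge_class (collatz i) = edge_class (collatz i) + (edge_class i + edge_class i)"
    if "i > 0" for i
    using edge_class_relation[OF that]
    by (metis add.assoc add_0 add_minus_cancel left_minus minus_add neg_eq_iff_add_eq_0)
  have "collatz 1 = 4" "collatz 4 = 2" "collatz 2 = 1" by (simp_all add: collatz_def)
  then have 1: "edge_class 1 = 0"
    using rel[of 1] rel[of 4] rel[of 2] by (intro higman_three_generators_trivial[of _ "edge_class 4" "edge_class 2"]) auto
  have "1 \<in> {(collatz ^^ k) i | k. True}" using assms by blast
  then obtain k where "(collatz ^^ k) i = 1" by auto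
  then show ?thesis using \<open>i > 0\<close>
  proof (induction k arbitrary: i)
    case 0 then show ?case using 1 by simp
  next
    case (Suc k)
    then have "edge_class (collatz i) = 0"
      by (intro Suc.IH) (auto simp: funpow_swap1 collatz_pos)
    with rel[OF Suc.prems(2)] show ?case
      by simp (metis add.right_neutral add_left_cancel)
  qed
qed

lemma contractible_if_collatz:
  assumes "\<forall>i::nat. i > 0 \<longrightarrow> 1 \<in> {(collatz ^^ k) i | k. True}"
  shows "contractible (UNIV :: pc set)"
proof -
  have null: "homotopic_paths UNIV (ed i) (\<lambda>_. vx)" if "i > 0" for i
    using edge_classes_trivial[OF assms that] edge_class_eq_0[OF that] by simp
  show ?thesis
  proof (rule homotopic_id_collapse_edges[OF null])
    fix f assume f: "homotopic_with_canon (\<lambda>_. True) UNIV UNIV id f"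
      "\<And>i s. i > 0 \<Longrightarrow> s \<in> {0..1} \<Longrightarrow> f (ed i s) = vx" "f vx = vx"
      "\<And>i z. i > 0 \<Longrightarrow> norm z \<in> {1/3..1} \<Longrightarrow> f (fc i z) = vx"
    have "continuous_on UNIV f"
      using homotopic_with_imp_continuous[OF f(1)] by simp
    then have "homotopic_with_canon (\<lambda>_. True) UNIV UNIV f (\<lambda>_. vx)"
      using f(3,2,4) by (rule collapsed_homotopic_constant)
    with f(1) have "homotopic_with_canon (\<lambda>_. True) UNIV UNIV id (\<lambda>_. vx)"
      by (rule homotopic_with_trans)
    then show ?thesis
      unfolding contractible_def by blast
  qed
qed

section \<open>Local systems on contractible spaces\<close>

lemma openin_UN: "(\<And>i. i \<in> I \<Longrightarrow> openin X (B i)) \<Longrightarrow> openin X (\<Union>i\<in>I. B i)"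
  by (rule openin_Union) auto

text \<open>\<open>sec c x p y\<close>: over the chart \<open>c\<close>, the section with parameter \<open>x\<close> has the value \<open>y\<close> at the point
  \<open>p\<close>. The charts contain the points where there are such values.\<close>

locale local_system =
  fixes sec :: "'c \<Rightarrow> 'x \<Rightarrow> 'p::topological_space \<Rightarrow> 'x \<Rightarrow> bool"
  assumes sec_bij: "(\<forall>x y. \<not> sec c x p y) \<or> (\<exists>b. bij b \<and> (\<forall>x y. sec c x p y \<longleftrightarrow> y = b x))"
    and sec_cover: "\<exists>c x y. sec c x p y"
    and sec_open: "open {p. \<exists>y. sec c x p y \<and> sec c' x' p y}"
begin

lemma ex_base: "sec c x p y \<Longrightarrow> \<exists>x'. sec c x' p y'"
  using sec_bij[of c p] by (metis bij_is_surj surj_def)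

lemma ex_value: "sec c x p y \<Longrightarrow> \<exists>y'. sec c x' p y'"
  using sec_bij[of c p] by blast

lemma base_unique: "sec c x p y \<Longrightarrow> sec c x' p y \<Longrightarrow> x = x'"
  using sec_bij[of c p] by (metis bij_is_inj injD)

lemma value_unique: "sec c x p y \<Longrightarrow> sec c x p y' \<Longrightarrow> y = y'"
  using sec_bij[of c p] by metis

lemma ex_chart: "\<exists>c x. sec c x p y"
  using sec_cover[of p] ex_base by metis

text \<open>This is continuity of a map into the total space, whose topology is generated by the
  images of the sections.\<close>

definition lifting :: "'z::topological_space set \<Rightarrow> ('z \<Rightarrow> 'p) \<Rightarrow> ('z \<Rightarrow> 'x) \<Rightarrow> bool" where
  "lifting S h l \<longleftrightarrow> (\<forall>c x. openin (top_of_set S) {z \<in> S. sec c x (h z) (l z)})"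

lemma liftingI:
  assumes h: "continuous_on S h"
    and loc: "\<And>z. z \<in> S \<Longrightarrow> \<exists>U c x. openin (top_of_set S) U \<and> z \<in> U \<and> (\<forall>w\<in>U. sec c x (h w) (l w))"
  shows "lifting S h l"
  unfolding lifting_def
proof (intro allI)
  fix c' x'
  let ?A = "{z \<in> S. sec c' x' (h z) (l z)}"
  show "openin (top_of_set S) ?A"
  proof (subst openin_subopen, intro ballI)
    fix z assume z: "z \<in> ?A"
    then obtain U c x where U: "openin (top_of_set S) U" "z \<in> U" "\<forall>w\<in>U. sec c x (h w) (l w)"
      using loc by blast
    let ?T = "U \<inter> (S \<inter> h -` {p. \<exists>y. sec c x p y \<and> sec c' x' p y})"
    have "openin (top_of_set S) ?T"
      using U(1) continuous_openin_preimage_gen[OF h sec_open] by blast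
    moreover have "z \<in> ?T" using z U by auto
    moreover have "?T \<subseteq> ?A"
    proof
      fix w assume w: "w \<in> ?T"
      then obtain y where "sec c x (h w) y" "sec c' x' (h w) y" by auto
      moreover have "sec c x (h w) (l w)" using w U by auto
      ultimately have "y = l w" "sec c' x' (h w) y" using value_unique by blast+
      then show "w \<in> ?A" using w U(1) openin_imp_subset by auto
    qed
    ultimately show "\<exists>T. openin (top_of_set S) T \<and> z \<in> T \<and> T \<subseteq> ?A" by blast
  qed
qed

lemma lifting_compose:
  assumes "lifting K h l" "continuous_on S \<phi>" "\<phi> ` S \<subseteq> K"
  shows "lifting S (h \<circ> \<phi>) (l \<circ> \<phi>)"
  unfolding lifting_def
proof (intro allI)
  fix c x
  have "openin (top_of_set S) (S \<inter> \<phi> -` {z \<in> K. sec c x (h z) (l z)})"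
    by (rule continuous_openin_preimage[OF assms(2), of K]) (use assms in \<open>auto simp: lifting_def\<close>)
  moreover have "S \<inter> \<phi> -` {z \<in> K. sec c x (h z) (l z)} = {z \<in> S. sec c x ((h \<circ> \<phi>) z) ((l \<circ> \<phi>) z)}"
    using assms(3) by auto
  ultimately show "openin (top_of_set S) {z \<in> S. sec c x ((h \<circ> \<phi>) z) ((l \<circ> \<phi>) z)}" by simp
qed

lemma lifting_subset: "lifting K h l \<Longrightarrow> S \<subseteq> K \<Longrightarrow> lifting S h l"
  using lifting_compose[of K h l S id] by simp

text \<open>In a chart two values at a point agree if and only if they lie on the same section. So
  agreement and disagreement are both open conditions, and on a connected set only one of them
  occurs.\<close>

lemma lifting_unique:
  assumes l: "lifting S h l" "lifting S h l'" and S: "connected S"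
    and z: "z0 \<in> S" "l z0 = l' z0" "z \<in> S"
  shows "l z = l' z"
proof (rule ccontr)
  assume ne: "l z \<noteq> l' z"
  let ?A = "\<lambda>c x. {z \<in> S. sec c x (h z) (l z)}" and ?A' = "\<lambda>c x. {z \<in> S. sec c x (h z) (l' z)}"
  let ?E = "\<Union>c. \<Union>x. ?A c x \<inter> ?A' c x" and ?N = "\<Union>c. \<Union>x. \<Union>x'\<in>-{x}. ?A c x \<inter> ?A' c x'"
  have E: "?E = {z \<in> S. l z = l' z}"
  proof (intro equalityI subsetI)
    fix w assume "w \<in> {z \<in> S. l z = l' z}"
    moreover obtain c x where "sec c x (h w) (l w)" using ex_chart by blast
    ultimately show "w \<in> ?E" by auto
  qed (auto intro: value_unique)
  have N: "?N = {z \<in> S. l z \<noteq> l' z}"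
  proof (intro equalityI subsetI)
    fix w assume "w \<in> {z \<in> S. l z \<noteq> l' z}"
    moreover obtain c x where "sec c x (h w) (l w)" using ex_chart by blast
    moreover obtain x' where "sec c x' (h w) (l' w)" using ex_base[OF calculation(2)] by blast
    ultimately have "x \<noteq> x'" "w \<in> ?A c x \<inter> ?A' c x'" using value_unique by auto
    then show "w \<in> ?N" by (intro UN_I[of c] UN_I[of x] UN_I[of x']) auto
  next
    fix w assume "w \<in> ?N"
    then obtain c x x' where "x' \<in> - {x}" "w \<in> ?A c x \<inter> ?A' c x'"
      by (elim UN_E)
    then have "x \<noteq> x'" "sec c x (h w) (l w)" "sec c x' (h w) (l' w)" "w \<in> S" by auto
    moreover from this have "l w \<noteq> l' w" using base_unique by metis
    ultimately show "w \<in> {z \<in> S. l z \<noteq> l' z}" by simp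
  qed
  have "openin (top_of_set S) (?A c x)" "openin (top_of_set S) (?A' c x)" for c x
    using l unfolding lifting_def by blast+
  then have "openin (top_of_set S) ?E" "openin (top_of_set S) ?N"
    by (intro openin_UN openin_Int; blast)+
  moreover have "S \<subseteq> ?E \<union> ?N" "?E \<inter> ?N = {}" "?E \<noteq> {}" "?N \<noteq> {}"
    unfolding E N using z ne by auto
  ultimately have "\<not> connected S"
    unfolding connected_openin not_not by (intro exI conjI)
  with S show False by contradiction
qed

definition liftable :: "'z::topological_space set \<Rightarrow> ('z \<Rightarrow> 'p) \<Rightarrow> bool" where
  "liftable S h \<longleftrightarrow> (\<forall>z\<in>S. \<forall>y. \<exists>l. lifting S h l \<and> l z = y)"

text \<open>The second lift is chosen to meet the first at one point of the overlap; by
  connectedness they agree on all of it. Openness for the glued lift follows from its complement, a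
  union of two closed sets.\<close>

lemma liftable_Un_aux:
  assumes R: "closed R1" "closed R2" and c: "connected (R1 \<inter> R2)" "R1 \<inter> R2 \<noteq> {}"
    and 1: "liftable R1 h" and 2: "liftable R2 h" and z: "z \<in> R1"
  shows "\<exists>l. lifting (R1 \<union> R2) h l \<and> l z = y"
proof -
  obtain m where m: "m \<in> R1" "m \<in> R2" using c by blast
  obtain l1 where l1: "lifting R1 h l1" "l1 z = y" using 1 z unfolding liftable_def by blast
  obtain l2 where l2: "lifting R2 h l2" "l2 m = l1 m" using 2 m unfolding liftable_def by blast
  have eq: "l1 w = l2 w" if "w \<in> R1 \<inter> R2" for w
    using lifting_unique[of "R1 \<inter> R2" h l1 l2 m w] l1 l2 c m that
    by (auto intro: lifting_subset)
  let ?l = "\<lambda>w. if w \<in> R1 then l1 w else l2 w"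
  have "lifting (R1 \<union> R2) h ?l"
    unfolding lifting_def
  proof (intro allI)
    fix c x
    let ?A1 = "{z \<in> R1. sec c x (h z) (l1 z)}" and ?A2 = "{z \<in> R2. sec c x (h z) (l2 z)}"
    have "closedin (top_of_set R1) (R1 - ?A1)" "closedin (top_of_set R2) (R2 - ?A2)"
      using l1 l2 unfolding lifting_def by (auto intro!: closedin_diff)
    then have "closed (R1 - ?A1)" "closed (R2 - ?A2)"
      using R closedin_closed_trans by blast+
    then have "closedin (top_of_set (R1 \<union> R2)) ((R1 - ?A1) \<union> (R2 - ?A2))"
      by (intro closed_subset) auto
    moreover have "(R1 \<union> R2) - ((R1 - ?A1) \<union> (R2 - ?A2)) = {z \<in> R1 \<union> R2. sec c x (h z) (?l z)}"
      using eq by auto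
    ultimately show "openin (top_of_set (R1 \<union> R2)) {z \<in> R1 \<union> R2. sec c x (h z) (?l z)}"
      by (metis (no_types, lifting) openin_diff openin_subtopology_self)
  qed
  then show ?thesis using z l1 by auto
qed

lemma liftable_Un:
  assumes "closed R1" "closed R2" "connected (R1 \<inter> R2)" "R1 \<inter> R2 \<noteq> {}" "liftable R1 h" "liftable R2 h"
  shows "liftable (R1 \<union> R2) h"
  unfolding liftable_def
proof (intro ballI allI)
  fix z y assume "z \<in> R1 \<union> R2"
  then show "\<exists>l. lifting (R1 \<union> R2) h l \<and> l z = y"
    using liftable_Un_aux[OF assms, of z y] liftable_Un_aux[of R2 R1 h z y] assms
    by (auto simp: Int_commute Un_commute)
qed

lemma liftable_locally:
  fixes h :: "'z::metric_space \<Rightarrow> 'p"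
  assumes "continuous_on K h" "z \<in> K"
  shows "\<exists>U. open U \<and> z \<in> U \<and> (\<forall>R. R \<subseteq> K \<inter> U \<longrightarrow> liftable R h)"
proof -
  obtain c x0 y0 where c: "sec c x0 (h z) y0" using sec_cover by blast
  \<comment> \<open>With both sections equal, \<open>sec_open\<close> says that the domain of the
    chart is open.\<close>
  let ?D = "{p. \<exists>y. sec c x0 p y \<and> sec c x0 p y}"
  from continuous_openin_preimage_gen[OF assms(1) sec_open, of c x0 c x0]
  obtain U where U: "open U" "K \<inter> h -` ?D = K \<inter> U" unfolding openin_open by blast
  have "liftable R h" if R: "R \<subseteq> K \<inter> U" for R
    unfolding liftable_def
  proof (intro ballI allI)
    fix w y assume w: "w \<in> R"
    have D: "\<exists>y. sec c x (h v) y" if "v \<in> R" for v x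
      using that R U ex_value by blast
    obtain x where x: "sec c x (h w) y" using D[OF w] ex_base by blast
    define l where "l v = (SOME y. sec c x (h v) y)" for v
    have l: "sec c x (h v) (l v)" if "v \<in> R" for v
      unfolding l_def using D[OF that] by (rule someI_ex)
    have "lifting R h l"
    proof (rule liftingI)
      show "continuous_on R h" using assms(1) by (rule continuous_on_subset) (use R in auto)
      show "\<exists>U c x. openin (top_of_set R) U \<and> v \<in> U \<and> (\<forall>w\<in>U. sec c x (h w) (l w))" if "v \<in> R" for v
        using l that by (intro exI[of _ R] exI[of _ c] exI[of _ x]) auto
    qed
    moreover have "l w = y" using l[OF w] x value_unique by blast
    ultimately show "\<exists>l. lifting R h l \<and> l w = y" by blast
  qed
  moreover have "z \<in> U" using U assms(2) c by blast
  ultimately show ?thesis using U(1) by blast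
qed

text \<open>A Lebesgue number gives a grid of small squares on which lifts exist; they are joined to
  rows and the rows to the whole, always along a segment.\<close>

lemma liftable_square:
  fixes h :: "real \<times> real \<Rightarrow> 'p"
  assumes h: "continuous_on ({0..1} \<times> {0..1}) h"
  shows "liftable ({0..1} \<times> {0..1}) h"
proof -
  let ?K = "{0..1} \<times> {0..1} :: (real \<times> real) set"
  let ?G = "{U. open U \<and> (\<forall>R. R \<subseteq> ?K \<inter> U \<longrightarrow> liftable R h)}"
  have "\<exists>e>0. \<forall>z\<in>?K. \<exists>G\<in>?G. ball z e \<subseteq> G"
  proof (rule Heine_Borel_lemma[of ?K ?G])
    show "compact ?K" by (intro compact_Times) auto
    show "?K \<subseteq> \<Union>?G" using liftable_locally[OF h] by blast
    show "open G" if "G \<in> ?G" for G using that by blast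
    show ?thesis if "0 < e" "\<And>z. z \<in> ?K \<Longrightarrow> \<exists>G\<in>?G. ball z e \<subseteq> G" for e
      by (intro exI[of _ e] conjI ballI that)
  qed
  then obtain e where e: "e > 0" "\<And>z. z \<in> ?K \<Longrightarrow> \<exists>G\<in>?G. ball z e \<subseteq> G"
    by meson
  then have small: "liftable R h" if R: "R \<subseteq> ?K" "R \<subseteq> ball z e" "z \<in> ?K" for R z
  proof -
    obtain G where "G \<in> ?G" "ball z e \<subseteq> G" using e(2)[OF R(3)] by blast
    then show ?thesis using R(1,2) by auto
  qed
  obtain n where n: "n > 0" "2 / real n < e"
  proof -
    obtain n where n: "2 / e < real n" using reals_Archimedean2 by blast
    moreover have "0 < 2 / e" using e(1) by simp
    ultimately have "real n > 0" by linarith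
    with n e(1) show ?thesis by (intro that[of n]) (auto simp: field_simps)
  qed
  let ?I = "\<lambda>i j. {real i / n..real j / n}"
  have le1: "real j / real n \<le> 1" if "j \<le> n" for j using that n by simp
  have cell: "liftable (?I i (Suc i) \<times> ?I j (Suc j)) h" if "i < n" "j < n" for i j
  proof (rule small)
    show "?I i (Suc i) \<times> ?I j (Suc j) \<subseteq> ?K"
      using that le1[of "Suc i"] le1[of "Suc j"]
      by (intro Sigma_mono) (simp_all only: atLeastatMost_subset_iff, simp_all)
    show "(real i / n, real j / n) \<in> ?K" using that by auto
    show "?I i (Suc i) \<times> ?I j (Suc j) \<subseteq> ball (real i / n, real j / n) e"
    proof
      fix p assume "p \<in> ?I i (Suc i) \<times> ?I j (Suc j)"
      then have "\<bar>fst p - real i / n\<bar> \<le> 1 / n" "\<bar>snd p - real j / n\<bar> \<le> 1 / n"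
        by (auto simp: add_divide_distrib)
      moreover have "dist (real i / n, real j / n) p \<le> \<bar>fst p - real i / n\<bar> + \<bar>snd p - real j / n\<bar>"
        using sqrt_sum_squares_le_sum_abs by (cases p) (simp add: dist_Pair_Pair dist_real_def abs_minus_commute)
      ultimately show "p \<in> ball (real i / n, real j / n) e" using n by simp
    qed
  qed
  have split: "?I i k = ?I i j \<union> ?I j k" "?I i j \<inter> ?I j k = {real j / n}" if "i \<le> j" "j \<le> k" for i j k
    using that divide_right_mono[of "real i" "real j" "real n"] divide_right_mono[of "real j" "real k" "real n"]
    by auto
  have row: "liftable (?I i (Suc i) \<times> ?I 0 (Suc j)) h" if "i < n" "j < n" for i j
    using that(2)
  proof (induction j)
    case 0 then show ?case using cell[of i 0] that by simp
  next
    case (Suc j)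
    have "?I i (Suc i) \<times> ?I 0 (Suc (Suc j)) = ?I i (Suc i) \<times> ?I 0 (Suc j) \<union> ?I i (Suc i) \<times> ?I (Suc j) (Suc (Suc j))"
      using split(1)[of 0 "Suc j" "Suc (Suc j)"] by (simp add: Sigma_Un_distrib2)
    moreover have "?I i (Suc i) \<times> ?I 0 (Suc j) \<inter> ?I i (Suc i) \<times> ?I (Suc j) (Suc (Suc j))
        = ?I i (Suc i) \<times> {real (Suc j) / n}"
      using split(2)[of 0 "Suc j" "Suc (Suc j)"] by (simp flip: Sigma_Int_distrib2)
    moreover have "connected (?I i (Suc i) \<times> {real (Suc j) / n})" by (intro connected_Times) auto
    moreover have "?I i (Suc i) \<times> {real (Suc j) / n} \<noteq> {}" using n by (auto simp: field_simps)
    ultimately show ?case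
      using Suc that cell[of i "Suc j"] by (metis Suc_lessD closed_Times closed_atLeastAtMost liftable_Un)
  qed
  have "liftable (?I 0 (Suc i) \<times> {0..1}) h" if "i < n" for i
    using that
  proof (induction i)
    case 0 then show ?case using row[of 0 "n - 1"] n by simp
  next
    case (Suc i)
    have r: "liftable (?I (Suc i) (Suc (Suc i)) \<times> {0..1}) h"
      using row[of "Suc i" "n - 1"] n Suc.prems by simp
    have "?I 0 (Suc (Suc i)) \<times> {0..1} = ?I 0 (Suc i) \<times> {0..1::real} \<union> ?I (Suc i) (Suc (Suc i)) \<times> {0..1}"
      using split(1)[of 0 "Suc i" "Suc (Suc i)"] by (simp add: Sigma_Un_distrib1)
    moreover have "(?I 0 (Suc i) \<times> {0..1}) \<inter> (?I (Suc i) (Suc (Suc i)) \<times> {0..1})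
        = {real (Suc i) / n} \<times> {0..1::real}"
      using split(2)[of 0 "Suc i" "Suc (Suc i)"] by (simp flip: Sigma_Int_distrib1)
    moreover have "connected ({real (Suc i) / n} \<times> {0..1::real})" by (intro connected_Times) auto
    moreover have "{real (Suc i) / n} \<times> {0..1::real} \<noteq> {}" by auto
    ultimately show ?case
      using Suc r by (metis Suc_lessD closed_Times closed_atLeastAtMost liftable_Un)
  qed
  from this[of "n - 1"] show ?thesis using n by simp
qed

text \<open>The square swept by the loop during the contraction is lifted. Over the final constant
  loop the lift is constant. The two sides over the moving base point lie over the same path and end
  at the same value, so by uniqueness they also start at the same value.\<close>

lemma contractible_imp_loop_lifts_closed:
  assumes "contractible (UNIV :: 'p set)" and \<gamma>: "continuous_on {0..1::real} \<gamma>" "\<gamma> 0 = \<gamma> 1"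
    and l: "lifting {0..1} \<gamma> l"
  shows "l 0 = l 1"
proof -
  let ?I = "{0..1::real}"
  from assms(1) obtain a where "homotopic_with_canon (\<lambda>_. True) UNIV UNIV id (\<lambda>_. a :: 'p)"
    unfolding contractible_def by blast
  then obtain H where H: "continuous_map (prod_topology (top_of_set ?I) (euclidean :: 'p topology)) euclidean H"
      "\<forall>x. H (0, x) = x" "\<forall>x. H (1, x) = a"
    unfolding homotopic_with_def subtopology_UNIV by auto
  have "prod_topology (top_of_set ?I) euclidean = top_of_set (?I \<times> (UNIV :: 'p set))"
    using prod_topology_subtopology_eu[of ?I "UNIV :: 'p set"] unfolding subtopology_UNIV .
  with H(1) have cH: "continuous_on (?I \<times> UNIV) H"
    by (simp only: continuous_map_iff_continuous)
  let ?h = "\<lambda>p. H (fst p, \<gamma> (snd p))"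
  have "continuous_on (?I \<times> ?I) (\<lambda>p. \<gamma> (snd p))"
    by (rule continuous_on_compose2[OF \<gamma>(1)]) (auto intro: continuous_intros)
  then have ch: "continuous_on (?I \<times> ?I) ?h"
    by (intro continuous_on_compose2[OF cH] continuous_intros) auto
  obtain L where L: "lifting (?I \<times> ?I) ?h L" "L (0, 0) = l 0"
    using liftable_square[OF ch] unfolding liftable_def by fastforce
  have side: "lifting ?I (\<lambda>s. ?h (\<phi> s)) (\<lambda>s. L (\<phi> s))" if "continuous_on ?I \<phi>" "\<phi> ` ?I \<subseteq> ?I \<times> ?I" for \<phi>
    using lifting_compose[OF L(1) that] by (simp add: o_def)
  have "lifting ?I \<gamma> (\<lambda>s. L (0, s))"
    using side[of "\<lambda>s. (0, s)"] H(2) by (simp add: image_subset_iff continuous_intros)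
  then have 1: "L (0, 1) = l 1"
    using lifting_unique[OF _ l, of "\<lambda>s. L (0, s)" 0 1] L(2) by simp
  have "lifting ?I (\<lambda>s. a) (\<lambda>s. L (1, s))"
    using side[of "\<lambda>s. (1, s)"] H(3) by (simp add: image_subset_iff continuous_intros)
  moreover have "lifting ?I (\<lambda>s. a) (\<lambda>s. L (1, 0))"
  proof (rule liftingI)
    fix z :: real assume "z \<in> ?I"
    obtain c x where "sec c x a (L (1, 0))" using ex_chart by blast
    with \<open>z \<in> ?I\<close> show "\<exists>U c x. openin (top_of_set ?I) U \<and> z \<in> U \<and> (\<forall>w\<in>U. sec c x a (L (1, 0)))"
      by (intro exI[of _ ?I] exI[of _ c] exI[of _ x]) auto
  qed auto
  ultimately have 2: "L (1, 1) = L (1, 0)"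
    using lifting_unique[of ?I _ "\<lambda>s. L (1, s)" "\<lambda>s. L (1, 0)" 0 1] by simp
  have "lifting ?I (\<lambda>t. H (t, \<gamma> 0)) (\<lambda>t. L (t, 0))" "lifting ?I (\<lambda>t. H (t, \<gamma> 0)) (\<lambda>t. L (t, 1))"
    using side[of "\<lambda>t. (t, 0)"] side[of "\<lambda>t. (t, 1)"] \<gamma>(2)
    by (simp_all add: image_subset_iff continuous_intros)
  then have "L (0, 0) = L (0, 1)"
    using lifting_unique[of ?I _ "\<lambda>t. L (t, 0)" "\<lambda>t. L (t, 1)" 1 0] 2 by simp
  then show ?thesis using 1 L(2) by simp
qed

end

section \<open>The local system of an action\<close>

text \<open>This is a right action: the relation \<open>a_i a_C(i) = a_C(i) a_i a_i\<close> is read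
  with the leftmost letter acting first.\<close>

locale collatz_action =
  fixes act :: "nat \<Rightarrow> 'x \<Rightarrow> 'x"
  assumes bij_act: "bij (act i)"
    and relation: "i > 0 \<Longrightarrow> act (collatz i) (act i x) = act i (act i (act (collatz i) x))"
begin

abbreviation iact :: "nat \<Rightarrow> 'x \<Rightarrow> 'x" where
  "iact i \<equiv> inv (act i)"

lemma bij_iact: "bij (iact i)"
  using bij_act by (rule bij_imp_bij_inv)

lemma act_iact [simp]: "act i (iact i x) = x"
  using bij_act by (simp add: bij_is_surj surj_f_inv_f)

lemma iact_act [simp]: "iact i (act i x) = x"
  using bij_act by (simp add: bij_is_inj)

lemma act_eq_iff: "act i y = x \<longleftrightarrow> y = iact i x"
  by auto

text \<open>\<open>corner i k\<close> is the transport from the \<open>k\<close>-th corner of the boundary of the face \<open>i\<close> back to its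
  base point, simplified by the relation. The fibre over the \<open>k\<close>-th side, which is the edge
  \<open>side_edge i k\<close>, is identified with the fibre over the start of that edge.\<close>

definition corner :: "nat \<Rightarrow> nat \<Rightarrow> 'x \<Rightarrow> 'x" where
  "corner i k x = (if k = 1 then act (collatz i) x
     else if k = 2 then act (collatz i) (iact i x)
     else if k = 3 then iact i (iact i x)
     else if k = 4 then iact i x else x)"

text \<open>The letters 0, 3 and 4 are inverses, so their edges start at the corner that ends the
  slot.\<close>

definition side :: "nat \<Rightarrow> nat \<Rightarrow> 'x \<Rightarrow> 'x" where
  "side i k = corner i (if k = 0 then 1 else if k = 3 then 4 else if k = 4 then 5 else k)"

definition side_edge :: "nat \<Rightarrow> nat \<Rightarrow> nat" where
  "side_edge i k = (if k = 0 \<or> k = 2 then collatz i else i)"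

lemma corner_simps [simp]:
  "corner i 0 x = x" "corner i 1 x = act (collatz i) x" "corner i (Suc 0) x = act (collatz i) x"
  "corner i 2 x = act (collatz i) (iact i x)"
  "corner i 3 x = iact i (iact i x)" "corner i 4 x = iact i x" "corner i 5 x = x"
  by (simp_all add: corner_def)

lemma side_simps [simp]:
  "side i 0 = corner i 1" "side i 1 = corner i 1" "side i (Suc 0) = corner i 1" "side i 2 = corner i 2"
  "side i 3 = corner i 4" "side i 4 = corner i 5"
  by (simp_all add: side_def)

lemma bij_corner: "bij (corner i k)"
proof -
  have "bij (\<lambda>x. act (collatz i) (iact i x))" "bij (\<lambda>x. iact i (iact i x))"
    using bij_comp[OF bij_iact bij_act] bij_comp[OF bij_iact bij_iact] by (auto simp: o_def)
  then show ?thesis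
    using bij_act bij_iact bij_id unfolding corner_def id_def by (cases "k = 1"; cases "k = 2"; cases "k = 3"; cases "k = 4"; simp)
qed

lemma corner_relation: "i > 0 \<Longrightarrow> act (collatz i) (iact i (iact (collatz i) x)) = iact i (iact i x)"
proof -
  assume "i > 0"
  then have "act i (act i (act (collatz i) (iact i (iact (collatz i) x)))) = x"
    using relation[of i "iact i (iact (collatz i) x)"] by simp
  then show ?thesis by (metis iact_act)
qed

lemma corner_relation_iff:
  "i > 0 \<Longrightarrow> act (collatz i) (iact i y) = iact i (iact i x) \<longleftrightarrow> y = iact (collatz i) x"
  by (metis act_iact iact_act corner_relation)

text \<open>The chart of a cell is its open star, where the star of the vertex consists of all points that
  are closer to one corner than to the others. The values over the interior of an edge are those at
  its start, and the values over the interior of a face those at its base point.\<close>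

fun edge_sec :: "(nat, nat) cell \<Rightarrow> 'x \<Rightarrow> nat \<Rightarrow> real \<Rightarrow> 'x \<Rightarrow> bool" where
  "edge_sec Vertex x g s y \<longleftrightarrow> s < 1/2 \<and> y = x \<or> s > 1/2 \<and> y = iact g x"
| "edge_sec (Edge g') x g s y \<longleftrightarrow> 0 < s \<and> s < 1 \<and> g = g' \<and> y = x"
| "edge_sec (Face i) x g s y \<longleftrightarrow> False"

fun face_sec :: "(nat, nat) cell \<Rightarrow> 'x \<Rightarrow> nat \<Rightarrow> real \<Rightarrow> real \<Rightarrow> 'x \<Rightarrow> bool" where
  "face_sec Vertex x i r \<theta> y \<longleftrightarrow> r > 0 \<and> (\<exists>k\<le>5. \<bar>5 * \<theta> - real k\<bar> < 1/2 \<and> y = corner i k x)"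
| "face_sec (Edge g) x i r \<theta> y \<longleftrightarrow>
     r > 0 \<and> (\<exists>k<5. real k < 5 * \<theta> \<and> 5 * \<theta> < real k + 1 \<and> side_edge i k = g \<and> y = side i k x)"
| "face_sec (Face j) x i r \<theta> y \<longleftrightarrow> r < 1 \<and> i = j \<and> y = x"

definition sec :: "(nat, nat) cell \<Rightarrow> 'x \<Rightarrow> pc \<Rightarrow> 'x \<Rightarrow> bool" where
  "sec c x p y = pc_fun (c = Vertex \<and> y = x) (\<lambda>g s. edge_sec c x g s y) (\<lambda>i r \<theta>. face_sec c x i r \<theta> y) p"

lemma sec_vx: "sec c x vx y \<longleftrightarrow> c = Vertex \<and> y = x"
  by (simp add: sec_def)

lemma sec_ed_interior: "i > 0 \<Longrightarrow> 0 < s \<Longrightarrow> s < 1 \<Longrightarrow> sec c x (ed i s) y \<longleftrightarrow> edge_sec c x i s y"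
  by (simp add: sec_def pc_fun_def Rep_ed edge_point_def)

lemma le_5_cases: "(\<exists>k\<le>5. P k) \<longleftrightarrow> P 0 \<or> P 1 \<or> P 2 \<or> P 3 \<or> P 4 \<or> P (5::nat)"
  by (auto simp: le_Suc_eq numeral_eq_Suc)

lemma less_5_cases: "(\<exists>k<5. P k) \<longleftrightarrow> P 0 \<or> P 1 \<or> P 2 \<or> P 3 \<or> P (4::nat)"
  by (auto simp: less_Suc_eq numeral_eq_Suc)

lemma sec_fc_interior:
  assumes "i > 0" "r \<in> {0..<1}" "\<theta> \<in> {0..1}"
  shows "sec c x (fc i (polar r \<theta>)) y \<longleftrightarrow> face_sec c x i r \<theta> y"
  unfolding sec_def
proof (rule pc_fun_fc_interior[where F = "\<lambda>i r \<theta>. face_sec c x i r \<theta> y", OF assms])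
  show "face_sec c x i r 1 y = face_sec c x i r 0 y"
    by (cases c) (auto simp: le_5_cases less_5_cases)
  show "face_sec c x i 0 \<theta> y = face_sec c x i 0 0 y" for \<theta>
    by (cases c) auto
qed

text \<open>The value of a section at a point of the boundary of a face, transported to the base point
  of the boundary.\<close>

definition edge_base :: "nat \<Rightarrow> real \<Rightarrow> 'x \<Rightarrow> 'x" where
  "edge_base g s = (if s = 1 then iact g else id)"

definition face_base :: "nat \<Rightarrow> real \<Rightarrow> real \<Rightarrow> 'x \<Rightarrow> 'x" where
  "face_base i r \<theta> = (if r < 1 then id
     else if 5 * \<theta> \<in> {0,1,2,3,4,5} then corner i (nat \<lfloor>5 * \<theta>\<rfloor>) else side i (nat \<lfloor>5 * \<theta>\<rfloor>))"

lemma bij_edge_base: "bij (edge_base g s)"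
  by (simp add: edge_base_def bij_iact)

lemma bij_face_base: "bij (face_base i r \<theta>)"
  by (simp add: face_base_def side_def bij_corner)

lemma sec_ed:
  assumes "i > 0" "s \<in> {0..1}"
  shows "sec c x (ed i s) y \<longleftrightarrow> edge_sec c x i s (edge_base i s y)"
proof -
  consider "s = 0" | "s = 1" | "0 < s" "s < 1" using assms by fastforce
  then show ?thesis
  proof cases
    case 1
    then show ?thesis using assms by (cases c) (auto simp: sec_vx edge_base_def)
  next
    case 2
    have "y = x \<longleftrightarrow> iact i y = iact i x" using bij_iact by (metis bij_is_inj injD)
    with 2 show ?thesis using assms by (cases c) (auto simp: sec_vx edge_base_def)
  next
    case 3
    then show ?thesis using assms by (simp add: sec_ed_interior edge_base_def)
  qed
qed

lemma sec_fc:
  assumes "i > 0" "r \<in> {0..1}" "\<theta> \<in> {0..1}"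
  shows "sec c x (fc i (polar r \<theta>)) y \<longleftrightarrow> face_sec c x i r \<theta> (face_base i r \<theta> y)"
proof (cases "r < 1")
  case True
  then show ?thesis using assms sec_fc_interior by (simp add: face_base_def)
next
  case False
  then have r: "r = 1" using assms by simp
  note C = collatz_pos[OF assms(1)]
  have inj: "act j a = act j b \<longleftrightarrow> a = b" "iact j a = iact j b \<longleftrightarrow> a = b" for j a b
    using bij_act bij_iact by (metis bij_is_inj injD)+
  define u where "u = 5 * \<theta>"
  then have \<theta>: "\<theta> = u / 5" and u: "0 \<le> u" "u \<le> 5" using assms by auto
  have sl: "sec c x (fc i (polar r \<theta>)) y \<longleftrightarrow> sec c x (slotwise ed i (u / 5)) y"
    using fc_boundary[OF assms(1,3)] unfolding r \<theta> by simp
  consider "u = 0" | "u = 1" | "u = 2" | "u = 3" | "u = 4" | "u = 5"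
    | "0 < u" "u < 1" | "1 < u" "u < 2" | "2 < u" "u < 3" | "3 < u" "u < 4" | "4 < u" "u < 5"
    using u by linarith
  then show ?thesis
  proof cases
    case 7
    then have f: "\<lfloor>u\<rfloor> = 0" by linarith
    show ?thesis unfolding sl unfolding \<theta> r using 7 assms C f
      by (cases c) (auto simp: slotwise_def sec_ed_interior face_base_def le_5_cases less_5_cases side_edge_def inj act_eq_iff abs_less_iff)
  next
    case 8
    then have f: "\<lfloor>u\<rfloor> = 1" by linarith
    show ?thesis unfolding sl unfolding \<theta> r using 8 assms C f
      by (cases c) (auto simp: slotwise_def sec_ed_interior face_base_def le_5_cases less_5_cases side_edge_def inj act_eq_iff abs_less_iff)
  next
    \<comment> \<open>The slot from corner 2 to corner 3: here the relation of the face is used,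
      because the transport from corner 3 was simplified by it.\<close>
    case 9
    then have f: "\<lfloor>u\<rfloor> = 2" by linarith
    show ?thesis unfolding sl unfolding \<theta> r using 9 assms C f
      by (cases c) (auto simp: slotwise_def sec_ed_interior face_base_def le_5_cases less_5_cases side_edge_def inj corner_relation_iff abs_less_iff)
  next
    case 10
    then have f: "\<lfloor>u\<rfloor> = 3" by linarith
    show ?thesis unfolding sl unfolding \<theta> r using 10 assms C f
      by (cases c) (auto simp: slotwise_def sec_ed_interior face_base_def le_5_cases less_5_cases side_edge_def inj act_eq_iff abs_less_iff)
  next
    case 11
    then have f: "\<lfloor>u\<rfloor> = 4" by linarith
    show ?thesis unfolding sl unfolding \<theta> r using 11 assms C f
      by (cases c) (auto simp: slotwise_def sec_ed_interior face_base_def le_5_cases less_5_cases side_edge_def inj act_eq_iff abs_less_iff)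
  qed (unfold sl, unfold \<theta> r, use assms C in \<open>(cases c; auto simp: slotwise_def sec_vx face_base_def le_5_cases less_5_cases inj)+\<close>)
qed

lemma open_edge_sec: "openin (top_of_set {0..1}) {s \<in> {0..1}. edge_sec c x i s y}"
proof -
  have "open {s. edge_sec c x i s y}"
    by (cases c) (auto intro!: open_Collect_disj open_Collect_conj open_Collect_less continuous_intros)
  then show ?thesis by (auto simp: openin_open)
qed

lemma open_face_sec:
  "openin (top_of_set ({0..1} \<times> {0..1})) {p \<in> {0..1} \<times> {0..1}. face_sec c x i (fst p) (snd p) y}"
proof -
  have "open {p. face_sec c x i (fst p) (snd p) y}"
    by (cases c) (auto simp: le_5_cases less_5_cases
        intro!: open_Collect_disj open_Collect_conj open_Collect_less continuous_intros)
  then show ?thesis by (auto simp: openin_open)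
qed

sublocale local_system sec
proof
  fix c c' x x' p
  show "\<exists>c x y. sec c x p y"
  proof (cases p rule: pc_cases)
    case 1
    then show ?thesis by (auto simp: sec_vx)
  next
    case (2 i s)
    then show ?thesis by (intro exI[of _ "Edge i"]) (simp add: sec_ed_interior)
  next
    case (3 i r \<theta>)
    then show ?thesis by (intro exI[of _ "Face i"]) (simp add: sec_fc_interior)
  qed
  show "open {p. \<exists>y. sec c x p y \<and> sec c' x' p y}"
    unfolding open_pc_iff
  proof (intro allI impI conjI)
    fix i :: nat assume i: "i > 0"
    \<comment> \<open>\<open>edge_base\<close> permutes the values, so it disappears in the union
      over all \<open>y\<close>; below, \<open>face_base\<close> is treated alike.\<close>
    have "{s \<in> {0..1}. ed i s \<in> {p. \<exists>y. sec c x p y \<and> sec c' x' p y}}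
        = (\<Union>y. {s \<in> {0..1}. edge_sec c x i s y} \<inter> {s \<in> {0..1}. edge_sec c' x' i s y})"
      using i bij_edge_base[THEN bij_is_surj] unfolding surj_def
      by (auto simp: sec_ed) metis
    then show "openin (top_of_set {0..1}) {s \<in> {0..1}. ed i s \<in> {p. \<exists>y. sec c x p y \<and> sec c' x' p y}}"
      by (simp only:) (intro openin_UN openin_Int open_edge_sec)
    have "{p \<in> {0..1} \<times> {0..1}. fc i (polar (fst p) (snd p)) \<in> {p. \<exists>y. sec c x p y \<and> sec c' x' p y}}
        = (\<Union>y. {p \<in> {0..1} \<times> {0..1}. face_sec c x i (fst p) (snd p) y} \<inter>
            {p \<in> {0..1} \<times> {0..1}. face_sec c' x' i (fst p) (snd p) y})"
      using i bij_face_base[THEN bij_is_surj] unfolding surj_def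
      by (auto simp: sec_fc) metis
    then show "openin (top_of_set ({0..1} \<times> {0..1}))
        {p \<in> {0..1} \<times> {0..1}. fc i (polar (fst p) (snd p)) \<in> {p. \<exists>y. sec c x p y \<and> sec c' x' p y}}"
      by (simp only:) (intro openin_UN openin_Int open_face_sec)
  qed
  show "(\<forall>x y. \<not> sec c x p y) \<or> (\<exists>b. bij b \<and> (\<forall>x y. sec c x p y \<longleftrightarrow> y = b x))"
  proof (cases p rule: pc_cases)
    case 1
    then show ?thesis by (cases c) (auto simp: sec_vx intro: exI[of _ "\<lambda>x. x"])
  next
    case (2 i s)
    show ?thesis
    proof (cases c)
      case Vertex
      consider "s < 1/2" | "s = 1/2" | "s > 1/2" by linarith
      then show ?thesis
        using 2 Vertex by cases (auto simp: sec_ed_interior bij_iact intro: exI[of _ "\<lambda>x. x"] exI[of _ "iact i"])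
    qed (use 2 in \<open>auto simp: sec_ed_interior intro: exI[of _ "\<lambda>x. x"]\<close>)
  next
    case (3 i r \<theta>)
    then have sec: "sec c x p y \<longleftrightarrow> face_sec c x i r \<theta> y" for x y
      by (simp add: sec_fc_interior)
    show ?thesis
    proof (cases c)
      case Vertex
      show ?thesis
      proof (cases "r > 0 \<and> (\<exists>k\<le>5. \<bar>5 * \<theta> - real k\<bar> < 1/2)")
        case True
        then obtain k where k: "k \<le> 5" "\<bar>5 * \<theta> - real k\<bar> < 1/2" by blast
        have "k' = k" if "\<bar>5 * \<theta> - real k'\<bar> < 1/2" for k'
          using that k by linarith
        note uniq = this
        have "sec c x p y \<longleftrightarrow> y = corner i k x" for x y
        proof
          assume "sec c x p y"
          then obtain k' where "\<bar>5 * \<theta> - real k'\<bar> < 1/2" "y = corner i k' x"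
            unfolding sec unfolding Vertex by auto
          then show "y = corner i k x" using uniq by simp
        qed (use True k sec Vertex in auto)
        then show ?thesis using bij_corner by blast
      qed (use sec Vertex in auto)
    next
      case (Edge g)
      show ?thesis
      proof (cases "r > 0 \<and> (\<exists>k<5. real k < 5 * \<theta> \<and> 5 * \<theta> < real k + 1 \<and> side_edge i k = g)")
        case True
        then obtain k where k: "k < 5" "real k < 5 * \<theta> \<and> 5 * \<theta> < real k + 1" "side_edge i k = g" by blast
        have "k' = k" if "real k' < 5 * \<theta> \<and> 5 * \<theta> < real k' + 1" for k'
          using that k(2) by linarith
        note uniq = this
        have "sec c x p y \<longleftrightarrow> y = side i k x" for x y
        proof
          assume "sec c x p y"
          then obtain k' where "real k' < 5 * \<theta> \<and> 5 * \<theta> < real k' + 1" "y = side i k' x"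
            unfolding sec unfolding Edge by auto
          then show "y = side i k x" using uniq by simp
        qed (use True k sec Edge in auto)
        then show ?thesis using bij_corner unfolding side_def by blast
      qed (use sec Edge in auto)
    next
      case (Face j)
      then show ?thesis
        using sec 3 by (cases "i = j") (auto intro: exI[of _ "\<lambda>x. x"])
    qed
  qed
qed

lemma contractible_imp_trivial:
  assumes "contractible (UNIV :: pc set)" "i > 0"
  shows "act i x = x"
proof -
  \<comment> \<open>In the coordinates of the edge this lift is constant. At the end point its value
    is read in the fibre over the vertex, which shifts it by \<open>act i\<close>.\<close>
  let ?l = "\<lambda>s::real. if s = 1 then act i x else x"
  have "lifting {0..1} (ed i) ?l"
    unfolding lifting_def
  proof (intro allI)
    fix c x'
    have "edge_base i s (?l s) = x" for s by (simp add: edge_base_def)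
    then have "sec c x' (ed i s) (?l s) \<longleftrightarrow> edge_sec c x' i s x" if "s \<in> {0..1}" for s
      using sec_ed[OF assms(2) that] by (simp only:)
    then have "{s \<in> {0..1}. sec c x' (ed i s) (?l s)} = {s \<in> {0..1}. edge_sec c x' i s x}"
      by blast
    then show "openin (top_of_set {0..1}) {s \<in> {0..1}. sec c x' (ed i s) (?l s)}"
      by (simp only: open_edge_sec)
  qed
  from contractible_imp_loop_lifts_closed[OF assms(1) continuous_ed _ this] assms(2)
  show ?thesis by simp
qed

end

section \<open>Permutations satisfying the relations of Higman's groups\<close>

definition zpow :: "('a \<Rightarrow> 'a) \<Rightarrow> int \<Rightarrow> 'a \<Rightarrow> 'a" where
  "zpow f k = (if 0 \<le> k then f ^^ nat k else inv f ^^ nat (- k))"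

lemma zpow_0 [simp]: "zpow f 0 x = x"
  by (simp add: zpow_def)

lemma zpow_of_nat: "zpow f (int n) = f ^^ n"
  by (simp add: zpow_def)

lemma zpow_Suc:
  assumes "bij f"
  shows "zpow f (k + 1) x = f (zpow f k x)"
proof (cases "0 \<le> k")
  case True
  then have "nat (k + 1) = Suc (nat k)" by simp
  with True show ?thesis by (simp add: zpow_def)
next
  case False
  then obtain n where n: "nat (- k) = Suc n" "nat (- (k + 1)) = n"
    by (metis (no_types, opaque_lifting) Suc_nat_eq_nat_zadd1 add.inverse_distrib_swap diff_add_cancel
        linorder_not_le minus_add_distrib neg_0_le_iff_le uminus_add_conv_diff zle_add1_eq_le add.commute neg_le_0_iff_le)
  have "f (inv f y) = y" for y using assms by (simp add: bij_is_surj surj_f_inv_f)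
  with False n show ?thesis by (cases "k = -1") (auto simp: zpow_def)
qed

lemma zpow_pred: "bij f \<Longrightarrow> zpow f (k - 1) x = inv f (zpow f k x)"
  using zpow_Suc[of f "k - 1" x] by (simp add: bij_is_inj)

lemma zpow_add:
  assumes "bij f"
  shows "zpow f (k + l) x = zpow f k (zpow f l x)"
proof (induction k rule: int_induct[where k = 0])
  case (step1 i)
  have "i + 1 + l = (i + l) + 1" by simp
  then show ?case using step1 zpow_Suc[OF assms] by metis
next
  case (step2 i)
  have "i - 1 + l = (i + l) - 1" by simp
  then show ?case using step2 zpow_pred[OF assms] by metis
qed simp

section \<open>Free actions of the integers\<close>

definition free_perm :: "('a \<Rightarrow> 'a) \<Rightarrow> bool" where
  "free_perm f \<longleftrightarrow> bij f \<and> (\<forall>n>0. \<forall>x. (f ^^ n) x \<noteq> x)"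

lemma free_permD: "free_perm f \<Longrightarrow> 0 < n \<Longrightarrow> (f ^^ n) x \<noteq> x"
  by (simp add: free_perm_def)

lemma zpow_free:
  assumes "free_perm f" "zpow f k x = zpow f l x"
  shows "k = l"
proof -
  have bij: "bij f" using assms by (simp add: free_perm_def)
  have False if "k < l" "zpow f k x = zpow f l x" for k l
  proof -
    have "zpow f (l - k) (zpow f k x) = zpow f k x"
      using zpow_add[OF bij, of "l - k" k x] that by simp
    moreover have "zpow f (l - k) = f ^^ nat (l - k)" using that by (simp add: zpow_def)
    moreover have "nat (l - k) > 0" using that by simp
    ultimately show False using assms(1) unfolding free_perm_def by metis
  qed
  then show ?thesis using assms(2) by (metis linorder_neqE)
qed

definition many_orbits :: "('a \<Rightarrow> 'a) \<Rightarrow> 'a set \<Rightarrow> bool" where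
  "many_orbits f L \<longleftrightarrow> (\<forall>x. f x \<in> L \<longleftrightarrow> x \<in> L) \<and>
     (\<exists>g :: nat \<Rightarrow> 'a. (\<forall>j. g j \<in> L) \<and> (\<forall>j j' k. zpow f k (g j) = g j' \<longrightarrow> j = j'))"

lemma bij_betw_shift_orbits:
  fixes L :: "'a::countable set"
  assumes f: "free_perm f" and "many_orbits f L"
  obtains \<phi> where "bij_betw \<phi> (UNIV :: (int \<times> nat) set) L" "\<And>k j. \<phi> (k + 1, j) = f (\<phi> (k, j))"
proof -
  from assms(2) obtain g :: "nat \<Rightarrow> 'a" where L: "\<And>x. f x \<in> L \<longleftrightarrow> x \<in> L"
    and g: "\<And>j. g j \<in> L" "\<And>j j' k. zpow f k (g j) = g j' \<Longrightarrow> j = j'"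
    unfolding many_orbits_def by blast
  have bij: "bij f" using f by (simp add: free_perm_def)
  have Lz: "zpow f k x \<in> L \<longleftrightarrow> x \<in> L" for k x
  proof (induction k rule: int_induct[where k = 0])
    case (step2 i)
    then show ?case using L zpow_Suc[OF bij, of "i - 1" x] by (metis diff_add_cancel)
  qed (auto simp: zpow_Suc[OF bij] L)
  \<comment> \<open>The choice is made from the orbit as a set, so all points of an orbit get the
    same representative.\<close>
  define rep where "rep x = (SOME y. \<exists>k. y = zpow f k x)" for x
  have rep: "\<exists>k. rep x = zpow f k x" for x
    unfolding rep_def by (rule someI_ex) (metis zpow_0)
  have rep_eq: "rep (zpow f k x) = rep x" for k x
  proof -
    have "(\<exists>l. y = zpow f l (zpow f k x)) \<longleftrightarrow> (\<exists>l. y = zpow f l x)" for y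
      by (metis zpow_add[OF bij] diff_add_cancel)
    then show ?thesis by (simp add: rep_def)
  qed
  let ?T = "rep ` L"
  have "inj (rep \<circ> g)"
  proof (rule injI)
    fix j j' assume "(rep \<circ> g) j = (rep \<circ> g) j'"
    then obtain k l where "zpow f k (g j) = zpow f l (g j')" using rep by (metis comp_apply)
    then have "zpow f (- l) (zpow f k (g j)) = g j'"
      using zpow_add[OF bij, of "- l" l "g j'"] by simp
    then show "j = j'" using g(2) zpow_add[OF bij] by metis
  qed
  then have "infinite (range (rep \<circ> g))" by (rule range_inj_infinite)
  moreover have "range (rep \<circ> g) \<subseteq> ?T" using g(1) by auto
  ultimately have "infinite ?T" using finite_subset by blast
  then have \<tau>: "bij_betw (from_nat_into ?T) UNIV ?T"
    by (intro bij_betw_from_nat_into) auto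
  define \<tau> where "\<tau> = from_nat_into ?T"
  define \<phi> where "\<phi> p = zpow f (fst p) (\<tau> (snd p))" for p :: "int \<times> nat"
  have \<tau>T: "\<tau> j \<in> ?T" for j using \<tau> unfolding \<tau>_def bij_betw_def by blast
  have "\<tau> j \<in> L" for j using \<tau>T[of j] rep Lz by (metis imageE)
  then have sub: "\<phi> p \<in> L" for p by (simp add: \<phi>_def Lz)
  have rep\<tau>: "rep (\<tau> j) = \<tau> j" for j using \<tau>T[of j] rep rep_eq by (metis imageE)
  have "inj \<phi>"
  proof (rule injI)
    fix p p' assume eq: "\<phi> p = \<phi> p'"
    then have "rep (\<phi> p) = rep (\<phi> p')" by simp
    then have "\<tau> (snd p) = \<tau> (snd p')" by (simp add: \<phi>_def rep_eq rep\<tau>)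
    then have "snd p = snd p'" using \<tau> unfolding \<tau>_def bij_betw_def by (meson injD)
    moreover then have "fst p = fst p'" using eq zpow_free[OF f] by (simp add: \<phi>_def)
    ultimately show "p = p'" by (simp add: prod_eq_iff)
  qed
  moreover have "\<exists>p. x = \<phi> p" if x: "x \<in> L" for x
  proof -
    obtain k where k: "rep x = zpow f k x" using rep by blast
    obtain j where j: "\<tau> j = rep x" using \<tau> x unfolding \<tau>_def bij_betw_def by (metis image_eqI rangeE)
    have "\<phi> (- k, j) = x" using zpow_add[OF bij, of "- k" k x] by (simp add: \<phi>_def j k)
    then show ?thesis by metis
  qed
  ultimately have "bij_betw \<phi> UNIV L"
    unfolding bij_betw_def using sub by blast
  moreover have "\<phi> (k + 1, j) = f (\<phi> (k, j))" for k j
    by (simp add: \<phi>_def zpow_Suc[OF bij])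
  ultimately show thesis by (rule that)
qed

text \<open>Each orbit of \<open>f\<close> in \<open>L'\<close> splits into two orbits of the square
  of \<open>f\<close>. So \<open>f\<close> on \<open>L\<close> and its square on \<open>L'\<close>
  both consist of infinitely many copies of the shift of the integers.\<close>

lemma bij_betw_doubling:
  fixes L L' :: "'a::countable set"
  assumes f: "free_perm f" and L: "many_orbits f L" and L': "many_orbits f L'"
  obtains c where "bij_betw c L L'" "\<And>x. x \<in> L \<Longrightarrow> c (f x) = f (f (c x))"
proof -
  obtain \<phi> where
    \<phi>: "bij_betw \<phi> (UNIV :: (int \<times> nat) set) L" "\<And>k j. \<phi> (k + 1, j) = f (\<phi> (k, j))"
    using bij_betw_shift_orbits[OF f L] by blast
  obtain \<psi> where
    \<psi>: "bij_betw \<psi> (UNIV :: (int \<times> nat) set) L'" "\<And>k j. \<psi> (k + 1, j) = f (\<psi> (k, j))"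
    using bij_betw_shift_orbits[OF f L'] by blast
  \<comment> \<open>Two neighbouring orbits are interleaved into one, as its even and odd positions,
    and the shift becomes a double shift.\<close>
  define D where "D p = (2 * fst p + int (snd p mod 2), snd p div 2)" for p :: "int \<times> nat"
  have "bij D"
  proof (rule o_bij)
    let ?E = "\<lambda>p::int \<times> nat. (fst p div 2, 2 * snd p + nat (fst p mod 2))"
    show "?E \<circ> D = id"
    proof
      fix p :: "int \<times> nat"
      have "(2 * fst p + int (snd p mod 2)) div 2 = fst p" by simp
      moreover have "nat ((2 * fst p + int (snd p mod 2)) mod 2) = snd p mod 2"
        by (simp add: nat_mod_distrib)
      ultimately show "(?E \<circ> D) p = id p" by (simp add: D_def prod_eq_iff)
    qed
    show "D \<circ> ?E = id"
    proof
      fix p :: "int \<times> nat"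
      have "nat (fst p mod 2) < 2" by (simp add: nat_less_iff)
      then show "(D \<circ> ?E) p = id p" by (simp add: D_def prod_eq_iff)
    qed
  qed
  let ?c = "\<psi> \<circ> D \<circ> inv_into UNIV \<phi>"
  have "bij_betw ?c L L'"
    using bij_betw_trans[OF bij_betw_trans[OF bij_betw_inv_into[OF \<phi>(1)] \<open>bij D\<close>] \<psi>(1)] by (simp add: comp_assoc)
  moreover have "?c (f x) = f (f (?c x))" if xL: "x \<in> L" for x
  proof -
    have "x \<in> range \<phi>" using \<phi>(1) xL by (simp add: bij_betw_def)
    then obtain k j where x: "x = \<phi> (k, j)" by auto
    have inv: "inv_into UNIV \<phi> (\<phi> p) = p" for p
      using \<phi>(1) by (simp add: bij_betw_def)
    have "D (k + 1, j) = (fst (D (k, j)) + 1 + 1, snd (D (k, j)))" by (simp add: D_def)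
    moreover have "\<psi> (fst q + 1 + 1, snd q) = f (f (\<psi> q))" for q
      by (simp only: \<psi>(2) prod.collapse)
    ultimately show ?thesis
      unfolding x \<phi>(2)[symmetric] o_apply inv by (simp only:)
  qed
  ultimately show thesis by (rule that)
qed

section \<open>Words, chains of relations and their transport\<close>

definition pm :: "bool \<Rightarrow> ('a \<Rightarrow> 'a) \<Rightarrow> 'a \<Rightarrow> 'a" where
  "pm e f = (if e then f else inv f)"

text \<open>In a letter \<open>(g, e)\<close> the bit \<open>g\<close> selects the generator, \<open>p\<close> or \<open>q\<close>, and \<open>e\<close> the sign of the
  exponent. The last letter acts first.\<close>

fun eval_word :: "('a \<Rightarrow> 'a) \<Rightarrow> ('a \<Rightarrow> 'a) \<Rightarrow> (bool \<times> bool) list \<Rightarrow> 'a \<Rightarrow> 'a" where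
  "eval_word p q [] x = x"
| "eval_word p q ((g, e) # w) x = pm e (if g then p else q) (eval_word p q w x)"

fun reduced :: "(bool \<times> bool) list \<Rightarrow> bool" where
  "reduced (a # b # w) \<longleftrightarrow> \<not> (fst a = fst b \<and> snd a \<noteq> snd b) \<and> reduced (b # w)"
| "reduced w \<longleftrightarrow> True"

definition free_at :: "('a \<Rightarrow> 'a) \<Rightarrow> ('a \<Rightarrow> 'a) \<Rightarrow> 'a \<Rightarrow> bool" where
  "free_at p q x \<longleftrightarrow> (\<forall>w. reduced w \<and> w \<noteq> [] \<longrightarrow> eval_word p q w x \<noteq> x)"

text \<open>Iterated Baumslag--Solitar relations between permutations, with two conditions at the ends
  that allow the chain to be prolonged: the last permutation is free, and the first one, which is
  free too, moves the orbit of \<open>x0\<close> under the last one away from itself.\<close>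

definition chain :: "nat \<Rightarrow> (nat \<Rightarrow> 'a \<Rightarrow> 'a) \<Rightarrow> 'a \<Rightarrow> bool" where
  "chain m a x0 \<longleftrightarrow> (\<forall>i. bij (a i)) \<and> (\<forall>i<m. \<forall>x. a (Suc i) (a i x) = a i (a i (a (Suc i) x))) \<and>
     free_perm (a 0) \<and> free_perm (a m) \<and>
     (\<forall>n>0. \<forall>k k'. (a 0 ^^ n) (zpow (a m) k x0) \<noteq> zpow (a m) k' x0)"

text \<open>The constructions below live on products; conjugation by a bijection brings them back to
  \<open>nat\<close>, so that chains can be prolonged repeatedly.\<close>

definition conj_by :: "('a \<Rightarrow> 'b) \<Rightarrow> ('a \<Rightarrow> 'a) \<Rightarrow> 'b \<Rightarrow> 'b" where
  "conj_by e f = e \<circ> f \<circ> inv e"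

context
  fixes e :: "'a \<Rightarrow> 'b"
  assumes e: "bij e"
begin

lemma inv_e [simp]: "inv e (e x) = x" and e_inv [simp]: "e (inv e y) = y"
  using e by (simp_all add: bij_is_inj bij_is_surj surj_f_inv_f)

lemma conj_apply: "conj_by e f (e x) = e (f x)"
  by (simp add: conj_by_def)

lemma all_e: "(\<forall>y. P y) \<longleftrightarrow> (\<forall>x. P (e x))"
  by (metis e_inv)

lemma e_eq [simp]: "e x = e y \<longleftrightarrow> x = y"
  by (metis inv_e)

lemma bij_conj: "bij f \<Longrightarrow> bij (conj_by e f)"
  unfolding conj_by_def using e by (intro bij_comp bij_imp_bij_inv)

lemma funpow_conj: "(conj_by e f ^^ n) (e x) = e ((f ^^ n) x)"
  by (induction n) (simp_all add: conj_apply)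

lemma inv_conj: "bij f \<Longrightarrow> inv (conj_by e f) = conj_by e (inv f)"
  by (rule inv_unique_comp) (auto simp: conj_by_def fun_eq_iff bij_is_inj bij_is_surj surj_f_inv_f)

lemma zpow_conj: "bij f \<Longrightarrow> zpow (conj_by e f) k (e x) = e (zpow f k x)"
  by (simp add: zpow_def inv_conj funpow_conj)

lemma free_perm_conj: "free_perm f \<Longrightarrow> free_perm (conj_by e f)"
  unfolding free_perm_def all_e by (simp add: bij_conj funpow_conj)

lemma eval_word_conj: "bij p \<Longrightarrow> bij q \<Longrightarrow> eval_word (conj_by e p) (conj_by e q) w (e x) = e (eval_word p q w x)"
  by (induction w) (auto simp: pm_def inv_conj conj_apply)

lemma free_at_conj: "bij p \<Longrightarrow> bij q \<Longrightarrow> free_at p q x \<Longrightarrow> free_at (conj_by e p) (conj_by e q) (e x)"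
  by (simp add: free_at_def eval_word_conj)

lemma chain_conj: "chain m a x0 \<Longrightarrow> chain m (\<lambda>i. conj_by e (a i)) (e x0)"
  unfolding chain_def all_e
  by (simp add: bij_conj funpow_conj zpow_conj free_perm_conj conj_apply)

end

text \<open>The affine maps x + 1 and 2 x of the rationals satisfy the relation. The integer
  coordinate makes doubling free despite its fixed point 0, and the orbit of (0, 0) under doubling
  keeps the second coordinate 0, which translation changes.\<close>

lemma ex_chain_1: "\<exists>(a :: nat \<Rightarrow> nat \<Rightarrow> nat) x0. chain 1 a x0"
proof -
  define a :: "nat \<Rightarrow> int \<times> rat \<Rightarrow> int \<times> rat" where
    "a i = (if i = 0 then (\<lambda>p. (fst p, snd p + 1)) else if i = 1 then (\<lambda>p. (fst p + 1, 2 * snd p)) else id)" for i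
  have 0: "bij (a 0)"
    by (rule o_bij[of "\<lambda>p. (fst p, snd p - 1)"]) (auto simp: a_def)
  have 1: "bij (a 1)"
    by (rule o_bij[of "\<lambda>p. (fst p - 1, snd p / 2)"]) (auto simp: a_def)
  have p0: "(a 0 ^^ n) p = (fst p, snd p + of_nat n)" for n p
    by (induction n) (auto simp: a_def)
  have p1: "fst ((a 1 ^^ n) p) = fst p + int n" for n p
    by (induction n) (auto simp: a_def)
  have z1: "snd (zpow (a 1) k (0, 0)) = 0" for k
  proof (induction k rule: int_induct[where k = 0])
    case (step1 i)
    then show ?case by (subst zpow_Suc[OF 1]) (simp add: a_def)
  next
    case (step2 i)
    have "snd (a 1 (zpow (a 1) (i - 1) (0, 0))) = 2 * snd (zpow (a 1) (i - 1) (0, 0))"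
      by (simp add: a_def)
    then show ?case using step2 zpow_Suc[OF 1, of "i - 1" "(0, 0)"] by simp
  qed simp
  have "chain 1 a (0, 0)"
    unfolding chain_def free_perm_def
  proof (intro conjI allI impI)
    show "bij (a i)" for i using 0 1 by (cases "i = 0"; cases "i = 1") (auto simp: a_def[of i])
    show "a (Suc i) (a i x) = a i (a i (a (Suc i) x))" if "i < 1" for i x
      using that by (simp add: a_def algebra_simps)
    show "(a 0 ^^ n) x \<noteq> x" if "n > 0" for n x
      using that by (simp add: p0 prod_eq_iff)
    show "(a 1 ^^ n) x \<noteq> x" if "n > 0" for n x
      using that p1[of n x] by force
    show "(a 0 ^^ n) (zpow (a 1) k (0, 0)) \<noteq> zpow (a 1) k' (0, 0)" if "n > 0" for n k k'
      using that z1 by (simp add: p0 prod_eq_iff)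
  qed (rule 0 1)+
  moreover have "bij (to_nat_on (UNIV :: (int \<times> rat) set))"
    by (rule to_nat_on_infinite) (auto simp: finite_prod infinite_UNIV_char_0)
  ultimately show ?thesis using chain_conj[of "to_nat_on UNIV" 1 a "(0, 0)"] by blast
qed

lemma inv_map_prod_id: "bij f \<Longrightarrow> inv (map_prod f id) = map_prod (inv f) id"
  by (rule inv_unique_comp) (auto simp: fun_eq_iff bij_is_inj bij_is_surj surj_f_inv_f)

lemma bij_map_prod_id: "bij f \<Longrightarrow> bij (map_prod f id)"
  using bij_betw_map_prod[of f UNIV UNIV id UNIV UNIV] by simp

lemma funpow_map_prod_id:
  fixes f :: "'a \<Rightarrow> 'a"
  shows "(map_prod f id ^^ n) y = ((f ^^ n) (fst y), snd y)"
  by (induction n) auto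

lemma zpow_map_prod_id: "bij f \<Longrightarrow> zpow (map_prod f id) k y = (zpow f k (fst y), snd y)"
  by (simp add: zpow_def inv_map_prod_id funpow_map_prod_id)

lemma free_perm_map_prod_id: "free_perm f \<Longrightarrow> free_perm (map_prod f id)"
  by (auto simp: free_perm_def bij_map_prod_id funpow_map_prod_id)

lemma funpow_inv_cancel:
  fixes f :: "'a \<Rightarrow> 'a"
  assumes "bij f"
  shows "(f ^^ n) ((inv f ^^ n) z) = z"
proof (induction n arbitrary: z)
  case (Suc n)
  have "(inv f ^^ Suc n) z = (inv f ^^ n) (inv f z)"
    by (simp only: funpow_Suc_right o_apply)
  then have "(f ^^ Suc n) ((inv f ^^ Suc n) z) = f (inv f z)"
    using Suc by (simp only: funpow.simps o_apply)
  then show ?case using assms by (simp add: bij_is_surj surj_f_inv_f)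
qed simp

section \<open>Ping-pong between a permutation that raises the level and one that returns to level
  0\<close>

context
  fixes p c :: "'a \<Rightarrow> 'a" and lev :: "'a \<Rightarrow> int" and x0 :: 'a
  assumes p: "free_perm p" and c: "bij c" and lev_c: "\<And>y. lev (c y) = lev y + 1"
    and leave: "\<And>n y. n > 0 \<Longrightarrow> lev y \<noteq> 0 \<Longrightarrow> lev ((p ^^ n) y) = 0"
    and base: "\<And>n. lev ((p ^^ n) x0) = 0" "\<And>n. lev ((inv p ^^ n) x0) = 0"
begin

lemma bij_p: "bij p"
  using p by (simp add: free_perm_def)

lemma lev_x0: "lev x0 = 0"
  using base(1)[of 0] by simp

lemma lev_zpow: "lev (zpow c k y) = lev y + k"
proof (induction k rule: int_induct[where k = 0])
  case (step1 i)
  then show ?case by (simp add: zpow_Suc[OF c] lev_c)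
next
  case (step2 i)
  then show ?case using lev_c[of "zpow c (i - 1) y"] zpow_Suc[OF c, of "i - 1" y] by simp
qed simp

lemma funpow_inv_cancel': "(inv p ^^ n) ((p ^^ n) z) = z"
  using funpow_inv_cancel[OF bij_imp_bij_inv[OF bij_p]] by (simp add: inv_inv_eq[OF bij_p])

lemma free_perm_level: "free_perm c"
  unfolding free_perm_def
proof (intro conjI allI impI c)
  fix n y assume "0 < (n::nat)"
  then show "(c ^^ n) y \<noteq> y" using lev_zpow[of "int n" y] unfolding zpow_of_nat by force
qed

text \<open>\<open>zpow c k x0\<close> has level \<open>k\<close>, and positive powers of
  \<open>p\<close> lead it to level 0. This forces both exponents to be 0, and then \<open>p\<close>
  would have a finite orbit. The result allows the chain to be prolonged once more.\<close>

lemma funpow_zpow_level: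
  assumes "n > 0"
  shows "(p ^^ n) (zpow c k x0) \<noteq> zpow c k' x0"
proof
  assume eq: "(p ^^ n) (zpow c k x0) = zpow c k' x0"
  have "lev ((p ^^ n) (zpow c k x0)) = 0"
    using leave[OF assms] base(1) by (cases "k = 0") (simp_all add: lev_zpow lev_x0)
  then have "k' = 0" using eq by (simp add: lev_zpow lev_x0)
  with eq have "zpow c k x0 = (inv p ^^ n) x0" using funpow_inv_cancel'[of n "zpow c k x0"] by simp
  then have "k = 0" using base(2)[of n] lev_zpow[of k x0] lev_x0 by simp
  with eq \<open>k' = 0\<close> show False using free_permD[OF p assms, of x0] by simp
qed

text \<open>What is known about \<open>w x0\<close> for a reduced word \<open>w\<close> with first letter \<open>(g, e)\<close>.\<close>

definition ping_pong :: "bool \<Rightarrow> bool \<Rightarrow> 'a \<Rightarrow> bool" where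
  "ping_pong g e y \<longleftrightarrow>
     (if g then \<exists>n>0. \<exists>z. (lev z \<noteq> 0 \<or> z = x0) \<and> y = (pm e p ^^ n) z
      else if e then lev y > 0 else lev y < 0)"

text \<open>For a power of the inverse: if the image had nonzero level, \<open>leave\<close> applied
  to it would give \<open>z\<close> the level 0.\<close>

lemma funpow_pm_level:
  assumes "n > 0" "lev z \<noteq> 0 \<or> z = x0"
  shows "lev ((pm e p ^^ n) z) = 0"
proof (cases "z = x0")
  case True
  then show ?thesis using base by (simp add: pm_def)
next
  case False
  then have z: "lev z \<noteq> 0" using assms by simp
  show ?thesis
  proof (rule ccontr)
    assume ne: "lev ((pm e p ^^ n) z) \<noteq> 0"
    show False
    proof (cases e)
      case True
      then show ?thesis using ne leave[OF assms(1) z] by (simp add: pm_def)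
    next
      case False
      then show ?thesis using ne leave[OF assms(1) ne] z by (simp add: pm_def funpow_inv_cancel[OF bij_p])
    qed
  qed
qed

lemma ping_pong_c: "lev y = 0 \<or> ping_pong False e y \<Longrightarrow> ping_pong False e (pm e c y)"
  using lev_c[of "inv c y"] lev_c[of y] c
  by (auto simp: ping_pong_def pm_def bij_is_surj surj_f_inv_f split: if_splits)

lemma ping_pong_p:
  assumes "lev y \<noteq> 0 \<or> y = x0 \<or> ping_pong True e y"
  shows "ping_pong True e (pm e p y)"
proof (cases "lev y \<noteq> 0 \<or> y = x0")
  case True
  then show ?thesis unfolding ping_pong_def by (auto intro!: exI[of _ 1] exI[of _ y])
next
  case False
  then obtain n z where "n > 0" "lev z \<noteq> 0 \<or> z = x0" "y = (pm e p ^^ n) z"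
    using assms unfolding ping_pong_def by auto
  then have "Suc n > 0 \<and> (lev z \<noteq> 0 \<or> z = x0) \<and> pm e p y = (pm e p ^^ Suc n) z" by simp
  then show ?thesis unfolding ping_pong_def by metis
qed

lemma ping_pong_word:
  "reduced ((g, e) # w) \<Longrightarrow> ping_pong g e (eval_word p c ((g, e) # w) x0)"
proof (induction w arbitrary: g e)
  case Nil
  then show ?case using ping_pong_c[of x0 e] ping_pong_p[of x0 e] lev_x0 by simp
next
  case (Cons l w)
  obtain g' e' where l: "l = (g', e')" by (cases l)
  define y where "y = eval_word p c (l # w) x0"
  have y: "ping_pong g' e' y"
    unfolding y_def l using Cons.prems l by (intro Cons.IH) simp
  have same: "g = g' \<Longrightarrow> e = e'" using Cons.prems l by auto
  have "g' \<Longrightarrow> lev y = 0" using y funpow_pm_level unfolding ping_pong_def by auto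
  moreover have "\<not> g' \<Longrightarrow> lev y \<noteq> 0" using y unfolding ping_pong_def by (auto split: if_splits)
  ultimately have "ping_pong g e (pm e (if g then p else c) y)"
    using y same ping_pong_c[of y e] ping_pong_p[of y e] by (cases g; cases g') simp_all
  then show ?case by (simp add: y_def)
qed

text \<open>As \<open>x0\<close> has level 0, a word fixing it begins with a power of
  \<open>p\<close>. Undoing this power leads from \<open>x0\<close> to a point \<open>z\<close> of
  level 0, by \<open>base\<close>; so \<open>z\<close> is \<open>x0\<close>, against the freeness of
  \<open>p\<close>.\<close>

lemma free_at_level: "free_at p c x0"
  unfolding free_at_def
proof (intro allI impI notI)
  fix w assume w: "reduced w \<and> w \<noteq> []" and eq: "eval_word p c w x0 = x0"
  then obtain g e w' where "w = (g, e) # w'" by (metis list.exhaust surj_pair)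
  with w eq ping_pong_word[of g e w'] have pp: "ping_pong g e x0" by simp
  then have g by (cases g) (auto simp: ping_pong_def lev_x0 split: if_splits)
  with pp obtain n z where n: "n > 0" and z: "lev z \<noteq> 0 \<or> z = x0" and x: "x0 = (pm e p ^^ n) z"
    unfolding ping_pong_def by auto
  have "z = (pm (\<not> e) p ^^ n) x0"
    unfolding x by (cases e) (simp_all add: pm_def funpow_inv_cancel' funpow_inv_cancel[OF bij_p])
  then have "lev z = 0" using base by (simp add: pm_def split: if_splits)
  with z have "z = x0" by simp
  with x have "(p ^^ n) x0 = x0"
    by (cases e) (simp_all add: pm_def, metis funpow_inv_cancel[OF bij_p])
  then show False using free_permD[OF p n] by blast
qed

end

text \<open>On countably many copies of the set, level \<open>l \<noteq> 0\<close> consists of copies of the orbit of \<open>x0\<close>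
  under \<open>a m\<close>, and level 0 of everything else. The new permutation raises the level by 1, while
  \<open>a 0\<close> sends all other levels to level 0: a ping-pong between the two.\<close>

lemma chain_step:
  fixes a :: "nat \<Rightarrow> nat \<Rightarrow> nat"
  assumes "chain m a x0"
  shows "\<exists>(a' :: nat \<Rightarrow> nat \<Rightarrow> nat) x0'. chain (Suc m) a' x0' \<and> free_at (a' 0) (a' (Suc m)) x0'"
proof -
  from assms have bij_a: "\<And>i. bij (a i)"
    and rel: "\<And>i x. i < m \<Longrightarrow> a (Suc i) (a i x) = a i (a i (a (Suc i) x))"
    and free: "free_perm (a 0)" "free_perm (a m)"
    and away: "\<And>n k k'. n > 0 \<Longrightarrow> (a 0 ^^ n) (zpow (a m) k x0) \<noteq> zpow (a m) k' x0"
    by (auto simp: chain_def)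
  \<comment> \<open>The integer index becomes the level; the last coordinate provides infinitely
    many orbits on each level.\<close>
  define ext :: "nat \<Rightarrow> nat \<times> int \<times> nat \<Rightarrow> nat \<times> int \<times> nat" where "ext i = map_prod (a i) id" for i
  have bij_ext: "bij (ext i)" for i by (simp add: ext_def bij_map_prod_id bij_a)
  define lev :: "nat \<times> int \<times> nat \<Rightarrow> int" where
    "lev y = (if \<exists>k. fst y = zpow (a m) k x0 then fst (snd y) else 0)" for y
  have orbit_iff: "(\<exists>k. a m x = zpow (a m) k x0) \<longleftrightarrow> (\<exists>k. x = zpow (a m) k x0)" for x
  proof -
    have "a m x = zpow (a m) (k + 1) x0 \<longleftrightarrow> x = zpow (a m) k x0" for k
      using bij_a by (auto simp: zpow_Suc bij_is_inj inj_eq)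
    then show ?thesis by (metis diff_add_cancel)
  qed
  have lev_ext: "lev (ext m y) = lev y" for y
    by (simp add: lev_def ext_def orbit_iff)
  have orbits: "many_orbits (ext m) {y. lev y = l}" for l
    unfolding many_orbits_def
  proof (intro conjI allI exI[of _ "\<lambda>j. (x0, l, j)"] impI)
    show "ext m x \<in> {y. lev y = l} \<longleftrightarrow> x \<in> {y. lev y = l}" for x by (simp add: lev_ext)
    have "\<exists>k. x0 = zpow (a m) k x0" by (metis zpow_0)
    then show "(x0, l, j) \<in> {y. lev y = l}" for j by (simp add: lev_def)
    show "j = j'" if "zpow (ext m) k (x0, l, j) = (x0, l, j')" for j j' k
      using that by (simp add: ext_def zpow_map_prod_id bij_a)
  qed
  have fr: "free_perm (ext m)" by (simp add: ext_def free_perm_map_prod_id free)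
  \<comment> \<open>The new relation asks for a bijection between neighbouring levels that turns
    \<open>ext m\<close> into its square.\<close>
  have "\<forall>l. \<exists>c. bij_betw c {y. lev y = l} {y. lev y = l + 1} \<and>
      (\<forall>y\<in>{y. lev y = l}. c (ext m y) = ext m (ext m (c y)))"
  proof
    fix l
    show "\<exists>c. bij_betw c {y. lev y = l} {y. lev y = l + 1} \<and>
        (\<forall>y\<in>{y. lev y = l}. c (ext m y) = ext m (ext m (c y)))"
    proof (rule bij_betw_doubling[OF fr orbits[of l] orbits[of "l + 1"]])
      fix c assume "bij_betw c {y. lev y = l} {y. lev y = l + 1}"
        and "\<And>y. y \<in> {y. lev y = l} \<Longrightarrow> c (ext m y) = ext m (ext m (c y))"
      then show ?thesis by (intro exI[of _ c] conjI ballI)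
    qed
  qed
  from choice[OF this] obtain cc where cc: "\<And>l. bij_betw (cc l) {y. lev y = l} {y. lev y = l + 1}"
      "\<And>y. cc (lev y) (ext m y) = ext m (ext m (cc (lev y) y))"
    by blast
  define c where "c y = cc (lev y) y" for y
  have lev_c: "lev (c y) = lev y + 1" for y
    using cc(1)[of "lev y"] unfolding bij_betw_def c_def by auto
  have bij_c: "bij c"
  proof (rule bijI)
    show "inj c"
    proof (rule injI)
      fix y y' assume eq: "c y = c y'"
      then have l: "lev y' = lev y" using lev_c by (metis add_right_cancel)
      have "inj_on (cc (lev y)) {z. lev z = lev y}"
        using bij_betw_imp_inj_on[OF cc(1)] .
      moreover have "cc (lev y) y = cc (lev y) y'"
        using eq l by (simp only: c_def)
      ultimately show "y = y'"
        by (rule inj_onD) (simp_all only: l mem_Collect_eq)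
    qed
    show "surj c"
    proof (rule surjI)
      fix y
      have "cc (lev y - 1) ` {z. lev z = lev y - 1} = {z. lev z = lev y - 1 + 1}"
        by (rule bij_betw_imp_surj_on[OF cc(1)])
      moreover have "y \<in> {z. lev z = lev y - 1 + 1}"
        by (simp only: mem_Collect_eq diff_add_cancel)
      ultimately have "y \<in> cc (lev y - 1) ` {z. lev z = lev y - 1}"
        by (simp only:)
      then obtain z where "lev z = lev y - 1" "y = cc (lev y - 1) z" by blast
      then have "\<exists>z. c z = y" unfolding c_def by metis
      then show "c (SOME z. c z = y) = y" by (rule someI_ex)
    qed
  qed
  have c_ext: "c (ext m y) = ext m (ext m (c y))" for y
    using cc(2) by (simp add: c_def lev_ext)
  define x0' where "x0' = (x0, 0 :: int, 0 :: nat)"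
  have lev_x0': "lev x0' = 0" by (simp add: x0'_def lev_def)
  have ext_pow: "(ext 0 ^^ n) y = ((a 0 ^^ n) (fst y), snd y)" for n y
    by (simp add: ext_def funpow_map_prod_id)
  have leave: "lev ((ext 0 ^^ n) y) = 0" if n: "n > 0" and y: "lev y \<noteq> 0" for n y
  proof -
    from y obtain k where "fst y = zpow (a m) k x0" unfolding lev_def by metis
    then show ?thesis using away[OF n] by (simp add: lev_def ext_pow)
  qed
  \<comment> \<open>Copies with integer index 0 lie entirely on level 0, and \<open>ext 0\<close>
    does not leave the copy of \<open>x0'\<close>.\<close>
  have lev_0: "fst (snd y) = 0 \<Longrightarrow> lev y = 0" for y
    by (simp add: lev_def)
  have base1: "lev ((ext 0 ^^ n) x0') = 0" for n
    by (rule lev_0) (simp add: ext_pow x0'_def)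
  have base2: "lev ((inv (ext 0) ^^ n) x0') = 0" for n
    by (rule lev_0) (simp add: ext_def inv_map_prod_id[OF bij_a] funpow_map_prod_id x0'_def)
  have free_ext: "free_perm (ext 0)" by (simp add: ext_def free_perm_map_prod_id free)
  define a' where "a' i = (if i \<le> m then ext i else if i = Suc m then c else id)" for i
  have "chain (Suc m) a' x0'"
    unfolding chain_def
  proof (intro conjI allI impI)
    show "bij (a' i)" for i by (simp add: a'_def bij_ext bij_c)
    show "a' (Suc i) (a' i y) = a' i (a' i (a' (Suc i) y))" if "i < Suc m" for i y
    proof (cases "i = m")
      case False
      with that rel[of i] show ?thesis by (cases y) (simp add: a'_def ext_def)
    qed (simp add: a'_def c_ext)
    show "free_perm (a' 0)" by (simp add: a'_def free_ext)
    show "free_perm (a' (Suc m))"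
      using free_perm_level[OF free_ext bij_c lev_c leave base1 base2] by (simp add: a'_def)
    show "(a' 0 ^^ n) (zpow (a' (Suc m)) k x0') \<noteq> zpow (a' (Suc m)) k' x0'" if "n > 0" for n k k'
      using funpow_zpow_level[OF free_ext bij_c lev_c leave base1 base2 that] by (simp add: a'_def)
  qed
  moreover have "free_at (ext 0) c x0'"
    by (rule free_at_level[OF free_ext bij_c lev_c leave base1 base2])
  then have "free_at (a' 0) (a' (Suc m)) x0'" by (simp add: a'_def)
  ultimately have "chain (Suc m) a' x0'" "free_at (a' 0) (a' (Suc m)) x0'" "bij (a' 0)" "bij (a' (Suc m))"
    by (auto simp: chain_def)
  moreover have "bij (to_nat_on (UNIV :: (nat \<times> int \<times> nat) set))"
    by (rule to_nat_on_infinite) (auto simp: finite_prod)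
  ultimately show ?thesis
    using chain_conj[of "to_nat_on UNIV" "Suc m" a' x0'] free_at_conj[of "to_nat_on UNIV" "a' 0" "a' (Suc m)" x0'] by blast
qed

lemma ex_chain_free_at:
  assumes "m \<ge> 2"
  shows "\<exists>(a :: nat \<Rightarrow> nat \<Rightarrow> nat) x0. chain m a x0 \<and> free_at (a 0) (a m) x0"
proof -
  have "\<exists>(a :: nat \<Rightarrow> nat \<Rightarrow> nat) x0. chain (Suc k) a x0" for k
  proof (induction k)
    case 0 then show ?case using ex_chain_1 by simp
  next
    case (Suc k) then show ?case using chain_step by blast
  qed
  moreover obtain k where "m = Suc (Suc k)" using assms by (metis add_2_eq_Suc le_Suc_ex)
  ultimately show ?thesis using chain_step by blast
qed

text \<open>The last condition gives infinitely many orbits of the group of the two ends. Together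
  with freeness it fixes their joint action on \<open>nat\<close> up to isomorphism.\<close>

definition free_chain :: "nat \<Rightarrow> (nat \<Rightarrow> 'a \<Rightarrow> 'a) \<Rightarrow> (nat \<Rightarrow> 'a) \<Rightarrow> bool" where
  "free_chain m A g \<longleftrightarrow> (\<forall>i. bij (A i)) \<and>
     (\<forall>i<m. \<forall>x. A (Suc i) (A i x) = A i (A i (A (Suc i) x))) \<and>
     (\<forall>x. free_at (A 0) (A m) x) \<and>
     (\<forall>j j' w. eval_word (A 0) (A m) w (g j) = g j' \<longrightarrow> j = j')"

text \<open>Letting the generated group act on countably many copies of itself turns one free point
  into a free action.\<close>

lemma ex_free_chain:
  assumes "m \<ge> 2"
  shows "\<exists>(A :: nat \<Rightarrow> nat \<Rightarrow> nat) g. free_chain m A g"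
proof -
  obtain a :: "nat \<Rightarrow> nat \<Rightarrow> nat" and x0 where "chain m a x0" and free: "free_at (a 0) (a m) x0"
    using ex_chain_free_at[OF assms] by blast
  then have bij_a: "\<And>i. bij (a i)" and rel: "\<And>i x. i < m \<Longrightarrow> a (Suc i) (a i x) = a i (a i (a (Suc i) x))"
    by (auto simp: chain_def)
  have inv_a: "a i (inv (a i) x) = x" "inv (a i) (a i x) = x" for i x
    using bij_a by (simp_all add: bij_is_inj bij_is_surj surj_f_inv_f)
  \<comment> \<open>\<open>range W\<close> is the group generated by the \<open>a i\<close>, as a
    set of functions. Its elements, in countably many copies, are the new points, and the group acts
    by multiplication from the left.\<close>
  define W where "W ws = foldr (\<lambda>l f. pm (snd l) (a (fst l)) \<circ> f) ws id" for ws :: "(nat \<times> bool) list"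
  define S where "S = range W \<times> (UNIV :: nat set)"
  have K: "pm e (a i) \<circ> f \<in> range W" if "f \<in> range W" for e i f
  proof -
    from that obtain ws where "f = W ws" by blast
    then have "pm e (a i) \<circ> f = W ((i, e) # ws)" by (simp add: W_def)
    then show ?thesis by blast
  qed
  have id: "id \<in> range W" using rangeI[of W "[]"] by (simp add: W_def)
  have surj: "surj f" if "f \<in> range W" for f
  proof -
    have "surj (pm e (a i))" for e i
      using bij_a[of i] bij_imp_bij_inv[OF bij_a[of i]] by (simp add: pm_def bij_is_surj)
    moreover have "W (l # ws) = pm (snd l) (a (fst l)) \<circ> W ws" for l ws by (simp add: W_def)
    moreover have "W [] = id" by (simp add: W_def)
    ultimately have "surj (W ws)" for ws
      by (induction ws) (simp_all only: surj_id comp_surj)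
    then show ?thesis using that by blast
  qed
  define e where "e = to_nat_on S"
  have e: "bij_betw e S UNIV"
    unfolding e_def S_def
  proof (rule to_nat_on_infinite)
    show "countable (range W \<times> (UNIV :: nat set))" by auto
    show "infinite (range W \<times> (UNIV :: nat set))"
      by (simp add: finite_cartesian_product_iff)
  qed
  have e_inj: "e (f, j) = e (f', j') \<longleftrightarrow> f = f' \<and> j = j'" if "f \<in> range W" "f' \<in> range W" for f f' j j'
    using bij_betw_imp_inj_on[OF e] that by (auto simp: S_def inj_on_def)
  have all_e: "\<exists>f j. f \<in> range W \<and> y = e (f, j)" for y
  proof -
    have "y \<in> e ` S" using bij_betw_imp_surj_on[OF e] by simp
    then show ?thesis unfolding S_def by blast
  qed
  define tr where "tr h y = e (h \<circ> fst (inv_into S e y), snd (inv_into S e y))" for h y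
  have tr: "tr h (e (f, j)) = e (h \<circ> f, j)" if "f \<in> range W" for h f j
    using inv_into_f_f[OF bij_betw_imp_inj_on[OF e], of "(f, j)"] that by (simp add: tr_def S_def)
  have pmK: "a i \<circ> f \<in> range W" "inv (a i) \<circ> f \<in> range W" if "f \<in> range W" for i f
    using K[OF that, of True i] K[OF that, of False i] by (simp_all add: pm_def)
  define A where "A i = tr (a i)" for i
  have A: "A i (e (f, j)) = e (a i \<circ> f, j)" if "f \<in> range W" for i f j
    using tr[OF that] by (simp add: A_def)
  have bij_A: "bij (A i)" and inv_A: "inv (A i) = tr (inv (a i))" for i
  proof -
    have "tr (inv (a i)) (A i y) = y" "A i (tr (inv (a i)) y) = y" for y
    proof -
      obtain f j where y: "f \<in> range W" "y = e (f, j)" using all_e by blast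
      have "inv (a i) \<circ> (a i \<circ> f) = f" "a i \<circ> (inv (a i) \<circ> f) = f" by (auto simp: inv_a)
      then show "tr (inv (a i)) (A i y) = y" "A i (tr (inv (a i)) y) = y"
        using y pmK[OF y(1)] by (simp_all add: A tr)
    qed
    then have "tr (inv (a i)) \<circ> A i = id" "A i \<circ> tr (inv (a i)) = id" by auto
    then show "bij (A i)" "inv (A i) = tr (inv (a i))"
      by (auto intro: o_bij inv_unique_comp)
  qed
  have word: "eval_word (A 0) (A m) w (e (f, j)) = e (eval_word (a 0) (a m) w \<circ> f, j) \<and>
      eval_word (a 0) (a m) w \<circ> f \<in> range W" if f: "f \<in> range W" for w f j
  proof (induction w)
    case Nil
    have "eval_word (a 0) (a m) [] \<circ> f = f" by auto
    then show ?case using f by simp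
  next
    case (Cons l w)
    obtain g s where l: "l = (g, s)" by (cases l)
    let ?f = "eval_word (a 0) (a m) w \<circ> f" and ?i = "if g then 0 else m"
    have IH: "eval_word (A 0) (A m) w (e (f, j)) = e (?f, j)" "?f \<in> range W"
      using Cons.IH by blast+
    have "pm s (A ?i) (e (?f, j)) = e (pm s (a ?i) \<circ> ?f, j)"
      using A[OF IH(2), of ?i j] tr[OF IH(2), of "inv (a ?i)" j] by (cases s) (simp_all only: pm_def inv_A if_True if_False)
    moreover have "pm s (a ?i) \<circ> ?f = eval_word (a 0) (a m) (l # w) \<circ> f"
      by (auto simp: l)
    moreover have "eval_word (A 0) (A m) (l # w) (e (f, j)) = pm s (A ?i) (e (?f, j))"
      by (cases g) (simp_all only: l eval_word.simps IH if_True if_False)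
    moreover have "pm s (a ?i) \<circ> ?f \<in> range W" by (rule K[OF IH(2)])
    ultimately show ?case by (simp only: simp_thms)
  qed
  have "A (Suc i) (A i y) = A i (A i (A (Suc i) y))" if "i < m" for i y
  proof -
    obtain f j where y: "f \<in> range W" "y = e (f, j)" using all_e by blast
    have "a (Suc i) \<circ> (a i \<circ> f) = a i \<circ> (a i \<circ> (a (Suc i) \<circ> f))"
      using rel[OF that] by auto
    then show ?thesis using y pmK(1) by (simp add: A)
  qed
  moreover have "free_at (A 0) (A m) y" for y
    unfolding free_at_def
  proof (intro allI impI notI)
    fix w assume w: "reduced w \<and> w \<noteq> []" and eq: "eval_word (A 0) (A m) w y = y"
    obtain f j where y: "f \<in> range W" "y = e (f, j)" using all_e by blast
    then have f: "eval_word (a 0) (a m) w \<circ> f = f"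
      using eq word[OF y(1), of w j] e_inj by simp
    \<comment> \<open>A word that fixes the element \<open>f\<close> is the identity on the image of
      \<open>f\<close>, which contains the free point \<open>x0\<close>.\<close>
    obtain z where "f z = x0" using surj[OF y(1)] by (metis surjD)
    then have "eval_word (a 0) (a m) w x0 = x0" using fun_cong[OF f, of z] by simp
    then show False using free w by (simp add: free_at_def)
  qed
  moreover have "j = j'" if "eval_word (A 0) (A m) w (e (id, j)) = e (id, j')" for j j' w
    using that word[OF id, of w j] e_inj id by simp
  ultimately show ?thesis
    using bij_A unfolding free_chain_def
    by (intro exI[of _ A] conjI exI[of _ "\<lambda>j. e (id, j)"]) blast+
qed

section \<open>Free actions of the free group of rank two\<close>

fun lmul :: "bool \<times> bool \<Rightarrow> (bool \<times> bool) list \<Rightarrow> (bool \<times> bool) list" where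
  "lmul l [] = [l]"
| "lmul l (l' # w) = (if fst l = fst l' \<and> snd l \<noteq> snd l' then w else l # l' # w)"

lemma reduced_Cons: "reduced (l # w) \<Longrightarrow> reduced w"
  by (cases w) auto

lemma reduced_lmul: "reduced w \<Longrightarrow> reduced (lmul l w)"
  by (cases w) (auto dest: reduced_Cons)

lemma lmul_reduced: "reduced (l # w) \<Longrightarrow> lmul l w = l # w"
  by (cases w) auto

lemma lmul_inverse: "reduced w \<Longrightarrow> lmul (g, e) (lmul (g, \<not> e) w) = w"
  by (cases w rule: reduced.cases) auto

lemma pm_cancel: "bij f \<Longrightarrow> pm e f (pm (\<not> e) f x) = x"
  by (auto simp: pm_def bij_is_inj bij_is_surj surj_f_inv_f)

context
  fixes p q :: "'a::countable \<Rightarrow> 'a"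
  assumes p: "bij p" and q: "bij q"
begin

lemma eval_lmul: "eval_word p q (lmul (g, e) w) x = pm e (if g then p else q) (eval_word p q w x)"
proof (cases w)
  case (Cons l v)
  then show ?thesis
    using pm_cancel[OF p, of e] pm_cancel[OF q, of e] by (cases l) auto
qed simp

lemma eval_word_append: "eval_word p q (u @ w) x = eval_word p q u (eval_word p q w x)"
  by (induction u) auto

lemma eval_word_inverse: "\<exists>v. \<forall>x. eval_word p q v (eval_word p q w x) = x"
proof (induction w)
  case Nil
  show ?case by (intro exI[of _ "[]"]) simp
next
  case (Cons l w)
  then obtain v where v: "\<And>x. eval_word p q v (eval_word p q w x) = x" by blast
  obtain g e where l: "l = (g, e)" by (cases l)
  have "eval_word p q (v @ [(g, \<not> e)]) (eval_word p q (l # w) x) = x" for x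
    using v pm_cancel[OF p, of "\<not> e"] pm_cancel[OF q, of "\<not> e"] by (simp add: eval_word_append l)
  then show ?case by blast
qed

lemma eval_word_reduce: "\<exists>v. reduced v \<and> (\<forall>x. eval_word p q v x = eval_word p q w x)"
proof (induction w)
  case Nil
  show ?case by (intro exI[of _ "[]"]) simp
next
  case (Cons l w)
  then obtain v where "reduced v" "\<forall>x. eval_word p q v x = eval_word p q w x" by blast
  then show ?case
    by (intro exI[of _ "lmul l v"]) (cases l, simp add: reduced_lmul eval_lmul)
qed

lemma eval_word_unique:
  assumes "free_at p q x" "reduced w" "reduced w'" "eval_word p q w x = eval_word p q w' x"
  shows "w = w'"
  using assms(2-4)
proof (induction w arbitrary: w')
  case Nil
  then show ?case using assms(1) unfolding free_at_def by (metis eval_word.simps(1))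
next
  case (Cons l w)
  obtain g e where l: "l = (g, e)" by (cases l)
  have "eval_word p q w x = eval_word p q (lmul (g, \<not> e) w') x"
    using Cons.prems(3) pm_cancel[OF p, of "\<not> e"] pm_cancel[OF q, of "\<not> e"]
    by (simp add: eval_lmul l flip: Cons.prems(3))
  then have "w = lmul (g, \<not> e) w'"
    using Cons.prems by (intro Cons.IH) (auto simp: reduced_lmul dest: reduced_Cons)
  then have "lmul l w = w'" using lmul_inverse[OF Cons.prems(2)] l by simp
  then show ?case using lmul_reduced[OF Cons.prems(1)] by simp
qed

text \<open>A free action is a union of copies of the group, one for each orbit, and countably many
  orbits can be numbered by \<open>nat\<close>. In these coordinates all such pairs
  \<open>p\<close>, \<open>q\<close> look the same, which makes any two of them isomorphic.\<close>

lemma ex_free_coordinates: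
  assumes free: "\<And>x. free_at p q x"
    and g: "\<forall>j j' w. eval_word p q w (g j) = g j' \<longrightarrow> j = (j' :: nat)"
  shows "\<exists>\<phi>. bij_betw \<phi> (UNIV \<times> {w. reduced w}) UNIV \<and>
    (\<forall>j::nat. \<forall>w. p (\<phi> (j, w)) = \<phi> (j, lmul (True, True) w) \<and> q (\<phi> (j, w)) = \<phi> (j, lmul (False, True) w))"
proof -
  define rep where "rep x = (SOME y. \<exists>w. y = eval_word p q w x)" for x
  have rep: "\<exists>w. rep x = eval_word p q w x" for x
    unfolding rep_def by (rule someI_ex) blast
  have rep_eq: "rep (eval_word p q u x) = rep x" for u x
  proof -
    obtain v where v: "\<And>x. eval_word p q v (eval_word p q u x) = x" using eval_word_inverse by blast
    have "(\<exists>w. y = eval_word p q w (eval_word p q u x)) \<longleftrightarrow> (\<exists>w. y = eval_word p q w x)" for y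
      by (metis eval_word_append v)
    then show ?thesis by (simp add: rep_def)
  qed
  have "inj (rep \<circ> g)"
  proof (rule injI)
    fix j j' assume "(rep \<circ> g) j = (rep \<circ> g) j'"
    then obtain w w' where "eval_word p q w (g j) = eval_word p q w' (g j')" using rep by (metis comp_apply)
    moreover obtain v where "\<And>x. eval_word p q v (eval_word p q w' x) = x" using eval_word_inverse by blast
    ultimately have "eval_word p q (v @ w) (g j) = g j'" by (simp add: eval_word_append)
    then show "j = j'" using g by blast
  qed
  then have "infinite (range (rep \<circ> g))" by (rule range_inj_infinite)
  moreover have "range (rep \<circ> g) \<subseteq> range rep" by auto
  ultimately have "infinite (range rep)" using finite_subset by blast
  then have \<tau>: "bij_betw (from_nat_into (range rep)) UNIV (range rep)"
    by (intro bij_betw_from_nat_into) auto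
  define \<tau> where "\<tau> = from_nat_into (range rep)"
  have \<tau>_range: "\<tau> j \<in> range rep" for j using \<tau> unfolding \<tau>_def bij_betw_def by blast
  have rep\<tau>: "rep (\<tau> j) = \<tau> j" for j using \<tau>_range[of j] rep rep_eq by (metis rangeE)
  define \<phi> where "\<phi> y = eval_word p q (snd y) (\<tau> (fst y))" for y :: "nat \<times> (bool \<times> bool) list"
  have "inj_on \<phi> (UNIV \<times> {w. reduced w})"
  proof (rule inj_onI)
    fix y y' assume y: "y \<in> UNIV \<times> {w. reduced w}" "y' \<in> UNIV \<times> {w. reduced w}" and eq: "\<phi> y = \<phi> y'"
    then have "rep (\<phi> y) = rep (\<phi> y')" by simp
    then have "\<tau> (fst y) = \<tau> (fst y')" by (simp add: \<phi>_def rep_eq rep\<tau>)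
    then have 1: "fst y = fst y'" using \<tau> unfolding \<tau>_def bij_betw_def by (meson injD)
    moreover have "snd y = snd y'"
      using y eq by (intro eval_word_unique[OF free[of "\<tau> (fst y)"]]) (auto simp: \<phi>_def 1)
    ultimately show "y = y'" by (simp add: prod_eq_iff)
  qed
  moreover have "x \<in> \<phi> ` (UNIV \<times> {w. reduced w})" for x
  proof -
    obtain w where w: "rep x = eval_word p q w x" using rep by blast
    obtain v where v: "\<And>x. eval_word p q v (eval_word p q w x) = x" using eval_word_inverse by blast
    obtain u where u: "reduced u" "\<And>x. eval_word p q u x = eval_word p q v x" using eval_word_reduce by blast
    obtain j where j: "\<tau> j = rep x" using \<tau> unfolding \<tau>_def bij_betw_def by (metis rangeE rangeI)
    have "\<phi> (j, u) = x" using u v w by (simp add: \<phi>_def j)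
    then show ?thesis using u(1) by force
  qed
  ultimately have "bij_betw \<phi> (UNIV \<times> {w. reduced w}) UNIV"
    unfolding bij_betw_def by blast
  moreover have "p (\<phi> (j, w)) = \<phi> (j, lmul (True, True) w)" "q (\<phi> (j, w)) = \<phi> (j, lmul (False, True) w)" for j w
    by (simp_all add: \<phi>_def eval_lmul pm_def)
  ultimately show ?thesis by blast
qed

end

lemma eval_word_swap: "eval_word q p w = eval_word p q (map (apfst Not) w)"
proof
  show "eval_word q p w x = eval_word p q (map (apfst Not) w) x" for x
    by (induction w) auto
qed

lemma reduced_swap: "reduced (map (apfst Not) w) \<longleftrightarrow> reduced w"
  by (induction w rule: reduced.induct) auto

text \<open>Two chains with free ends \<open>a 0, a m\<close> and \<open>d 0, d 2\<close> are glued to a cycle of length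
  \<open>m + 2\<close> by an isomorphism of the free actions of \<open>(a 0, a m)\<close> and \<open>(d 2, d 0)\<close>.\<close>

lemma ex_higman_permutations:
  assumes "n \<ge> 4"
  shows "\<exists>A :: nat \<Rightarrow> nat \<Rightarrow> nat. (\<forall>i. bij (A i)) \<and>
    (\<forall>i<n. \<forall>x. A (Suc i mod n) (A i x) = A i (A i (A (Suc i mod n) x))) \<and> (\<exists>x. A 0 x \<noteq> x)"
proof -
  \<comment> \<open>Two relations are left to the second chain. Both chains need at least two for
    free ends, which is where \<open>n \<ge> 4\<close> enters.\<close>
  define m where "m = n - 2"
  have m: "n = m + 2" "m \<ge> 2" using assms by (simp_all add: m_def)
  obtain a :: "nat \<Rightarrow> nat \<Rightarrow> nat" and ga where "free_chain m a ga"
    using ex_free_chain[OF m(2)] by blast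
  then have a: "\<And>i. bij (a i)"
    "\<And>i x. i < m \<Longrightarrow> a (Suc i) (a i x) = a i (a i (a (Suc i) x))" "\<And>x. free_at (a 0) (a m) x"
    "\<forall>j j' w. eval_word (a 0) (a m) w (ga j) = ga j' \<longrightarrow> j = j'"
    by (simp_all add: free_chain_def)
  obtain d :: "nat \<Rightarrow> nat \<Rightarrow> nat" and gd where "free_chain 2 d gd"
    using ex_free_chain[OF order_refl] by blast
  then have d: "\<And>i. bij (d i)"
    "\<And>i x. i < 2 \<Longrightarrow> d (Suc i) (d i x) = d i (d i (d (Suc i) x))" "\<And>x. free_at (d 0) (d 2) x"
    "\<forall>j j' w. eval_word (d 0) (d 2) w (gd j) = gd j' \<longrightarrow> j = j'"
    by (simp_all add: free_chain_def)
  have d': "free_at (d 2) (d 0) x" for x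
    using d(3)[of x] unfolding free_at_def eval_word_swap[of "d 2"]
    by (metis reduced_swap map_is_Nil_conv)
  have gd': "\<forall>j j' w. eval_word (d 2) (d 0) w (gd j) = gd j' \<longrightarrow> j = j'"
    using d(4) unfolding eval_word_swap[of "d 2"] by blast
  let ?M = "UNIV \<times> {w. reduced w} :: (nat \<times> (bool \<times> bool) list) set"
  obtain \<phi> where \<phi>: "bij_betw \<phi> ?M UNIV" "\<And>j w. a 0 (\<phi> (j, w)) = \<phi> (j, lmul (True, True) w)"
      "\<And>j w. a m (\<phi> (j, w)) = \<phi> (j, lmul (False, True) w)"
    using ex_free_coordinates[OF a(1) a(1) a(3) a(4)] by blast
  obtain \<psi> where \<psi>: "bij_betw \<psi> ?M UNIV" "\<And>j w. d 2 (\<psi> (j, w)) = \<psi> (j, lmul (True, True) w)"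
      "\<And>j w. d 0 (\<psi> (j, w)) = \<psi> (j, lmul (False, True) w)"
    using ex_free_coordinates[OF d(1) d(1) d' gd'] by blast
  \<comment> \<open>The map identifies \<open>a 0\<close> with \<open>d 2\<close> and
    \<open>a m\<close> with \<open>d 0\<close>, so that \<open>d 1\<close> becomes the one missing
    generator between \<open>a m\<close> and \<open>a 0\<close>.\<close>
  define \<theta> where "\<theta> = \<psi> \<circ> inv_into ?M \<phi>"
  have bij_\<theta>: "bij \<theta>"
    unfolding \<theta>_def using bij_betw_trans[OF bij_betw_inv_into[OF \<phi>(1)] \<psi>(1)] .
  have \<theta>: "\<theta> (\<phi> (j, w)) = \<psi> (j, w)" if "reduced w" for j w
    using inv_into_f_f[OF bij_betw_imp_inj_on[OF \<phi>(1)], of "(j, w)"] that by (simp add: \<theta>_def)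
  have conj: "\<theta> (a 0 x) = d 2 (\<theta> x) \<and> \<theta> (a m x) = d 0 (\<theta> x)" for x
  proof -
    have "x \<in> \<phi> ` ?M" using bij_betw_imp_surj_on[OF \<phi>(1)] by simp
    then obtain j w where "x = \<phi> (j, w)" "reduced w" by blast
    then show ?thesis by (simp add: \<phi>(2,3) \<psi>(2,3) \<theta> reduced_lmul)
  qed
  have \<theta>_inv: "\<theta> (inv \<theta> x) = x" "inv \<theta> (\<theta> x) = x" for x
    using bij_\<theta> by (simp_all add: bij_is_inj bij_is_surj surj_f_inv_f)
  define b where "b = inv \<theta> \<circ> d 1 \<circ> \<theta>"
  have \<theta>_b: "\<theta> (b x) = d 1 (\<theta> x)" for x by (simp add: b_def \<theta>_inv)
  have \<theta>_eq: "x = y" if "\<theta> x = \<theta> y" for x y using that \<theta>_inv(2) by metis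
  define A where "A i = (if i \<le> m then a i else b)" for i
  have "bij (A i)" for i
    unfolding A_def b_def using a(1) d(1) bij_\<theta> by (auto intro: bij_comp bij_imp_bij_inv)
  moreover have "A (Suc i mod n) (A i x) = A i (A i (A (Suc i mod n) x))" if i: "i < n" for i x
  proof -
    consider "i < m" | "i = m" | "i = Suc m" using i m by linarith
    then show ?thesis
    proof cases
      case 1
      then show ?thesis using a(2) m by (simp add: A_def)
    next
      case 2
      have "b (a m x) = a m (a m (b x))"
        by (rule \<theta>_eq) (use d(2)[of 0] in \<open>simp add: conj \<theta>_b\<close>)
      then show ?thesis using 2 m by (simp add: A_def)
    next
      case 3
      have "a 0 (b x) = b (b (a 0 x))"
        by (rule \<theta>_eq) (use d(2)[of 1] in \<open>simp add: conj \<theta>_b numeral_2_eq_2\<close>)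
      then show ?thesis using 3 m by (simp add: A_def)
    qed
  qed
  moreover have "A 0 x \<noteq> x" for x
    using a(3)[of x] unfolding free_at_def by (auto simp: A_def pm_def dest!: spec[of _ "[(True, True)]"])
  ultimately show ?thesis by blast
qed

section \<open>Orbits of the Collatz map\<close>

lemma parity_cases:
  obtains k where "(n::nat) = 2 * k" | k where "n = 2 * k + 1"
  by (metis evenE oddE)

lemma collatz_double: "collatz (2 * n) = n" and collatz_odd: "collatz (2 * n + 1) = 2 * (3 * n + 2)"
  by (simp_all add: collatz_def)

lemma collatz_period_2: "y > 0 \<Longrightarrow> collatz (collatz y) \<noteq> y"
proof (cases y rule: parity_cases)
  case (1 k)
  assume "y > 0"
  with 1 show ?thesis unfolding 1 collatz_double by (auto simp: collatz_def)
next
  case (2 k)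
  show ?thesis unfolding 2 collatz_odd collatz_double by simp
qed

text \<open>Cycles of length three must be located because Higman's group with three generators is
  trivial; the parity cases leave linear equations.\<close>

lemma collatz_period_3:
  assumes "y > 0" "collatz (collatz (collatz y)) = y"
  shows "y \<in> {1, 2, 4}"
proof (cases y rule: parity_cases)
  case (1 k)
  with assms have eq: "collatz (collatz k) = 2 * k" "k > 0" by (auto simp: collatz_double)
  show ?thesis
  proof (cases k rule: parity_cases)
    case (1 l)
    with eq have "collatz l = 4 * l" "l > 0" by (auto simp: collatz_double)
    then have "l = 1" unfolding collatz_def by (auto split: if_splits)
    then show ?thesis using \<open>y = 2 * k\<close> 1 by simp
  next
    case (2 l)
    then have "3 * l + 2 = 2 * (2 * l + 1)" using eq(1) unfolding 2 collatz_odd collatz_double by simp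
    then show ?thesis using \<open>y = 2 * k\<close> 2 by simp
  qed
next
  case (2 k)
  then have eq: "collatz (3 * k + 2) = 2 * k + 1" using assms(2) unfolding 2 collatz_odd collatz_double by simp
  then have "k = 0" unfolding collatz_def by (auto split: if_splits)
  then show ?thesis using 2 by simp
qed

text \<open>Generators outside \<open>S\<close> act as the identity, and the relation of such an
  \<open>i\<close> then holds however \<open>collatz i\<close> acts; so \<open>S\<close> only has to
  be closed in the forward direction.\<close>

lemma nontrivial_action_of_indexing:
  assumes "n \<ge> 4" and S: "\<And>j. j \<in> S \<Longrightarrow> collatz j \<in> S \<and> idx (collatz j) = Suc (idx j) mod n \<and> idx j < n"
    and j0: "j0 \<in> S" "idx j0 = 0"
  shows "\<exists>act :: nat \<Rightarrow> nat \<Rightarrow> nat. collatz_action act \<and> (\<exists>x. act j0 x \<noteq> x)"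
proof -
  obtain A :: "nat \<Rightarrow> nat \<Rightarrow> nat" where A: "\<And>i. bij (A i)"
    "\<And>i x. i < n \<Longrightarrow> A (Suc i mod n) (A i x) = A i (A i (A (Suc i mod n) x))" "\<exists>x. A 0 x \<noteq> x"
    using ex_higman_permutations[OF assms(1)] by blast
  let ?act = "\<lambda>j. if j \<in> S then A (idx j) else id"
  have "collatz_action ?act"
  proof
    show "bij (?act i)" for i using A(1) by simp
    show "?act (collatz i) (?act i x) = ?act i (?act i (?act (collatz i) x))" for i x
      using S[of i] A(2)[of "idx i" x] by (cases "i \<in> S") auto
  qed
  moreover have "\<exists>x. ?act j0 x \<noteq> x" using A(3) j0 by simp
  ultimately show ?thesis by blast
qed

lemma nontrivial_action:
  assumes "i > 0" "\<And>k. (collatz ^^ k) i \<noteq> 1"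
  shows "\<exists>(act :: nat \<Rightarrow> nat \<Rightarrow> nat) j x. collatz_action act \<and> j > 0 \<and> act j x \<noteq> x"
proof -
  have pos: "(collatz ^^ k) i > 0" for k
    using \<open>i > 0\<close> by (induction k) (auto intro: collatz_pos)
  show ?thesis
  proof (cases "inj (\<lambda>k. (collatz ^^ k) i)")
    case True
    let ?o = "\<lambda>k. (collatz ^^ k) i"
    have idx: "inv ?o (?o k) = k" for k using True by (rule inv_f_f)
    have "\<exists>act :: nat \<Rightarrow> nat \<Rightarrow> nat. collatz_action act \<and> (\<exists>x. act i x \<noteq> x)"
    proof (rule nontrivial_action_of_indexing[where n = 4 and S = "range ?o" and idx = "\<lambda>j. inv ?o j mod 4"])
      fix j assume "j \<in> range ?o"
      then obtain k where j: "j = ?o k" by blast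
      then have "collatz j = ?o (Suc k)" by simp
      then show "collatz j \<in> range ?o \<and> inv ?o (collatz j) mod 4 = Suc (inv ?o j mod 4) mod 4 \<and> inv ?o j mod 4 < 4"
        using idx[of k] idx[of "Suc k"] rangeI[of ?o "Suc k"] j by (simp add: mod_Suc_eq)
    next
      show "i \<in> range ?o" using rangeI[of ?o 0] by simp
      show "inv ?o i mod 4 = 0" using idx[of 0] by simp
    qed simp
    then show ?thesis using \<open>i > 0\<close> by blast
  next
    case False
    then obtain a b where "a < b" and ab: "(collatz ^^ a) i = (collatz ^^ b) i"
      unfolding inj_def by (metis linorder_neqE_nat)
    define y where "y = (collatz ^^ a) i"
    have y_pos: "y > 0" using pos by (simp add: y_def)
    have y_not: "(collatz ^^ k) y \<noteq> 1" for k
      using assms(2)[of "k + a"] by (simp add: y_def funpow_add)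
    have "(collatz ^^ (b - a)) y = (collatz ^^ (b - a + a)) i"
      unfolding y_def by (simp only: funpow_add o_apply)
    then have "(collatz ^^ (b - a)) y = y" using ab \<open>a < b\<close> by (simp add: y_def)
    then have ex: "b - a > 0 \<and> (collatz ^^ (b - a)) y = y" using \<open>a < b\<close> by simp
    define n where "n = (LEAST n. n > 0 \<and> (collatz ^^ n) y = y)"
    have n: "n > 0" "(collatz ^^ n) y = y"
      using LeastI[of "\<lambda>n. n > 0 \<and> (collatz ^^ n) y = y", OF ex] by (simp_all add: n_def)
    have least: "n \<le> k" if "k > 0" "(collatz ^^ k) y = y" for k
      unfolding n_def using that by (intro Least_le) simp
    have "n \<noteq> 1" using n collatz_neq[OF y_pos] by auto
    moreover have "n \<noteq> 2" using n collatz_period_2[OF y_pos] by (auto simp: numeral_2_eq_2)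
    moreover have "n \<noteq> 3"
    proof
      assume "n = 3"
      then have "y \<in> {1, 2, 4}" using n collatz_period_3[OF y_pos] by (simp add: numeral_3_eq_3)
      moreover have "collatz 2 = 1" "collatz 4 = 2" by (simp_all add: collatz_def)
      ultimately show False using y_not[of 0] y_not[of "Suc 0"] y_not[of "Suc (Suc 0)"] by auto
    qed
    ultimately have "n \<ge> 4" using n(1) by linarith
    let ?o = "\<lambda>k. (collatz ^^ k) y"
    have inj: "k = l" if "k < n" "l < n" "?o k = ?o l" for k l
    proof -
      have "False" if "k < l" "l < n" "?o k = ?o l" for k l
      proof -
        \<comment> \<open>Completing the cycle from equal points at positions \<open>k < l\<close>
          gives the period \<open>n - l + k\<close>, which is smaller than \<open>n\<close>.\<close>
        have "?o (n - l + k) = ?o (n - l + l)" using that(3) by (simp only: funpow_add o_apply)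
        then have "n \<le> n - l + k" using n that by (intro least) auto
        then show False using that by simp
      qed
      then show ?thesis using that by (metis linorder_neqE_nat)
    qed
    let ?S = "?o ` {..<n}"
    have idx: "inv_into {..<n} ?o (?o k) = k" if "k < n" for k
      using that by (intro inv_into_f_f inj_onI) (auto intro: inj)
    have "\<exists>act :: nat \<Rightarrow> nat \<Rightarrow> nat. collatz_action act \<and> (\<exists>x. act y x \<noteq> x)"
    proof (rule nontrivial_action_of_indexing[OF \<open>n \<ge> 4\<close>, where S = ?S and idx = "inv_into {..<n} ?o"])
      fix j assume "j \<in> ?S"
      then obtain k where k: "k < n" "j = ?o k" by blast
      have "collatz j = ?o (Suc k mod n)"
        using k n by (cases "Suc k = n") auto
      moreover have "Suc k mod n < n" using n(1) by simp
      ultimately show "collatz j \<in> ?S \<and> inv_into {..<n} ?o (collatz j) = Suc (inv_into {..<n} ?o j) mod n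
          \<and> inv_into {..<n} ?o j < n"
        using idx[OF k(1)] idx[of "Suc k mod n"] k by simp
    next
      show "y \<in> ?S" using n(1) by (intro image_eqI[of _ _ 0]) auto
      show "inv_into {..<n} ?o y = 0" using idx[of 0] n(1) by simp
    qed
    then show ?thesis using y_pos by blast
  qed
qed

theorem corollary3:
  shows "contractible_space (presentation_complex collatz_presentation) \<longleftrightarrow>
         (\<forall>i::nat. i > 0 \<longrightarrow> 1 \<in> {(collatz ^^ k) i | k. True})"
  unfolding collatz_complex_def[symmetric] contractible_space_collatz_complex
proof
  assume contr: "contractible (UNIV :: pc set)"
  show "\<forall>i::nat. i > 0 \<longrightarrow> 1 \<in> {(collatz ^^ k) i | k. True}"
  proof (intro allI impI, rule ccontr)
    fix i :: nat assume "i > 0" "1 \<notin> {(collatz ^^ k) i | k. True}"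
    then have "(collatz ^^ k) i \<noteq> 1" for k by (auto dest: spec[of _ k])
    from nontrivial_action[OF \<open>i > 0\<close> this] obtain act :: "nat \<Rightarrow> nat \<Rightarrow> nat" and j x
      where act: "collatz_action act" "j > 0" "act j x \<noteq> x" by blast
    from collatz_action.contractible_imp_trivial[OF act(1) contr act(2)] act(3)
    show False by simp
  qed
qed (rule contractible_if_collatz)

end
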